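(* Let $f$ be an inner function with $f(0)=0$ which is not a rotation. Let $\{a_{n}\}_{n\ge1}$ be a sequence of complex numbers with $\sum_{n=1}^\infty |a_{n}|^{2}<\infty$ and $F=\sum_{n=1}^\infty a_{n}f^{n}$. Assume there exists an arc $I\subset \partial\mathbb{D}$ such that $\sup\{|F(\xi)|:\xi\in I\}<\infty$. Then $\sum_{n=1}^\infty |a_{n}|<\infty$.
   Context: $\mathbb{D}$ is the open unit disc and $\partial\mathbb{D}$ the unit circle. An inner function is an analytic mapping $f:\mathbb{D}\to\mathbb{D}$ whose radial limits have modulus one at almost every point of $\partial\mathbb{D}$. A rotation is a map $z\mapsto \lambda z$ with $|\lambda|=1$. $f^{n}$ denotes the $n$-th iterate of $f$ (not the power). When $\sum|a_n|^2<\infty$, the series $\sum a_nf^n$ converges in the Hardy space $\mathbb{H}^2(\mathbb{D})$ (hence uniformly on compact subsets of $\mathbb{D}$), and $F\in\mathbb{H}^2(\mathbb{D})$ denotes its sum. For $\xi\in\partial\mathbb{D}$, $F(\xi)$ denotes the non-tangential limit of $F$ at $\xi$, which exists for almost every $\xi$; the supremum over $\xi\in I$ is over the points of $I$ where this limit exists. Arcs are nondegenerate (positive length). *)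

theory Defs
  imports "HOL-Complex_Analysis.Complex_Analysis"
begin

(* Functions on the unit disc are total functions on complex; their values
   outside ball 0 1 never matter. *)

definition radial_limit :: "(complex \<Rightarrow> complex) \<Rightarrow> complex \<Rightarrow> complex \<Rightarrow> bool" where
  "radial_limit f \<xi> w \<longleftrightarrow> ((\<lambda>r::real. f (of_real r * \<xi>)) \<longlongrightarrow> w) (at_left 1)"

(* "Almost every point" of the circle refers to arc length, that is, to Lebesgue measure
   in the angle t. *)
definition inner_function :: "(complex \<Rightarrow> complex) \<Rightarrow> bool" where
  "inner_function f \<longleftrightarrow>
     f holomorphic_on ball 0 1 \<and> f ` ball 0 1 \<subseteq> ball 0 1 \<and>
     (AE t in lebesgue_on {0..2*pi}. \<exists>w. radial_limit f (cis t) w \<and> norm w = 1)"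

definition rotation :: "(complex \<Rightarrow> complex) \<Rightarrow> bool" where
  "rotation f \<longleftrightarrow> (\<exists>c. norm c = 1 \<and> (\<forall>z\<in>ball 0 1. f z = c * z))"

definition square_mean :: "(complex \<Rightarrow> complex) \<Rightarrow> real \<Rightarrow> real" where
  "square_mean g r = (1 / (2*pi)) * integral {0..2*pi} (\<lambda>t. (norm (g (of_real r * cis t)))\<^sup>2)"

definition hardy2 :: "(complex \<Rightarrow> complex) set" where
  "hardy2 = {g. g holomorphic_on ball 0 1 \<and> bdd_above (square_mean g ` {0..<1})}"

(* The supremum is a real one, so this is meaningful for elements of hardy2 only. *)
definition hardy2_norm :: "(complex \<Rightarrow> complex) \<Rightarrow> real" where
  "hardy2_norm g = sqrt (SUP r\<in>{0..<1}. square_mean g r)"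

definition hardy2_sums :: "(nat \<Rightarrow> complex \<Rightarrow> complex) \<Rightarrow> (complex \<Rightarrow> complex) \<Rightarrow> bool" where
  "hardy2_sums u F \<longleftrightarrow>
     (\<forall>n. u n \<in> hardy2) \<and> F \<in> hardy2 \<and>
     (\<lambda>N. hardy2_norm (\<lambda>z. F z - (\<Sum>n<N. u n z))) \<longlonglongrightarrow> 0"

(* Empty for \<alpha> \<le> 1, since dist z \<xi> \<ge> 1 - norm z whenever norm \<xi> = 1. *)
definition stolz_region :: "complex \<Rightarrow> real \<Rightarrow> complex set" where
  "stolz_region \<xi> \<alpha> = {z \<in> ball 0 1. dist z \<xi> < \<alpha> * (1 - norm z)}"

definition nontangential_limit :: "(complex \<Rightarrow> complex) \<Rightarrow> complex \<Rightarrow> complex \<Rightarrow> bool" where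
  "nontangential_limit F \<xi> w \<longleftrightarrow> (\<forall>\<alpha>>1. (F \<longlongrightarrow> w) (at \<xi> within stolz_region \<xi> \<alpha>))"

(* Arcs of positive length, with or without their endpoints, up to the full circle. *)
definition circle_arc :: "complex set \<Rightarrow> bool" where
  "circle_arc I \<longleftrightarrow>
     (\<exists>s t. s < t \<and> t \<le> s + 2*pi \<and> cis ` {s<..<t} \<subseteq> I \<and> I \<subseteq> cis ` {s..t})"

end

(* Write l = f'(0) and d_k = f^k - conj(l) f^(k+1). By Schwarz's lemma |l| < 1. The d_k are reverse
   martingale differences on the circle: given the boundary values of f^(k+1), the conditional
   expectation of d_k is 0 and that of |d_k|^2 is 1 - |l|^2. Summation by parts turns sum a_n f^n
   into sum c_k d_k with a_k = c_k - conj(l) c_(k-1), so it suffices to bound sum |c_k|. The Riesz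
   product prod (1 + delta Re(b_k d_k)) is nonnegative with mean 1, and its correlation with d_k is
   (delta/2)(1 - |l|^2) conj(b_k) up to an error of order delta^2. For b_k = sgn c_k and small delta,
   its correlation with the series is therefore at least a constant times sum |c_k|, whereas it is
   at most the supremum of |F|. To work on the arc only, one multiplies by a weight supported over
   the arc and lets the product start at a high iterate, given whose boundary values the weight has
   nearly constant conditional expectation because the Taylor coefficients of the iterates tend to 0.

   That F is bounded near a smaller arc is seen from its primitive H, which extends continuously
   to the closed disc and is absolutely continuous on the circle. At almost every boundary point H has
   a tangential derivative, and F has the corresponding nontangential limit there (Fatou). Hence H
   is Lipschitz on the arc, and the tangential derivative of the Poisson kernel turns this into a
   bound for F = H' up to the arc. *)
theory Submission
  imports Defs
begin

section \<open>Circle means\<close>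

text \<open>The obstacle is that the series converges to F only in mean square, whereas the Riesz
  products are controlled only in mean. The series is therefore cut at N. The block of terms from
  N+1 up to a much later N' is a function of f^(N+1), given which the product over indices up to N
  has conditional expectation 1, so inserting the product does not change the mean square of the
  block. Only the remainder beyond N' is multiplied by the supremum of the product, and N' is chosen
  once that supremum is known.

  The error of order delta^2 has a single source: the conditional expectation of d_k^2 given f^(k+1)
  is conj(f_2) f^(k+1), where f_2 is the second Taylor coefficient of f, and it need not vanish. The
  correlation of f^(k+1) with the later factors is at most delta / (1 - |l|), the fixed point of x =
  |l| x + delta. Hence delta = (1 - |l|)(1 - |l|^2)/2 makes the error at most half of the main
  term.\<close>

definition circ_mean :: "real \<Rightarrow> (complex \<Rightarrow> 'a::euclidean_space) \<Rightarrow> 'a" where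
  "circ_mean r X = (1 / (2*pi)) *\<^sub>R integral {0..2*pi} (\<lambda>t. X (of_real r * cis t))"

lemma norm_circle_point [simp]: "norm (of_real r * cis t) = \<bar>r\<bar>"
  by (simp add: norm_mult)

lemma continuous_on_circle:
  assumes "continuous_on (ball 0 1) X" "\<bar>r\<bar> < 1"
  shows "continuous_on S (\<lambda>t. X (of_real r * cis t))"
  by (rule continuous_on_compose2[OF assms(1)]) (use assms(2) in \<open>auto intro!: continuous_intros\<close>)

lemma integrable_circle:
  fixes X :: "complex \<Rightarrow> 'a::euclidean_space"
  assumes "continuous_on (ball 0 1) X" "\<bar>r\<bar> < 1"
  shows "(\<lambda>t. X (of_real r * cis t)) integrable_on {a..b}"
  by (intro integrable_continuous_real continuous_on_circle assms)

context
  fixes r :: real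
  assumes r: "\<bar>r\<bar> < 1"
begin

lemma circ_mean_cong:
  assumes "\<And>z. norm z = \<bar>r\<bar> \<Longrightarrow> X z = Y z"
  shows "circ_mean r X = circ_mean r Y"
  unfolding circ_mean_def using assms by simp

lemma circ_mean_add:
  assumes "continuous_on (ball 0 1) X" "continuous_on (ball 0 1) Y"
  shows "circ_mean r (\<lambda>z. X z + Y z) = circ_mean r X + circ_mean r Y"
  unfolding circ_mean_def
  by (subst integral_add) (use assms r in \<open>simp_all add: integrable_circle scaleR_right_distrib scaleR_right_diff_distrib\<close>)

lemma circ_mean_diff:
  assumes "continuous_on (ball 0 1) X" "continuous_on (ball 0 1) Y"
  shows "circ_mean r (\<lambda>z. X z - Y z) = circ_mean r X - circ_mean r Y"
  unfolding circ_mean_def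
  by (subst integral_diff) (use assms r in \<open>simp_all add: integrable_circle scaleR_right_distrib scaleR_right_diff_distrib\<close>)

lemma circ_mean_linear:
  fixes X :: "complex \<Rightarrow> 'a::euclidean_space" and L :: "'a \<Rightarrow> 'b::euclidean_space"
  assumes "continuous_on (ball 0 1) X" "bounded_linear L"
  shows "circ_mean r (\<lambda>z. L (X z)) = L (circ_mean r X)"
proof -
  interpret bounded_linear L by fact
  have "integral {0..2*pi} (L \<circ> (\<lambda>t. X (of_real r * cis t))) = L (integral {0..2*pi} (\<lambda>t. X (of_real r * cis t)))"
    by (rule integral_linear[OF integrable_circle[OF assms(1) r] assms(2)])
  thus ?thesis by (simp add: circ_mean_def o_def scaleR)
qed

lemma circ_mean_cmult:
  fixes X :: "complex \<Rightarrow> 'a::{euclidean_space,real_normed_field}"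
  assumes "continuous_on (ball 0 1) X"
  shows "circ_mean r (\<lambda>z. c * X z) = c * circ_mean r X"
  by (rule circ_mean_linear[OF assms bounded_linear_mult_right])

lemma circ_mean_cnj:
  assumes "continuous_on (ball 0 1) X"
  shows "circ_mean r (\<lambda>z. cnj (X z)) = cnj (circ_mean r X)"
  by (rule circ_mean_linear[OF assms bounded_linear_cnj])

lemma circ_mean_Re:
  assumes "continuous_on (ball 0 1) X"
  shows "circ_mean r (\<lambda>z. Re (X z)) = Re (circ_mean r X)"
  by (rule circ_mean_linear[OF assms bounded_linear_Re])

lemma circ_mean_of_real:
  assumes "continuous_on (ball 0 1) X"
  shows "circ_mean r (\<lambda>z. complex_of_real (X z)) = of_real (circ_mean r X)"
  by (rule circ_mean_linear[OF assms bounded_linear_of_real])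

lemma circ_mean_const: "circ_mean r (\<lambda>z. c) = c"
  by (simp add: circ_mean_def)

lemma circ_mean_sum:
  assumes "finite A" "\<And>i. i \<in> A \<Longrightarrow> continuous_on (ball 0 1) (X i)"
  shows "circ_mean r (\<lambda>z. \<Sum>i\<in>A. X i z) = (\<Sum>i\<in>A. circ_mean r (X i))"
  using assms
proof (induction A)
  case empty
  then show ?case by (simp add: circ_mean_const)
next
  case (insert x F)
  then show ?case by (simp add: circ_mean_add continuous_on_sum)
qed

lemma circ_mean_mono:
  fixes X Y :: "complex \<Rightarrow> real"
  assumes "continuous_on (ball 0 1) X" "continuous_on (ball 0 1) Y"
    and "\<And>z. norm z = \<bar>r\<bar> \<Longrightarrow> X z \<le> Y z"
  shows "circ_mean r X \<le> circ_mean r Y"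
  unfolding circ_mean_def real_scaleR_def
  by (intro mult_left_mono integral_le integrable_circle) (use assms r in auto)

lemma circ_mean_nonneg:
  fixes X :: "complex \<Rightarrow> real"
  assumes "continuous_on (ball 0 1) X" "\<And>z. norm z = \<bar>r\<bar> \<Longrightarrow> X z \<ge> 0"
  shows "circ_mean r X \<ge> 0"
  using circ_mean_mono[of "\<lambda>_. 0" X] assms by (simp add: circ_mean_const)

lemma norm_circ_mean_le:
  fixes X :: "complex \<Rightarrow> 'a::euclidean_space"
  assumes "continuous_on (ball 0 1) X"
  shows "norm (circ_mean r X) \<le> circ_mean r (\<lambda>z. norm (X z))"
proof -
  have "norm (integral {0..2*pi} (\<lambda>t. X (of_real r * cis t))) \<le> integral {0..2*pi} (\<lambda>t. norm (X (of_real r * cis t)))"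
    by (intro integral_norm_bound_integral integrable_circle) (use assms r in \<open>auto intro!: continuous_intros\<close>)
  thus ?thesis by (simp add: circ_mean_def divide_right_mono)
qed

lemma circ_mean_le_bound:
  fixes X :: "complex \<Rightarrow> 'a::euclidean_space"
  assumes "continuous_on (ball 0 1) X" "\<And>z. norm z = \<bar>r\<bar> \<Longrightarrow> norm (X z) \<le> C"
  shows "norm (circ_mean r X) \<le> C"
proof -
  have "norm (circ_mean r X) \<le> circ_mean r (\<lambda>z. norm (X z))" by (rule norm_circ_mean_le[OF assms(1)])
  also have "\<dots> \<le> circ_mean r (\<lambda>z. C)"
    by (rule circ_mean_mono) (use assms in \<open>auto intro!: continuous_intros\<close>)
  finally show ?thesis by (simp add: circ_mean_const)
qed

end

text \<open>Unlike the lemmas before it, this one admits r = 1 for functions continuous on the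
  closed disc; Parseval's identity and the Poisson kernel rely on that case.\<close>

lemma circ_mean_Cauchy:
  assumes "continuous_on (cball 0 r) G" "G holomorphic_on ball 0 r" "0 < r"
  shows "circ_mean r G = G 0"
proof -
  have "((\<lambda>u. G u / (u - 0)) has_contour_integral (2 * of_real pi * \<i> * G 0)) (circlepath 0 r)"
    by (rule Cauchy_integral_circlepath) (use assms in auto)
  hence "((\<lambda>t. G (0 + of_real r * cis t) / (of_real r * cis t) * r * \<i> * cis t) has_integral (2 * of_real pi * \<i> * G 0)) {0..2*pi}"
    by (subst (asm) circlepath_def, subst (asm) has_contour_integral_part_circlepath_iff) (use assms in auto)
  hence "((\<lambda>t. \<i> * G (of_real r * cis t)) has_integral (2 * of_real pi * \<i> * G 0)) {0..2*pi}"
    using assms by (simp add: field_simps)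
  from integral_unique[OF this] have "\<i> * integral {0..2*pi} (\<lambda>t. G (of_real r * cis t)) = 2 * of_real pi * \<i> * G 0"
    by (subst (asm) integral_mult_right) auto
  hence "integral {0..2*pi} (\<lambda>t. G (of_real r * cis t)) = 2 * of_real pi * G 0" by simp
  thus ?thesis by (simp add: circ_mean_def scaleR_conv_of_real)
qed

lemma circ_mean_holomorphic:
  assumes "G holomorphic_on ball 0 1" "0 < r" "r < 1"
  shows "circ_mean r G = G 0"
  by (rule circ_mean_Cauchy)
    (use assms in \<open>auto intro!: holomorphic_on_imp_continuous_on intro: holomorphic_on_subset\<close>)

section \<open>Bounded continuous and bounded holomorphic functions on the disc\<close>

definition cb :: "(complex \<Rightarrow> 'a::real_normed_vector) \<Rightarrow> bool" where
  "cb X \<longleftrightarrow> continuous_on (ball 0 1) X \<and> bounded (X ` ball 0 1)"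

definition bh :: "(complex \<Rightarrow> complex) \<Rightarrow> bool" where
  "bh G \<longleftrightarrow> G holomorphic_on ball 0 1 \<and> bounded (G ` ball 0 1)"

lemma cb_iff: "cb X \<longleftrightarrow> continuous_on (ball 0 1) X \<and> (\<exists>K. \<forall>z. norm z < 1 \<longrightarrow> norm (X z) \<le> K)"
  unfolding cb_def bounded_iff ball_simps unfolding Ball_def mem_ball_0 ..

lemma cbI: "continuous_on (ball 0 1) X \<Longrightarrow> (\<And>z. norm z < 1 \<Longrightarrow> norm (X z) \<le> K) \<Longrightarrow> cb X"
  unfolding cb_iff by auto

lemma cb_bound:
  assumes "cb X" obtains K where "K > 0" "\<And>z. norm z < 1 \<Longrightarrow> norm (X z) \<le> K"
  using assms unfolding cb_iff by (metis gt_ex less_eq_real_def order_trans linorder_not_le)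

lemma bhI: "G holomorphic_on ball 0 1 \<Longrightarrow> (\<And>z. norm z < 1 \<Longrightarrow> norm (G z) \<le> K) \<Longrightarrow> bh G"
  unfolding bh_def bounded_iff ball_simps unfolding Ball_def mem_ball_0 by blast

lemma bh_imp_cb: "bh G \<Longrightarrow> cb G"
  unfolding bh_def cb_def by (auto intro: holomorphic_on_imp_continuous_on)

lemma cb_cont: "cb X \<Longrightarrow> continuous_on (ball 0 1) X"
  by (simp add: cb_def)

lemma continuous_on_cball_imp_cb: assumes "continuous_on (cball 0 1) X" shows "cb X"
  unfolding cb_def
proof
  show "continuous_on (ball 0 1) X" by (rule continuous_on_subset[OF assms]) auto
  have "bounded (X ` cball 0 1)" by (intro compact_imp_bounded compact_continuous_image assms) auto
  thus "bounded (X ` ball 0 1)" by (rule bounded_subset) auto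
qed

lemma cb_const [intro!, simp]: "cb (\<lambda>z. c)"
  by (rule cbI) auto

lemma cb_add [intro!]: assumes "cb X" "cb Y" shows "cb (\<lambda>z. X z + Y z)"
proof -
  obtain K L where "\<And>z. norm z < 1 \<Longrightarrow> norm (X z) \<le> K" "\<And>z. norm z < 1 \<Longrightarrow> norm (Y z) \<le> L"
    using assms by (metis cb_bound)
  thus ?thesis using assms
    by (intro cbI[where K = "K + L"]) (auto intro!: continuous_intros norm_triangle_mono dest: cb_cont)
qed

lemma cb_mult [intro!]:
  fixes X Y :: "complex \<Rightarrow> 'a::real_normed_algebra"
  assumes "cb X" "cb Y" shows "cb (\<lambda>z. X z * Y z)"
proof -
  obtain K L where "K > 0" "\<And>z. norm z < 1 \<Longrightarrow> norm (X z) \<le> K" "\<And>z. norm z < 1 \<Longrightarrow> norm (Y z) \<le> L"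
    using assms by (metis cb_bound)
  thus ?thesis using assms
    by (intro cbI[where K = "K * L"])
      (auto intro!: continuous_intros order_trans[OF norm_mult_ineq] mult_mono dest: cb_cont)
qed

lemma cb_linear:
  assumes "cb X" "bounded_linear L" shows "cb (\<lambda>z. L (X z))"
proof -
  obtain K where K: "\<And>z. norm z < 1 \<Longrightarrow> norm (X z) \<le> K" using assms by (metis cb_bound)
  obtain B where B: "B > 0" "\<And>x. norm (L x) \<le> norm x * B" using bounded_linear.pos_bounded[OF assms(2)] by blast
  show ?thesis
  proof (rule cbI[where K = "K * B"])
    show "continuous_on (ball 0 1) (\<lambda>z. L (X z))"
      by (rule bounded_linear.continuous_on[OF assms(2) cb_cont[OF assms(1)]])
    fix z :: complex assume "norm z < 1"
    have "norm (L (X z)) \<le> norm (X z) * B" by (rule B)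
    also have "\<dots> \<le> K * B" using K[OF \<open>norm z < 1\<close>] B(1) by (simp add: mult_right_mono)
    finally show "norm (L (X z)) \<le> K * B" .
  qed
qed

lemma cb_minus [intro!]: "cb X \<Longrightarrow> cb (\<lambda>z. - X z)"
  by (rule cb_linear) (auto intro: bounded_linear_minus bounded_linear_ident)

lemma cb_diff [intro!]: "cb X \<Longrightarrow> cb Y \<Longrightarrow> cb (\<lambda>z. X z - Y z)"
  using cb_add[of X "\<lambda>z. - Y z"] by auto

lemma cb_cnj [intro!]: "cb X \<Longrightarrow> cb (\<lambda>z. cnj (X z))"
  by (rule cb_linear) (auto intro: bounded_linear_cnj)

lemma cb_Re [intro!]: "cb X \<Longrightarrow> cb (\<lambda>z. Re (X z))"
  by (rule cb_linear) (auto intro: bounded_linear_Re)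

lemma cb_of_real [intro!]: "cb X \<Longrightarrow> cb (\<lambda>z. complex_of_real (X z))"
  by (rule cb_linear) (auto intro: bounded_linear_of_real)

lemma cb_norm [intro!]: "cb X \<Longrightarrow> cb (\<lambda>z. norm (X z))"
  unfolding cb_iff by (auto intro: continuous_intros)

lemma cb_power [intro!]:
  fixes X :: "complex \<Rightarrow> 'a::real_normed_field"
  shows "cb X \<Longrightarrow> cb (\<lambda>z. X z ^ n)"
  by (induction n) auto

lemma cb_sum [intro!]: "(\<And>i. i \<in> A \<Longrightarrow> cb (X i)) \<Longrightarrow> cb (\<lambda>z. \<Sum>i\<in>A. X i z)"
  by (induction A rule: infinite_finite_induct) auto

lemma cb_prod [intro!]:
  fixes X :: "'i \<Rightarrow> complex \<Rightarrow> 'a::real_normed_field"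
  shows "(\<And>i. i \<in> A \<Longrightarrow> cb (X i)) \<Longrightarrow> cb (\<lambda>z. \<Prod>i\<in>A. X i z)"
  by (induction A rule: infinite_finite_induct) auto

lemma cb_ident [intro!, simp]: "cb (\<lambda>z. z)"
  by (rule cbI[where K = 1]) auto

lemmas cb_intros = cb_const cb_ident cb_add cb_diff cb_minus cb_mult cb_cnj cb_Re cb_of_real cb_norm
  cb_power cb_sum cb_prod

lemma bh_const [intro, simp]: "bh (\<lambda>z. c)"
  by (rule bhI) auto

lemma bh_ident [intro, simp]: "bh (\<lambda>z. z)"
  by (rule bhI[where K = 1]) auto

lemma bh_iff: "bh G \<longleftrightarrow> G holomorphic_on ball 0 1 \<and> cb G"
  unfolding bh_def cb_def by (auto intro: holomorphic_on_imp_continuous_on)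

lemma bh_mult [intro]: "bh X \<Longrightarrow> bh Y \<Longrightarrow> bh (\<lambda>z. X z * Y z)"
  unfolding bh_iff by (auto intro!: holomorphic_intros)

lemma bh_power [intro]: "bh X \<Longrightarrow> bh (\<lambda>z. X z ^ n)"
  unfolding bh_iff by (auto intro!: holomorphic_intros)

lemma bh_sum [intro]: "(\<And>i. i \<in> A \<Longrightarrow> bh (X i)) \<Longrightarrow> bh (\<lambda>z. \<Sum>i\<in>A. X i z)"
  unfolding bh_iff by (auto intro!: holomorphic_intros)

lemma bh_compose:
  assumes "bh G" "u holomorphic_on ball 0 1" "u ` ball 0 1 \<subseteq> ball 0 1"
  shows "bh (\<lambda>z. G (u z))"
proof -
  have "(G \<circ> u) holomorphic_on ball 0 1"
    by (rule holomorphic_on_compose_gen[of _ _ _ "ball 0 1"]) (use assms in \<open>auto simp: bh_def\<close>)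
  moreover have "bounded ((\<lambda>z. G (u z)) ` ball 0 1)"
    using assms by (auto simp: bh_def intro: bounded_subset)
  ultimately show ?thesis by (simp add: bh_def o_def)
qed

text \<open>Functions on the circle are represented by functions on the disc, compared through their means
  over \<open>|z| = r\<close> as \<open>r\<close> tends to 1; thus no boundary values of the iterates are needed, and
  \<open>bnull X\<close> plays the role of \<open>X = 0\<close> almost everywhere on the circle.\<close>
abbreviation blim :: "(complex \<Rightarrow> 'a::euclidean_space) \<Rightarrow> 'a \<Rightarrow> bool" where
  "blim X L \<equiv> ((\<lambda>r. circ_mean r X) \<longlongrightarrow> L) (at_left 1)"

definition bnull :: "(complex \<Rightarrow> 'a::real_normed_vector) \<Rightarrow> bool" where
  "bnull X \<longleftrightarrow> blim (\<lambda>z. norm (X z)) 0"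

lemma eventually_at_left_1: "eventually (\<lambda>r::real. 0 < r \<and> r < 1) (at_left 1)"
  using eventually_at_left_real[of 0 "1::real"] by simp

lemma blim_cong:
  assumes "blim X L" "\<And>z. norm z < 1 \<Longrightarrow> X z = Y z"
  shows "blim Y L"
  by (rule Lim_transform_eventually[OF assms(1)])
    (use eventually_at_left_1 assms(2) in \<open>auto elim!: eventually_mono intro!: circ_mean_cong\<close>)

lemma blim_add:
  assumes "blim X L" "blim Y M" "cb X" "cb Y"
  shows "blim (\<lambda>z. X z + Y z) (L + M)"
  by (rule Lim_transform_eventually[OF tendsto_add[OF assms(1,2)]])
    (use eventually_at_left_1 assms in \<open>auto elim!: eventually_mono simp: circ_mean_add cb_cont\<close>)

lemma blim_diff:
  assumes "blim X L" "blim Y M" "cb X" "cb Y"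
  shows "blim (\<lambda>z. X z - Y z) (L - M)"
  by (rule Lim_transform_eventually[OF tendsto_diff[OF assms(1,2)]])
    (use eventually_at_left_1 assms in \<open>auto elim!: eventually_mono simp: circ_mean_diff cb_cont\<close>)

lemma blim_linear:
  assumes "blim X M" "cb X" "bounded_linear L"
  shows "blim (\<lambda>z. L (X z)) (L M)"
  by (rule Lim_transform_eventually[OF bounded_linear.tendsto[OF assms(3,1)]])
    (use eventually_at_left_1 assms in \<open>auto elim!: eventually_mono simp: circ_mean_linear cb_cont\<close>)

lemma blim_cmult:
  fixes X :: "complex \<Rightarrow> 'a::{euclidean_space,real_normed_field}"
  assumes "blim X M" "cb X"
  shows "blim (\<lambda>z. c * X z) (c * M)"
  by (rule blim_linear[OF assms bounded_linear_mult_right])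

lemma blim_cnj: "blim X M \<Longrightarrow> cb X \<Longrightarrow> blim (\<lambda>z. cnj (X z)) (cnj M)"
  by (rule blim_linear) (auto intro: bounded_linear_cnj)

lemma blim_sum:
  assumes "finite A" "\<And>i. i \<in> A \<Longrightarrow> blim (X i) (L i)" "\<And>i. i \<in> A \<Longrightarrow> cb (X i)"
  shows "blim (\<lambda>z. \<Sum>i\<in>A. X i z) (\<Sum>i\<in>A. L i)"
  by (rule Lim_transform_eventually[OF tendsto_sum[OF assms(2)]])
    (use eventually_at_left_1 assms in \<open>auto elim!: eventually_mono simp: circ_mean_sum cb_cont\<close>)

lemma blim_holomorphic: "G holomorphic_on ball 0 1 \<Longrightarrow> blim G (G 0)"
  by (rule tendsto_eventually) (use eventually_at_left_1 in \<open>auto elim!: eventually_mono intro!: circ_mean_holomorphic\<close>)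

lemma blim_const: "blim (\<lambda>z. c) c"
  by (rule tendsto_eventually) (use eventually_at_left_1 in \<open>auto elim!: eventually_mono simp: circ_mean_const\<close>)

lemma bnull_imp_blim: assumes "bnull X" "cb X" shows "blim X 0"
  by (rule Lim_null_comparison[OF _ assms(1)[unfolded bnull_def]])
    (use eventually_at_left_1 assms in \<open>auto elim!: eventually_mono intro!: norm_circ_mean_le cb_cont\<close>)

lemma bnull_dominated:
  assumes "bnull X" "cb X" "cb Y" "\<And>z. norm z < 1 \<Longrightarrow> norm (Y z) \<le> C * norm (X z)"
  shows "bnull Y"
  unfolding bnull_def
proof (rule Lim_null_comparison)
  have "blim (\<lambda>z. C * norm (X z)) (C * 0)"
    by (rule blim_cmult) (use assms in \<open>auto simp: bnull_def\<close>)
  thus "((\<lambda>r. circ_mean r (\<lambda>z. C * norm (X z))) \<longlongrightarrow> 0) (at_left 1)" by simp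
  show "\<forall>\<^sub>F r in at_left 1. norm (circ_mean r (\<lambda>z. norm (Y z))) \<le> circ_mean r (\<lambda>z. C * norm (X z))"
    using eventually_at_left_1
  proof eventually_elim
    case (elim r)
    have "circ_mean r (\<lambda>z. norm (Y z)) \<le> circ_mean r (\<lambda>z. C * norm (X z))"
      by (rule circ_mean_mono) (use assms elim in \<open>auto intro!: cb_cont\<close>)
    moreover have "0 \<le> circ_mean r (\<lambda>z. norm (Y z))"
      by (rule circ_mean_nonneg) (use assms elim in \<open>auto intro!: cb_cont\<close>)
    ultimately show ?case by simp
  qed
qed

lemma bnull_mult:
  fixes X Y :: "complex \<Rightarrow> 'a::{real_normed_algebra}"
  assumes "bnull X" "cb X" "cb Y" shows "bnull (\<lambda>z. X z * Y z)"
proof -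
  obtain K where K: "K > 0" "\<And>z. norm z < 1 \<Longrightarrow> norm (Y z) \<le> K" using cb_bound[OF assms(3)] by metis
  show ?thesis
  proof (rule bnull_dominated[OF assms(1,2)])
    fix z :: complex assume "norm z < 1"
    from K(2)[OF this] have "norm (X z) * norm (Y z) \<le> norm (X z) * K" by (rule mult_left_mono) auto
    thus "norm (X z * Y z) \<le> K * norm (X z)" using norm_mult_ineq[of "X z" "Y z"] by (simp add: mult.commute)
  qed (use assms in auto)
qed

text \<open>Stands in for changing a boundary function on a null set. Its typical use is to cancel
  \<open>u z * cnj (u z)\<close> for an inner function u, whose boundary values have modulus
  1.\<close>

lemma blim_bnull_diff:
  assumes "blim Y L" "bnull (\<lambda>z. X z - Y z)" "cb X" "cb Y"
  shows "blim X L"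
proof -
  have "blim (\<lambda>z. (X z - Y z) + Y z) (0 + L)"
    by (rule blim_add) (use assms in \<open>auto intro: bnull_imp_blim\<close>)
  thus ?thesis by simp
qed

section \<open>Taylor coefficients and subordination\<close>

text \<open>The backward shift, with the singularity at 0 removed.\<close>

definition shift :: "(complex \<Rightarrow> complex) \<Rightarrow> complex \<Rightarrow> complex" where
  "shift G z = (if z = 0 then deriv G 0 else (G z - G 0) / z)"

text \<open>The i-th Taylor coefficient, read off after i backward shifts. In this form the Taylor
  expansion with remainder (\<open>tcoeff_expand\<close>) is an identity at every point and raises
  no question of convergence.\<close>

definition tcoeff :: "(complex \<Rightarrow> complex) \<Rightarrow> nat \<Rightarrow> complex" where
  "tcoeff G i = (shift ^^ i) G 0"

lemma shift_eq: "G z = G 0 + z * shift G z"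
  by (simp add: shift_def)

lemma shift_holomorphic:
  assumes "G holomorphic_on ball 0 1" shows "shift G holomorphic_on ball 0 1"
proof -
  have "(\<lambda>z. if z = 0 then deriv G 0 else (G z - G 0) / (z - 0)) holomorphic_on ball 0 1"
    by (rule pole_lemma[OF assms]) auto
  thus ?thesis unfolding shift_def[abs_def] by (simp cong: if_cong)
qed

text \<open>For |z| > 1/2 the division by z costs a factor of at most 2; on the compact disc |z| <=
  1/2 continuity gives a bound.\<close>

lemma bh_shift [intro]: assumes "bh G" shows "bh (shift G)"
proof -
  have hol: "shift G holomorphic_on ball 0 1" using assms by (intro shift_holomorphic) (simp add: bh_def)
  have "compact (shift G ` cball 0 (1/2))"
    by (intro compact_continuous_image holomorphic_on_imp_continuous_on holomorphic_on_subset[OF hol]) auto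
  hence "bounded (shift G ` cball 0 (1/2))" by (rule compact_imp_bounded)
  then obtain B where B: "\<And>z. norm z \<le> 1/2 \<Longrightarrow> norm (shift G z) \<le> B"
    unfolding bounded_iff by (metis image_eqI mem_cball_0)
  obtain K where K: "K > 0" "\<And>z. norm z < 1 \<Longrightarrow> norm (G z) \<le> K"
    using cb_bound[OF bh_imp_cb[OF assms]] by metis
  show ?thesis
  proof (rule bhI[OF hol, where K = "max B (4 * K)"])
    fix z :: complex assume z: "norm z < 1"
    show "norm (shift G z) \<le> max B (4 * K)"
    proof (cases "norm z \<le> 1/2")
      case True
      thus ?thesis using B[of z] by simp
    next
      case False
      have "norm (G z - G 0) \<le> K + K"
        using K(2)[OF z] K(2)[of 0] by (intro order_trans[OF norm_triangle_ineq4] add_mono) auto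
      also have "\<dots> \<le> 4 * K * norm z" using False K(1) by simp
      finally have "norm (G z - G 0) / norm z \<le> 4 * K" using False by (subst pos_divide_le_eq) auto
      thus ?thesis using False by (auto simp: shift_def norm_divide)
    qed
  qed
qed

lemma bh_shift_pow [intro]: "bh G \<Longrightarrow> bh ((shift ^^ n) G)"
  by (induction n) auto

lemma tcoeff_0 [simp]: "tcoeff G 0 = G 0"
  by (simp add: tcoeff_def)

lemma tcoeff_Suc: "tcoeff G (Suc i) = tcoeff (shift G) i"
  by (simp add: tcoeff_def funpow_swap1)

lemma tcoeff_shift_pow: "tcoeff ((shift ^^ n) G) i = tcoeff G (i + n)"
  by (simp add: tcoeff_def funpow_add)

lemma tcoeff_expand: "G z = (\<Sum>i<n. tcoeff G i * z ^ i) + z ^ n * (shift ^^ n) G z"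
proof (induction n)
  case (Suc n)
  have "(shift ^^ n) G z = tcoeff G n + z * (shift ^^ Suc n) G z"
    using shift_eq[of "(shift ^^ n) G" z] by (simp add: tcoeff_def)
  with Suc show ?case by (simp add: algebra_simps)
qed auto

lemma shift_mult_ident:
  assumes "G holomorphic_on ball 0 1" "norm z < 1" shows "shift (\<lambda>z. z * G z) z = G z"
proof -
  have "((\<lambda>z. z * G z) has_field_derivative (1 * G 0 + deriv G 0 * 0)) (at 0)"
    by (rule DERIV_mult) (use assms in \<open>auto intro!: holomorphic_derivI[OF assms(1)]\<close>)
  thus ?thesis by (auto simp: shift_def DERIV_imp_deriv)
qed

lemma shift_cong:
  assumes "\<And>z. norm z < 1 \<Longrightarrow> G z = H z" "norm z < 1" shows "shift G z = shift H z"
proof -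
  have "deriv G 0 = deriv H 0"
    by (rule deriv_cong_ev) (use assms in \<open>auto simp: eventually_nhds intro!: exI[of _ "ball 0 1"]\<close>)
  thus ?thesis using assms by (simp add: shift_def)
qed

lemma tcoeff_cong: "(\<And>z. norm z < 1 \<Longrightarrow> G z = H z) \<Longrightarrow> tcoeff G i = tcoeff H i"
proof (induction i arbitrary: G H)
  case (Suc i)
  show ?case unfolding tcoeff_Suc by (rule Suc.IH) (rule shift_cong[OF Suc.prems])
qed auto

lemma tcoeff_mult_ident:
  assumes "G holomorphic_on ball 0 1" shows "tcoeff (\<lambda>z. z * G z) (Suc i) = tcoeff G i"
  unfolding tcoeff_Suc by (rule tcoeff_cong) (rule shift_mult_ident[OF assms])

lemma tcoeff_mult_ident_pow:
  assumes "G holomorphic_on ball 0 1"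
  shows "tcoeff (\<lambda>z. z ^ m * G z) i = (if i < m then 0 else tcoeff G (i - m))"
  using assms
proof (induction m arbitrary: i)
  case (Suc m)
  have "tcoeff (\<lambda>z. z * (z ^ m * G z)) i = (if i < Suc m then 0 else tcoeff G (i - Suc m))"
  proof (cases i)
    case (Suc j)
    thus ?thesis using Suc.prems
      by (simp add: Suc.IH tcoeff_mult_ident holomorphic_intros)
  qed simp
  thus ?case by (simp add: mult.assoc)
qed auto

lemma tcoeff_const: "tcoeff (\<lambda>z. c) i = (if i = 0 then c else 0)"
proof (cases i)
  case (Suc j)
  have "shift (\<lambda>z. c) = (\<lambda>z. 0)" by (auto simp: shift_def)
  moreover have "tcoeff (\<lambda>z. 0) j = 0"
  proof (induction j)
    case (Suc k)
    have "shift (\<lambda>z. 0) = (\<lambda>z. 0)" by (auto simp: shift_def)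
    thus ?case using Suc by (simp add: tcoeff_Suc)
  qed simp
  ultimately show ?thesis using Suc by (simp add: tcoeff_Suc)
qed simp

lemma tcoeff_power: "tcoeff (\<lambda>z. z ^ m) i = (if i = m then 1 else 0)"
  using tcoeff_mult_ident_pow[of "\<lambda>_. 1" m i] by (auto simp: tcoeff_const)

lemma cnj_power_mult_self: "cnj z ^ i * z ^ i = of_real (norm z) ^ (2 * i)"
proof -
  have "cnj z ^ i * z ^ i = (z * cnj z) ^ i" by (simp add: power_mult_distrib)
  also have "z * cnj z = of_real (norm z) ^ 2" by (metis complex_norm_square of_real_power)
  finally show ?thesis by (simp add: power_mult)
qed

text \<open>On |z| = r the product of z and its conjugate is r^2, so each conjugate factor strips
  one backward shift off G; the constant term contributes the conjugate of a mean of a positive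
  power, which is 0.\<close>

lemma circ_mean_cnj_power:
  assumes "bh G" "0 < r" "r < 1"
  shows "circ_mean r (\<lambda>z. cnj z ^ i * G z) = of_real r ^ (2 * i) * tcoeff G i"
  using assms(1)
proof (induction i arbitrary: G)
  case 0
  then show ?case using assms by (simp add: circ_mean_holomorphic bh_def)
next
  case (Suc i)
  have r: "\<bar>r\<bar> < 1" using assms by simp
  have bs: "bh (shift G)" using Suc.prems by auto
  have "circ_mean r (\<lambda>z. cnj z ^ Suc i * G z)
      = circ_mean r (\<lambda>z. G 0 * cnj (z ^ Suc i) + of_real r ^ 2 * (cnj z ^ i * shift G z))"
  proof (rule circ_mean_cong[OF r])
    fix z :: complex assume "norm z = \<bar>r\<bar>"
    hence "cnj z * z = of_real r ^ 2" using cnj_power_mult_self[of z 1]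
      by (simp flip: of_real_power)
    moreover have "cnj z ^ Suc i * G z = G 0 * cnj (z ^ Suc i) + cnj z * z * (cnj z ^ i * shift G z)"
      by (subst shift_eq[of G z]) (simp add: algebra_simps)
    ultimately show "cnj z ^ Suc i * G z = G 0 * cnj (z ^ Suc i) + of_real r ^ 2 * (cnj z ^ i * shift G z)" by simp
  qed
  also have "\<dots> = G 0 * cnj (circ_mean r (\<lambda>z. z ^ Suc i)) + of_real r ^ 2 * circ_mean r (\<lambda>z. cnj z ^ i * shift G z)"
  proof -
    have 1: "cb (\<lambda>z. cnj z ^ i * shift G z)" by (intro cb_intros bh_imp_cb[OF bs])
    have 2: "cb (\<lambda>z. cnj (z ^ Suc i))" by (intro cb_intros)
    have 3: "cb (\<lambda>z. z ^ Suc i :: complex)" by (intro cb_intros)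
    show ?thesis
      using circ_mean_add[OF r cb_cont cb_cont, OF cb_mult[OF cb_const 2] cb_mult[OF cb_const 1], of "G 0" "of_real r ^ 2"]
        circ_mean_cmult[OF r cb_cont[OF 1]] circ_mean_cmult[OF r cb_cont[OF 2]] circ_mean_cnj[OF r cb_cont[OF 3]]
      by simp
  qed
  also have "circ_mean r (\<lambda>z. z ^ Suc i) = 0"
    using assms by (subst circ_mean_holomorphic) (auto intro!: holomorphic_intros)
  also have "circ_mean r (\<lambda>z. cnj z ^ i * shift G z) = of_real r ^ (2 * i) * tcoeff G (Suc i)"
    by (simp add: Suc.IH[OF bs] tcoeff_Suc)
  finally show ?case by (simp add: power2_eq_square)
qed

text \<open>The variance of X on the circle is nonnegative.\<close>

lemma circ_mean_power2_le:
  fixes X :: "complex \<Rightarrow> real"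
  assumes "continuous_on (ball 0 1) X" "\<bar>r\<bar> < 1"
  shows "(circ_mean r X)\<^sup>2 \<le> circ_mean r (\<lambda>z. (X z)\<^sup>2)"
proof -
  define m where "m = circ_mean r X"
  have "0 \<le> circ_mean r (\<lambda>z. (X z - m)\<^sup>2)"
    by (rule circ_mean_nonneg) (use assms in \<open>auto intro!: continuous_intros\<close>)
  also have "\<dots> = circ_mean r (\<lambda>z. ((X z)\<^sup>2 - (2 * m) * X z) + m\<^sup>2)"
    by (simp add: power2_diff algebra_simps)
  also have "\<dots> = circ_mean r (\<lambda>z. (X z)\<^sup>2) - (2 * m) * m + m\<^sup>2"
    using assms
    by (subst circ_mean_add, simp, (auto intro!: continuous_intros)[2],
        subst circ_mean_diff, simp, (auto intro!: continuous_intros)[2],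
        subst circ_mean_cmult, simp, simp) (simp add: circ_mean_const m_def)
  finally show ?thesis by (simp add: m_def power2_eq_square)
qed

text \<open>Modulus one on the boundary is expressed by means over |z| = r, not by radial limits.
  This property is visibly inherited by compositions, while radial limits of f(u(z)) would require a
  separate study.\<close>

definition inner_like :: "(complex \<Rightarrow> complex) \<Rightarrow> bool" where
  "inner_like u \<longleftrightarrow> u holomorphic_on ball 0 1 \<and> u ` ball 0 1 \<subseteq> ball 0 1 \<and> u 0 = 0 \<and>
     bnull (\<lambda>z. 1 - (norm (u z))\<^sup>2)"

lemma norm_add_square: "(norm (a + b))\<^sup>2 = (norm a)\<^sup>2 + (norm b)\<^sup>2 + 2 * Re (cnj a * b)" for a b :: complex
  unfolding cmod_power2 by (simp add: power2_eq_square algebra_simps)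

section \<open>Littlewood subordination for self-maps of the disc fixing 0\<close>

context
  fixes u :: "complex \<Rightarrow> complex"
  assumes hol: "u holomorphic_on ball 0 1" and im: "u ` ball 0 1 \<subseteq> ball 0 1" and u0: "u 0 = 0"
begin

lemma self_map_norm_le: "norm z < 1 \<Longrightarrow> norm (u z) \<le> norm z"
  by (rule Schwarz_Lemma(1)[OF hol u0]) (use im in \<open>auto simp: image_subset_iff\<close>)

lemma self_map_bh: "bh u"
  by (rule bhI[OF hol, where K = 1]) (use im in \<open>auto simp: image_subset_iff less_imp_le\<close>)

lemma bh_self_map_compose: "bh G \<Longrightarrow> bh (\<lambda>z. G (u z))"
  by (rule bh_compose[OF _ hol im])

text \<open>Write A(u) = A(0) + u * (shift A)(u). The cross term is the mean of a holomorphic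
  function vanishing at 0, because u(0) = 0.\<close>

lemma circ_mean_norm_split:
  assumes "bh A" "0 < r" "r < 1"
  shows "circ_mean r (\<lambda>z. (norm (A (u z)))\<^sup>2) =
         (norm (A 0))\<^sup>2 + circ_mean r (\<lambda>z. (norm (u z) * norm (shift A (u z)))\<^sup>2)"
proof -
  have r: "\<bar>r\<bar> < 1" using assms by simp
  have b: "bh (\<lambda>z. u z * shift A (u z))"
    using assms by (intro bh_mult self_map_bh bh_self_map_compose bh_shift)
  note c = bh_imp_cb[OF b]
  have b': "bh (\<lambda>z. cnj (A 0) * (u z * shift A (u z)))" using b by auto
  have "circ_mean r (\<lambda>z. (norm (A (u z)))\<^sup>2)
     = circ_mean r (\<lambda>z. ((norm (A 0))\<^sup>2 + (norm (u z * shift A (u z)))\<^sup>2) + 2 * Re (cnj (A 0) * (u z * shift A (u z))))"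
    by (rule circ_mean_cong[OF r]) (subst shift_eq, simp only: norm_add_square)
  also have "\<dots> = (norm (A 0))\<^sup>2 + circ_mean r (\<lambda>z. (norm (u z * shift A (u z)))\<^sup>2)
        + 2 * Re (circ_mean r (\<lambda>z. cnj (A 0) * (u z * shift A (u z))))"
  proof -
    let ?X = "\<lambda>z. (norm (A 0))\<^sup>2" and ?Y = "\<lambda>z. (norm (u z * shift A (u z)))\<^sup>2"
      and ?Z = "\<lambda>z. cnj (A 0) * (u z * shift A (u z))"
    have "cb ?Y" using cb_power[OF cb_norm[OF c]] .
    moreover have "cb ?Z" using bh_imp_cb[OF b'] .
    moreover have "cb (\<lambda>z. 2 * Re (?Z z))" by (intro cb_intros bh_imp_cb[OF b'])
    moreover have "cb (\<lambda>z. Re (?Z z))" by (intro cb_intros bh_imp_cb[OF b'])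
    moreover have "cb (\<lambda>z. ?X z + ?Y z)" by (intro cb_add cb_const \<open>cb ?Y\<close>)
    ultimately show ?thesis
      using circ_mean_add[OF r, of "\<lambda>z. ?X z + ?Y z" "\<lambda>z. 2 * Re (?Z z)"]
        circ_mean_add[OF r, of ?X ?Y] circ_mean_cmult[OF r, of "\<lambda>z. Re (?Z z)" 2] circ_mean_Re[OF r, of ?Z]
      by (simp add: cb_cont circ_mean_const[OF r])
  qed
  also have "circ_mean r (\<lambda>z. cnj (A 0) * (u z * shift A (u z))) = 0"
    using assms b' by (subst circ_mean_holomorphic) (auto simp: u0 bh_def)
  finally show ?thesis by (simp add: norm_mult)
qed

text \<open>Iterates the splitting. By Schwarz's lemma |u(z)| <= r on |z| = r, so every further
  backward shift contributes a factor r^2.\<close>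

lemma circ_mean_norm_subord:
  assumes "bh A" "0 < r" "r < 1"
  shows "circ_mean r (\<lambda>z. (norm (A (u z)))\<^sup>2)
     \<le> (\<Sum>i<m. (norm (tcoeff A i))\<^sup>2) + r ^ (2 * m) * circ_mean r (\<lambda>z. (norm ((shift ^^ m) A (u z)))\<^sup>2)"
proof (induction m)
  case (Suc m)
  have r: "\<bar>r\<bar> < 1" using assms by simp
  let ?S = "\<lambda>m. circ_mean r (\<lambda>z. (norm ((shift ^^ m) A (u z)))\<^sup>2)"
  have b: "bh ((shift ^^ m) A)" "bh ((shift ^^ Suc m) A)" using assms by blast+
  have cs: "cb (\<lambda>z. shift ((shift ^^ m) A) (u z))" "cb u"
    using b(2) by (auto intro!: bh_imp_cb bh_self_map_compose self_map_bh)
  have "?S m = (norm (tcoeff A m))\<^sup>2 + circ_mean r (\<lambda>z. (norm (u z) * norm ((shift ^^ Suc m) A (u z)))\<^sup>2)"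
    using circ_mean_norm_split[OF b(1) assms(2,3)] by (simp add: tcoeff_def)
  also have "circ_mean r (\<lambda>z. (norm (u z) * norm ((shift ^^ Suc m) A (u z)))\<^sup>2)
     \<le> circ_mean r (\<lambda>z. r\<^sup>2 * (norm ((shift ^^ Suc m) A (u z)))\<^sup>2)"
  proof (rule circ_mean_mono[OF r])
    fix z :: complex assume "norm z = \<bar>r\<bar>"
    hence "norm (u z) \<le> r" using self_map_norm_le[of z] assms by simp
    thus "(norm (u z) * norm ((shift ^^ Suc m) A (u z)))\<^sup>2 \<le> r\<^sup>2 * (norm ((shift ^^ Suc m) A (u z)))\<^sup>2"
      by (simp add: power_mult_distrib mult_right_mono power_mono)
  qed (use cs in \<open>auto intro!: cb_cont\<close>)
  also have "\<dots> = r\<^sup>2 * ?S (Suc m)"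
    by (rule circ_mean_cmult[OF r]) (use cs in \<open>auto intro!: cb_cont\<close>)
  finally have 1: "?S m \<le> (norm (tcoeff A m))\<^sup>2 + r\<^sup>2 * ?S (Suc m)" by simp
  have "circ_mean r (\<lambda>z. (norm (A (u z)))\<^sup>2) \<le> (\<Sum>i<m. (norm (tcoeff A i))\<^sup>2) + r ^ (2 * m) * ?S m" by (rule Suc.IH)
  also have "\<dots> \<le> (\<Sum>i<m. (norm (tcoeff A i))\<^sup>2) + r ^ (2 * m) * ((norm (tcoeff A m))\<^sup>2 + r\<^sup>2 * ?S (Suc m))"
    using 1 assms by (intro add_left_mono mult_left_mono) auto
  also have "\<dots> = (\<Sum>i<m. (norm (tcoeff A i))\<^sup>2) + r ^ (2 * m) * (norm (tcoeff A m))\<^sup>2 + r ^ (2 * Suc m) * ?S (Suc m)"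
    by (simp add: algebra_simps power2_eq_square)
  also have "r ^ (2 * m) * (norm (tcoeff A m))\<^sup>2 \<le> 1 * (norm (tcoeff A m))\<^sup>2"
    using assms by (intro mult_right_mono power_le_one) auto
  finally show ?case by simp
qed simp

end

lemma tcoeff_square_sum_le:
  assumes "bh A" "\<And>z. norm z < 1 \<Longrightarrow> norm (A z) \<le> K"
  shows "(\<Sum>i<m. (norm (tcoeff A i))\<^sup>2) \<le> K\<^sup>2"
proof -
  have K0: "K \<ge> 0" using assms(2)[of 0] norm_ge_zero[of "A 0"] by (simp add: order_trans[OF norm_ge_zero])
  have eq: "circ_mean r (\<lambda>z. (norm (A z))\<^sup>2) \<ge> (\<Sum>i<m. r ^ (2 * i) * (norm (tcoeff A i))\<^sup>2)"
    if r: "0 < r" "r < 1" for r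
  proof -
    have r': "\<bar>r\<bar> < 1" using r by simp
    have "circ_mean r (\<lambda>z. (norm (A z))\<^sup>2) = (\<Sum>i<m. r ^ (2 * i) * (norm (tcoeff A i))\<^sup>2)
        + r ^ (2 * m) * circ_mean r (\<lambda>z. (norm ((shift ^^ m) A z))\<^sup>2)"
    proof (induction m)
      case (Suc m)
      have b: "bh ((shift ^^ m) A)" "bh (shift ((shift ^^ m) A))" using assms by blast+
      have "circ_mean r (\<lambda>z. (norm ((shift ^^ m) A z))\<^sup>2)
         = (norm (tcoeff A m))\<^sup>2 + circ_mean r (\<lambda>z. (norm z * norm ((shift ^^ Suc m) A z))\<^sup>2)"
        using circ_mean_norm_split[of "\<lambda>z. z" "(shift ^^ m) A" r] b r by (simp add: tcoeff_def)
      also have "circ_mean r (\<lambda>z. (norm z * norm ((shift ^^ Suc m) A z))\<^sup>2)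
          = circ_mean r (\<lambda>z. r\<^sup>2 * (norm ((shift ^^ Suc m) A z))\<^sup>2)"
        by (rule circ_mean_cong[OF r']) (simp add: power_mult_distrib)
      also have "\<dots> = r\<^sup>2 * circ_mean r (\<lambda>z. (norm ((shift ^^ Suc m) A z))\<^sup>2)"
        by (rule circ_mean_cmult[OF r']) (use b in \<open>auto intro!: cb_cont bh_imp_cb\<close>)
      finally show ?case using Suc by (simp add: algebra_simps power2_eq_square)
    qed simp
    moreover have "circ_mean r (\<lambda>z. (norm ((shift ^^ m) A z))\<^sup>2) \<ge> 0"
      by (rule circ_mean_nonneg[OF r']) (use bh_shift_pow[OF assms(1)] in \<open>auto intro!: cb_cont bh_imp_cb\<close>)
    ultimately show ?thesis using r by simp
  qed
  have "((\<lambda>r. \<Sum>i<m. r ^ (2 * i) * (norm (tcoeff A i))\<^sup>2) \<longlongrightarrow> (\<Sum>i<m. 1 ^ (2 * i) * (norm (tcoeff A i))\<^sup>2)) (at_left 1)"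
    by (intro tendsto_intros)
  moreover have "eventually (\<lambda>r. (\<Sum>i<m. r ^ (2 * i) * (norm (tcoeff A i))\<^sup>2) \<le> K\<^sup>2) (at_left 1)"
    using eventually_at_left_1
  proof eventually_elim
    case (elim r)
    have "norm (circ_mean r (\<lambda>z. (norm (A z))\<^sup>2)) \<le> K\<^sup>2"
      by (rule circ_mean_le_bound)
        (use elim assms in \<open>auto intro!: cb_cont power_mono dest: bh_imp_cb\<close>)
    thus ?case using eq[of r] elim by simp
  qed
  ultimately show ?thesis
    using tendsto_upperbound[of "\<lambda>r. \<Sum>i<m. r ^ (2 * i) * (norm (tcoeff A i))\<^sup>2" _ "at_left 1" "K\<^sup>2"] by simp
qed

lemma summable_tcoeff_square: assumes "bh A" shows "summable (\<lambda>i. (norm (tcoeff A i))\<^sup>2)"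
proof -
  obtain K where "\<And>z. norm z < 1 \<Longrightarrow> norm (A z) \<le> K" using cb_bound[OF bh_imp_cb[OF assms]] by metis
  thus ?thesis by (intro summableI_nonneg_bounded[of _ "K\<^sup>2"] tcoeff_square_sum_le assms) auto
qed

text \<open>On |z| = s the remainder z^m (shift^m A)(z) is A minus m Taylor terms, each at most K;
  the maximum principle carries the estimate inside.\<close>

lemma shift_pow_bound:
  assumes "bh A" "\<And>z. norm z < 1 \<Longrightarrow> norm (A z) \<le> K" "0 < s" "s < 1" "norm w \<le> s"
  shows "norm ((shift ^^ m) A w) \<le> K * (1 + real m) / s ^ m"
proof -
  have K0: "K \<ge> 0" using assms(2)[of 0] norm_ge_zero[of "A 0"] by (simp add: order_trans[OF norm_ge_zero])
  have hol: "(shift ^^ m) A holomorphic_on ball 0 1" using bh_shift_pow[OF assms(1)] by (simp add: bh_def)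
  have ck: "norm (tcoeff A i) \<le> K" for i
  proof -
    have "(norm (tcoeff A i))\<^sup>2 \<le> (\<Sum>i<Suc i. (norm (tcoeff A i))\<^sup>2)" by (simp add: sum_nonneg)
    also have "\<dots> \<le> K\<^sup>2" by (rule tcoeff_square_sum_le[OF assms(1,2)])
    finally show ?thesis using K0 by (simp add: power2_le_iff_abs_le)
  qed
  show ?thesis
  proof (rule maximum_modulus_frontier[of "(shift ^^ m) A" "cball 0 s"])
    show "(shift ^^ m) A holomorphic_on interior (cball 0 s)"
      by (rule holomorphic_on_subset[OF hol]) (use assms in auto)
    show "continuous_on (closure (cball 0 s)) ((shift ^^ m) A)"
      by (rule holomorphic_on_imp_continuous_on, rule holomorphic_on_subset[OF hol]) (use assms in auto)
    show "bounded (cball 0 s :: complex set)" by simp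
    show "w \<in> cball 0 s" using assms by simp
    fix z :: complex assume "z \<in> frontier (cball 0 s)"
    hence z: "norm z = s" using assms by (simp add: frontier_cball)
    have "norm (\<Sum>i<m. tcoeff A i * z ^ i) \<le> (\<Sum>i<m. K)"
    proof (rule sum_norm_le)
      fix i
      have "norm (tcoeff A i) * s ^ i \<le> K * 1"
        using ck[of i] assms K0 by (intro mult_mono power_le_one) auto
      thus "norm (tcoeff A i * z ^ i) \<le> K" by (simp add: norm_mult norm_power z)
    qed
    moreover have "z ^ m * (shift ^^ m) A z = A z - (\<Sum>i<m. tcoeff A i * z ^ i)"
      by (subst tcoeff_expand[of A z m]) simp
    ultimately have "norm (z ^ m * (shift ^^ m) A z) \<le> K + (\<Sum>i<m. K)"
      using assms(2)[of z] z assms by (auto intro!: order_trans[OF norm_triangle_ineq4] add_mono)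
    hence "s ^ m * norm ((shift ^^ m) A z) \<le> K * (1 + real m)"
      by (simp add: norm_mult norm_power z algebra_simps)
    thus "norm ((shift ^^ m) A z) \<le> K * (1 + real m) / s ^ m"
      using assms by (simp add: field_simps)
  qed
qed

lemma Littlewood_subordination:
  assumes u: "u holomorphic_on ball 0 1" "u ` ball 0 1 \<subseteq> ball 0 1" "u 0 = 0"
    and A: "bh A" and r: "0 < r" "r < 1"
  shows "circ_mean r (\<lambda>z. (norm (A (u z)))\<^sup>2) \<le> (\<Sum>i. (norm (tcoeff A i))\<^sup>2)"
proof -
  obtain K where K: "K > 0" "\<And>z. norm z < 1 \<Longrightarrow> norm (A z) \<le> K" using cb_bound[OF bh_imp_cb[OF A]] by metis
  \<comment> \<open>Any s strictly between r and 1 works: the remainder after m steps is then at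
    most a multiple of ((1 + m)(r/s)^m)^2, which tends to 0.\<close>
  define s where "s = (1 + r) / 2"
  have s: "0 < s" "s < 1" "r < s" using r by (auto simp: s_def)
  have bound: "circ_mean r (\<lambda>z. (norm (A (u z)))\<^sup>2)
      \<le> (\<Sum>i. (norm (tcoeff A i))\<^sup>2) + K\<^sup>2 * ((1 + real m) * (r / s) ^ m)\<^sup>2" for m
  proof -
    have c: "cb (\<lambda>z. (shift ^^ m) A (u z))"
      by (rule bh_imp_cb) (rule bh_self_map_compose[OF u bh_shift_pow[OF A]])
    have "norm (circ_mean r (\<lambda>z. (norm ((shift ^^ m) A (u z)))\<^sup>2)) \<le> (K * (1 + real m) / s ^ m)\<^sup>2"
    proof (rule circ_mean_le_bound)
      fix z :: complex assume "norm z = \<bar>r\<bar>"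
      hence "norm (u z) \<le> s" using self_map_norm_le[OF u, of z] r s by simp
      from shift_pow_bound[OF A K(2) s(1,2) this, of m]
      show "norm ((norm ((shift ^^ m) A (u z)))\<^sup>2) \<le> (K * (1 + real m) / s ^ m)\<^sup>2"
        by (simp add: power_mono)
    qed (use r c in \<open>auto intro!: cb_cont\<close>)
    hence "r ^ (2 * m) * circ_mean r (\<lambda>z. (norm ((shift ^^ m) A (u z)))\<^sup>2) \<le> r ^ (2 * m) * (K * (1 + real m) / s ^ m)\<^sup>2"
      using r by (intro mult_left_mono) auto
    also have "\<dots> = K\<^sup>2 * ((1 + real m) * (r / s) ^ m)\<^sup>2"
      by (simp add: power_mult_distrib power_divide power_mult[symmetric] mult.commute)
    finally have "r ^ (2 * m) * circ_mean r (\<lambda>z. (norm ((shift ^^ m) A (u z)))\<^sup>2) \<le> K\<^sup>2 * ((1 + real m) * (r / s) ^ m)\<^sup>2" .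
    moreover have "(\<Sum>i<m. (norm (tcoeff A i))\<^sup>2) \<le> (\<Sum>i. (norm (tcoeff A i))\<^sup>2)"
      by (rule sum_le_suminf[OF summable_tcoeff_square[OF A]]) auto
    ultimately show ?thesis using circ_mean_norm_subord[OF u A r, of m] by linarith
  qed
  have q: "norm (r / s) < 1" using r s by simp
  have "(\<lambda>m. (r / s) ^ m + real m * (r / s) ^ m) \<longlonglongrightarrow> 0 + 0"
    by (intro tendsto_add LIMSEQ_power_zero powser_times_n_limit_0 q)
  hence "(\<lambda>m. (1 + real m) * (r / s) ^ m) \<longlonglongrightarrow> 0" by (simp add: algebra_simps)
  hence "(\<lambda>m. (\<Sum>i. (norm (tcoeff A i))\<^sup>2) + K\<^sup>2 * ((1 + real m) * (r / s) ^ m)\<^sup>2) \<longlonglongrightarrow> (\<Sum>i. (norm (tcoeff A i))\<^sup>2) + K\<^sup>2 * 0\<^sup>2"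
    by (intro tendsto_intros)
  from LIMSEQ_le_const[OF this, of "circ_mean r (\<lambda>z. (norm (A (u z)))\<^sup>2)"] bound show ?thesis by auto
qed

section \<open>Inner functions fixing 0, through their circle means\<close>

lemma inner_likeD:
  assumes "inner_like u"
  shows "u holomorphic_on ball 0 1" "u ` ball 0 1 \<subseteq> ball 0 1" "u 0 = 0" "bnull (\<lambda>z. 1 - (norm (u z))\<^sup>2)"
  using assms by (auto simp: inner_like_def)

lemma inner_like_bh: "inner_like u \<Longrightarrow> bh u"
  by (rule self_map_bh) (auto simp: inner_like_def)

lemma inner_like_norm_lt: "inner_like u \<Longrightarrow> norm z < 1 \<Longrightarrow> norm (u z) < 1"
  by (auto simp: inner_like_def image_subset_iff)

lemma inner_like_bh_compose: "inner_like u \<Longrightarrow> bh G \<Longrightarrow> bh (\<lambda>z. G (u z))"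
  by (rule bh_self_map_compose) (auto simp: inner_like_def)

lemma inner_like_cb_compose: "inner_like u \<Longrightarrow> bh G \<Longrightarrow> cb (\<lambda>z. G (u z))"
  by (rule bh_imp_cb) (rule inner_like_bh_compose)

lemma inner_like_bnull:
  assumes "inner_like u" "cb X"
  shows "bnull (\<lambda>z. (u z * cnj (u z) - 1) * X z)"
proof -
  have cu: "cb u" using assms by (intro bh_imp_cb inner_like_bh)
  have "bnull (\<lambda>z. u z * cnj (u z) - 1)"
  proof (rule bnull_dominated[OF inner_likeD(4)[OF assms(1)], where C = 1])
    fix z :: complex assume "norm z < 1"
    have "u z * cnj (u z) - 1 = of_real ((norm (u z))\<^sup>2 - 1)"
      by (simp only: of_real_diff complex_norm_square of_real_1)
    hence "norm (u z * cnj (u z) - 1) = norm ((norm (u z))\<^sup>2 - 1)" by (simp only: norm_of_real real_norm_def)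
    thus "norm (u z * cnj (u z) - 1) \<le> 1 * norm (1 - (norm (u z))\<^sup>2)" by (simp add: abs_minus_commute)
  qed (intro cb_intros cu)+
  thus ?thesis by (rule bnull_mult) (intro cb_intros cu assms(2))+
qed

lemma inner_like_ident: "inner_like (\<lambda>z. z)"
proof -
  have "blim (\<lambda>z::complex. norm (1 - (norm z)\<^sup>2)) 0"
  proof (rule Lim_transform_eventually)
    show "((\<lambda>r::real. 1 - r\<^sup>2) \<longlongrightarrow> 0) (at_left 1)"
      by (rule tendsto_eq_intros refl | simp)+
    show "\<forall>\<^sub>F r in at_left 1. 1 - r\<^sup>2 = circ_mean r (\<lambda>z::complex. norm (1 - (norm z)\<^sup>2))"
      using eventually_at_left_1
    proof eventually_elim
      case (elim r)
      have "circ_mean r (\<lambda>z::complex. norm (1 - (norm z)\<^sup>2)) = circ_mean r (\<lambda>z::complex. 1 - r\<^sup>2)"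
        by (rule circ_mean_cong) (use elim in \<open>auto simp: power_le_one\<close>)
      thus ?case using elim by (simp add: circ_mean_const)
    qed
  qed
  thus ?thesis by (auto simp: inner_like_def bnull_def)
qed

text \<open>The boundary map of u preserves normalized arc length, so the formula for the Taylor
  coefficients persists with u(z) in place of z. The induction is that of
  \<open>circ_mean_cnj_power\<close>, with |u| = 1 holding on the boundary only.\<close>

lemma blim_inner_cnj_power:
  assumes "inner_like u" "bh G"
  shows "blim (\<lambda>z. cnj (u z) ^ i * G (u z)) (tcoeff G i)"
  using assms(2)
proof (induction i arbitrary: G)
  case 0
  have "blim (\<lambda>z. G (u z)) (G (u 0))"
    using inner_like_bh_compose[OF assms(1) 0] by (intro blim_holomorphic) (simp add: bh_def)
  thus ?case using assms by (simp add: inner_like_def)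
next
  case (Suc i)
  have bs: "bh (shift G)" using Suc.prems by auto
  have cs: "cb (\<lambda>z. shift G (u z))" and cu: "cb u"
    using inner_like_cb_compose[OF assms(1) bs] bh_imp_cb[OF inner_like_bh[OF assms(1)]] .
  have l1: "blim (\<lambda>z. cnj (u z) ^ i * shift G (u z)) (tcoeff G (Suc i))"
    using Suc.IH[OF bs] by (simp add: tcoeff_Suc)
  have bu: "bh (\<lambda>z. u z ^ Suc i)" using assms by (intro bh_power inner_like_bh)
  have "blim (\<lambda>z. u z ^ Suc i) (u 0 ^ Suc i)"
    by (rule blim_holomorphic) (use bu in \<open>simp add: bh_def\<close>)
  from blim_cnj[OF this bh_imp_cb[OF bu]] have "blim (\<lambda>z. cnj (u z ^ Suc i)) 0"
    using assms(1) by (simp add: inner_like_def)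
  from blim_cmult[OF this cb_cnj[OF cb_power[OF cu]], of "G 0"]
  have l2: "blim (\<lambda>z. G 0 * cnj (u z ^ Suc i)) 0" by (simp only: mult_zero_right)
  have "blim (\<lambda>z. cnj (u z) ^ i * shift G (u z) + G 0 * cnj (u z ^ Suc i)) (tcoeff G (Suc i) + 0)"
    by (rule blim_add[OF l1 l2]) (intro cb_intros cu cs)+
  hence l3: "blim (\<lambda>z. cnj (u z) ^ i * shift G (u z) + G 0 * cnj (u z ^ Suc i)) (tcoeff G (Suc i))" by simp
  show ?case
  proof (rule blim_bnull_diff[OF l3])
    have "bnull (\<lambda>z. (u z * cnj (u z) - 1) * (cnj (u z) ^ i * shift G (u z)))"
      by (rule inner_like_bnull[OF assms(1)]) (intro cb_intros cu cs)
    moreover have "(u z * cnj (u z) - 1) * (cnj (u z) ^ i * shift G (u z)) =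
       cnj (u z) ^ Suc i * G (u z) - (cnj (u z) ^ i * shift G (u z) + G 0 * cnj (u z ^ Suc i))" for z
      by (subst shift_eq[of G "u z"]) (simp add: algebra_simps)
    ultimately show "bnull (\<lambda>z. cnj (u z) ^ Suc i * G (u z) -
        (cnj (u z) ^ i * shift G (u z) + G 0 * cnj (u z ^ Suc i)))" by simp
    show "cb (\<lambda>z. cnj (u z) ^ Suc i * G (u z))"
      by (intro cb_intros cu inner_like_cb_compose[OF assms(1)] Suc.prems)
  qed (intro cb_intros cu cs)
qed

text \<open>As in \<open>circ_mean_norm_split\<close>, with the factor |u|^2 removed in the
  limit.\<close>

lemma blim_norm_split:
  assumes u: "inner_like u" and A: "bh A"
  shows "blim (\<lambda>z. (norm (A (u z)))\<^sup>2 - (norm (shift A (u z)))\<^sup>2) ((norm (A 0))\<^sup>2)"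
proof -
  have cs: "cb (\<lambda>z. shift A (u z))" and ca: "cb (\<lambda>z. A (u z))" and cu: "cb u"
    using inner_like_cb_compose[OF u bh_shift[OF A]] inner_like_cb_compose[OF u A] bh_imp_cb[OF inner_like_bh[OF u]] .
  have "blim (\<lambda>z. (norm (A (u z)))\<^sup>2 - (norm (u z) * norm (shift A (u z)))\<^sup>2) ((norm (A 0))\<^sup>2)"
  proof (rule tendsto_eventually, use eventually_at_left_1 in eventually_elim)
    case (elim r)
    hence r: "\<bar>r\<bar> < 1" by simp
    show ?case
      using circ_mean_norm_split[OF inner_likeD(1,2,3)[OF u] A, of r] elim
      by (subst circ_mean_diff[OF r]; (intro cb_cont cb_intros cu cs ca)?) auto
  qed
  thus ?thesis
  proof (rule blim_bnull_diff)
    show "bnull (\<lambda>z. ((norm (A (u z)))\<^sup>2 - (norm (shift A (u z)))\<^sup>2) -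
        ((norm (A (u z)))\<^sup>2 - (norm (u z) * norm (shift A (u z)))\<^sup>2))"
    proof -
      have "bnull (\<lambda>z. (1 - (norm (u z))\<^sup>2) * - (norm (shift A (u z)))\<^sup>2)"
        by (rule bnull_mult[OF inner_likeD(4)[OF u]]) (intro cb_intros cu cs)+
      thus ?thesis by (simp add: algebra_simps power_mult_distrib)
    qed
  qed (intro cb_intros cu cs ca)+
qed

lemma blim_norm_split_pow:
  assumes u: "inner_like u" and A: "bh A"
  shows "blim (\<lambda>z. (norm (A (u z)))\<^sup>2 - (norm ((shift ^^ n) A (u z)))\<^sup>2) (\<Sum>i<n. (norm (tcoeff A i))\<^sup>2)"
proof (induction n)
  case 0
  show ?case using blim_const[of "0::real"] by simp
next
  case (Suc n)
  have c: "cb (\<lambda>z. (shift ^^ k) A (u z))" for k by (intro inner_like_cb_compose[OF u] bh_shift_pow A)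
  have "blim (\<lambda>z. ((norm (A (u z)))\<^sup>2 - (norm ((shift ^^ n) A (u z)))\<^sup>2) +
      ((norm ((shift ^^ n) A (u z)))\<^sup>2 - (norm ((shift ^^ Suc n) A (u z)))\<^sup>2))
      ((\<Sum>i<n. (norm (tcoeff A i))\<^sup>2) + (norm (tcoeff A n))\<^sup>2)"
  proof (rule blim_add[OF Suc.IH])
    show "blim (\<lambda>z. (norm ((shift ^^ n) A (u z)))\<^sup>2 - (norm ((shift ^^ Suc n) A (u z)))\<^sup>2) ((norm (tcoeff A n))\<^sup>2)"
      using blim_norm_split[OF u bh_shift_pow[OF A, of n]] by (simp add: tcoeff_def)
  qed (use c[of 0] c[of n] c[of "Suc n"] in \<open>auto simp del: funpow.simps\<close>)
  thus ?case by simp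
qed

text \<open>The square means of f tend to 1, and subordination with the identity bounds each of them
  by the coefficient sum.\<close>

lemma suminf_tcoeff_inner:
  assumes "inner_like f" shows "(\<Sum>i. (norm (tcoeff f i))\<^sup>2) \<ge> 1"
proof -
  have bf: "bh f" and cf: "cb f" using assms by (auto intro: inner_like_bh bh_imp_cb)
  have "blim (\<lambda>z. 1 - (norm (f z))\<^sup>2) 0"
    by (rule bnull_imp_blim[OF inner_likeD(4)[OF assms]]) (intro cb_intros cf)
  hence "blim (\<lambda>z. 1 - (1 - (norm (f z))\<^sup>2)) (1 - 0)"
    by (intro blim_diff blim_const cb_intros cf)
  hence 1: "blim (\<lambda>z. (norm (f z))\<^sup>2) 1" by simp
  have "eventually (\<lambda>r. circ_mean r (\<lambda>z. (norm (f z))\<^sup>2) \<le> (\<Sum>i. (norm (tcoeff f i))\<^sup>2)) (at_left 1)"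
    using eventually_at_left_1
    by eventually_elim (use Littlewood_subordination[of "\<lambda>z. z" f] bf in auto)
  from tendsto_upperbound[OF 1 this] show ?thesis by simp
qed

lemma inner_like_compose:
  assumes f: "inner_like f" and u: "inner_like u"
  shows "inner_like (\<lambda>z. f (u z))"
proof -
  have bf: "bh f" using f by (rule inner_like_bh)
  have b: "bh (\<lambda>z. f (u z))" by (rule inner_like_bh_compose[OF u bf])
  note c = bh_imp_cb[OF b]
  have lt: "norm (f (u z)) < 1" if "norm z < 1" for z
    by (rule inner_like_norm_lt[OF f inner_like_norm_lt[OF u that]])
  have "blim (\<lambda>z. norm (1 - (norm (f (u z)))\<^sup>2)) 0"
  proof (rule tendstoI)
    fix e :: real assume e: "e > 0"
    have "(\<lambda>n. \<Sum>i<n. (norm (tcoeff f i))\<^sup>2) \<longlonglongrightarrow> (\<Sum>i. (norm (tcoeff f i))\<^sup>2)"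
      by (rule summable_LIMSEQ[OF summable_tcoeff_square[OF bf]])
    \<comment> \<open>Finitely many coefficients of f already carry mass above 1 - e/2. By
      \<open>blim_norm_split_pow\<close> the square means of f(u) are in the limit at least that
      mass.\<close>
    from order_tendstoD(1)[OF this, of "1 - e / 2"] obtain n where n: "(\<Sum>i<n. (norm (tcoeff f i))\<^sup>2) > 1 - e / 2"
      using suminf_tcoeff_inner[OF f] e unfolding eventually_sequentially by fastforce
    have cn: "cb (\<lambda>z. (shift ^^ n) f (u z))" by (intro inner_like_cb_compose[OF u] bh_shift_pow bf)
    have "eventually (\<lambda>r. circ_mean r (\<lambda>z. (norm (f (u z)))\<^sup>2 - (norm ((shift ^^ n) f (u z)))\<^sup>2) > 1 - e) (at_left 1)"
      by (rule order_tendstoD(1)[OF blim_norm_split_pow[OF u bf, of n]]) (use n e in linarith)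
    thus "\<forall>\<^sub>F r in at_left 1. dist (circ_mean r (\<lambda>z. norm (1 - (norm (f (u z)))\<^sup>2))) 0 < e"
      using eventually_at_left_1
    proof eventually_elim
      case (elim r)
      hence r: "\<bar>r\<bar> < 1" by simp
      have "circ_mean r (\<lambda>z. (norm (f (u z)))\<^sup>2 - (norm ((shift ^^ n) f (u z)))\<^sup>2) \<le> circ_mean r (\<lambda>z. (norm (f (u z)))\<^sup>2)"
        by (rule circ_mean_mono[OF r]) (intro cb_cont cb_intros c cn, intro cb_cont cb_intros c cn, simp)
      moreover have "circ_mean r (\<lambda>z. norm (1 - (norm (f (u z)))\<^sup>2)) = circ_mean r (\<lambda>z. 1 - (norm (f (u z)))\<^sup>2)"
        by (rule circ_mean_cong[OF r]) (use lt r in \<open>auto simp: power_le_one less_imp_le\<close>)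
      moreover have "\<dots> = 1 - circ_mean r (\<lambda>z. (norm (f (u z)))\<^sup>2)"
        by (subst circ_mean_diff[OF r]; (intro cb_cont cb_intros c)?) (simp add: circ_mean_const[OF r])
      moreover have "circ_mean r (\<lambda>z. norm (1 - (norm (f (u z)))\<^sup>2)) \<ge> 0"
        by (rule circ_mean_nonneg[OF r]) (intro cb_cont cb_intros c, simp)
      ultimately show ?case using elim(1) by simp
    qed
  qed
  thus ?thesis using b lt f u by (auto simp: inner_like_def bh_def bnull_def)
qed

lemma inner_like_iterate: "inner_like f \<Longrightarrow> inner_like (f ^^ n)"
proof (induction n)
  case 0 thus ?case using inner_like_ident by (simp add: id_def)
next
  case (Suc n) thus ?case using inner_like_compose[of f "f ^^ n"] by (simp add: o_def)
qed

lemma circ_mean_le_sqrt: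
  assumes "cb R" "0 < r" "r < 1" "circ_mean r (\<lambda>z. (norm (R z))\<^sup>2) \<le> t"
  shows "circ_mean r (\<lambda>z. norm (R z)) \<le> sqrt t"
proof -
  have "(circ_mean r (\<lambda>z. norm (R z)))\<^sup>2 \<le> circ_mean r (\<lambda>z. (norm (R z))\<^sup>2)"
    by (rule circ_mean_power2_le) (use assms in \<open>auto intro!: cb_cont\<close>)
  thus ?thesis using assms(4) by (intro real_le_rsqrt) linarith
qed

text \<open>Cancelling pairs of u and its conjugate on the boundary leaves a pure power of one of
  them.\<close>

lemma blim_monomials:
  assumes u: "inner_like u" and X: "cb X"
    and "\<And>m. blim (\<lambda>z. X z * u z ^ m) 0" "\<And>m. blim (\<lambda>z. X z * cnj (u z) ^ m) 0"
  shows "blim (\<lambda>z. X z * (u z ^ i * cnj (u z) ^ j)) 0"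
proof (induction i arbitrary: j)
  case 0
  show ?case using assms(4)[of j] by simp
next
  case (Suc i)
  have cu: "cb u" using u by (intro bh_imp_cb inner_like_bh)
  show ?case
  proof (cases j)
    case 0
    thus ?thesis using assms(3)[of "Suc i"] by simp
  next
    case j: (Suc k)
    show ?thesis
    proof (rule blim_bnull_diff[OF Suc.IH[of k]])
      have "bnull (\<lambda>z. (u z * cnj (u z) - 1) * (X z * (u z ^ i * cnj (u z) ^ k)))"
        by (rule inner_like_bnull[OF u]) (intro cb_intros cu X)
      thus "bnull (\<lambda>z. X z * (u z ^ Suc i * cnj (u z) ^ j) - X z * (u z ^ i * cnj (u z) ^ k))"
        by (simp add: j algebra_simps)
    qed (intro cb_intros cu X)+
  qed
qed

lemma blim_zero_approx:
  assumes "\<And>e. e > 0 \<Longrightarrow> \<exists>Y. blim Y 0 \<and> (\<forall>r. 0 < r \<and> r < 1 \<longrightarrow> norm (circ_mean r X - circ_mean r Y) \<le> e)"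
  shows "blim X 0"
proof (rule tendstoI)
  fix e :: real assume "e > 0"
  then obtain Y where Y: "blim Y 0" "\<And>r. 0 < r \<Longrightarrow> r < 1 \<Longrightarrow> norm (circ_mean r X - circ_mean r Y) \<le> e / 2"
    using assms[of "e / 2"] by auto
  from tendstoD[OF Y(1), of "e / 2"] \<open>e > 0\<close> have "eventually (\<lambda>r. norm (circ_mean r Y) < e / 2) (at_left 1)" by simp
  thus "\<forall>\<^sub>F r in at_left 1. dist (circ_mean r X) 0 < e" using eventually_at_left_1
  proof eventually_elim
    case (elim r)
    have "norm (circ_mean r X) \<le> norm (circ_mean r X - circ_mean r Y) + norm (circ_mean r Y)"
      by (metis add.commute diff_add_cancel norm_triangle_ineq)
    thus ?case using elim Y(2)[of r] by simp
  qed
qed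

text \<open>If \<open>X\<close> is orthogonal to all powers of \<open>u\<close> and their conjugates, then its conditional expectation given the boundary
  values of \<open>u\<close> vanishes. The Taylor expansions of \<open>A\<close> and \<open>B\<close> converge only in mean square on the circle,
  and Littlewood's subordination principle transports this convergence to \<open>A \<circ> u\<close> and \<open>B \<circ> u\<close>.\<close>
lemma blim_orthogonal:
  assumes u: "inner_like u" and X: "cb X" and A: "bh A" and B: "bh B"
    and X1: "\<And>m. blim (\<lambda>z. X z * u z ^ m) 0" and X2: "\<And>m. blim (\<lambda>z. X z * cnj (u z) ^ m) 0"
  shows "blim (\<lambda>z. X z * (A (u z) * cnj (B (u z)))) 0"
proof (rule blim_zero_approx)
  fix e :: real assume e: "e > 0"
  have cu: "cb u" using u by (intro bh_imp_cb inner_like_bh)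
  obtain K where K: "K > 0" "\<And>z. norm z < 1 \<Longrightarrow> norm (X z) \<le> K" using cb_bound[OF X] by metis
  obtain L1 where L1: "L1 > 0" "\<And>z. norm z < 1 \<Longrightarrow> norm (A z) \<le> L1" using cb_bound[OF bh_imp_cb[OF A]] by metis
  obtain L2 where L2: "L2 > 0" "\<And>z. norm z < 1 \<Longrightarrow> norm (B z) \<le> L2" using cb_bound[OF bh_imp_cb[OF B]] by metis
  define L where "L = L1 + L2"
  have L: "L > 0" "\<And>z. norm z < 1 \<Longrightarrow> norm (A z) \<le> L" "\<And>z. norm z < 1 \<Longrightarrow> norm (B z) \<le> L"
    using L1 L2 by (auto simp: L_def intro: add_increasing add_increasing2 less_imp_le)
  define R where "R n G z = u z ^ n * (shift ^^ n) G (u z)" for n and G :: "complex \<Rightarrow> complex" and z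
  \<comment> \<open>The tails of both coefficient series: by subordination they bound the square
    means of the Taylor remainders of A(u) and B(u) at every radius.\<close>
  define t where "t n = (\<Sum>i. (norm (tcoeff A (i + n)))\<^sup>2) + (\<Sum>i. (norm (tcoeff B (i + n)))\<^sup>2)" for n
  have t0: "(\<Sum>i. (norm (tcoeff G (i + n)))\<^sup>2) \<ge> 0" if "bh G" for G n
    using summable_tcoeff_square[OF bh_shift_pow[OF that, of n]] unfolding tcoeff_shift_pow
    by (rule suminf_nonneg) auto
  have tlim: "t \<longlonglongrightarrow> 0 + 0"
    unfolding t_def by (intro tendsto_add suminf_exist_split2 summable_tcoeff_square A B)
  have cR: "cb (R n G)" if "bh G" for n G
    unfolding R_def by (intro cb_intros cu inner_like_cb_compose[OF u] bh_shift_pow that)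
  have R2: "circ_mean r (\<lambda>z. (norm (R n G z))\<^sup>2) \<le> (\<Sum>i. (norm (tcoeff G (i + n)))\<^sup>2)"
    if "bh G" "0 < r" "r < 1" for G n r
  proof -
    have cs: "cb (\<lambda>z. (shift ^^ n) G (u z))" by (intro inner_like_cb_compose[OF u] bh_shift_pow that)
    have "circ_mean r (\<lambda>z. (norm (R n G z))\<^sup>2) \<le> circ_mean r (\<lambda>z. (norm ((shift ^^ n) G (u z)))\<^sup>2)"
    proof (rule circ_mean_mono)
      fix z :: complex assume "norm z = \<bar>r\<bar>"
      hence "norm (u z) < 1" using that by (intro inner_like_norm_lt[OF u]) simp
      hence "norm (u z) ^ n * norm ((shift ^^ n) G (u z)) \<le> 1 * norm ((shift ^^ n) G (u z))"
        by (intro mult_right_mono power_le_one) auto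
      thus "(norm (R n G z))\<^sup>2 \<le> (norm ((shift ^^ n) G (u z)))\<^sup>2"
        by (intro power_mono) (auto simp: R_def norm_mult norm_power)
    qed (use that in \<open>simp, intro cb_cont cb_intros cR, simp, intro cb_cont cb_intros cs\<close>)
    also have "\<dots> \<le> (\<Sum>i. (norm (tcoeff ((shift ^^ n) G) i))\<^sup>2)"
      by (rule Littlewood_subordination) (use u that in \<open>auto dest: inner_likeD\<close>)
    finally show ?thesis by (simp add: tcoeff_shift_pow)
  qed
  have "(\<lambda>n. K * (2 * L * sqrt (t n) + t n)) \<longlonglongrightarrow> K * (2 * L * sqrt 0 + 0)"
    using tlim by (intro tendsto_intros) auto
  hence "eventually (\<lambda>n. K * (2 * L * sqrt (t n) + t n) < e) sequentially"
    using e by (intro order_tendstoD) auto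
  then obtain n where n: "K * (2 * L * sqrt (t n) + t n) < e" by (auto simp: eventually_sequentially)
  define Q where "Q z = X z * ((\<Sum>i<n. tcoeff A i * u z ^ i) * cnj (\<Sum>i<n. tcoeff B i * u z ^ i))" for z
  have cQ: "cb Q" unfolding Q_def by (intro cb_intros X cu)
  let ?F = "\<lambda>z. X z * (A (u z) * cnj (B (u z)))"
  have cA: "cb (\<lambda>z. A (u z))" and cB: "cb (\<lambda>z. B (u z))" using inner_like_cb_compose[OF u A] inner_like_cb_compose[OF u B] .
  have cF: "cb ?F" by (intro cb_intros X cA cB)
  show "\<exists>Y. blim Y 0 \<and> (\<forall>r. 0 < r \<and> r < 1 \<longrightarrow> norm (circ_mean r ?F - circ_mean r Y) \<le> e)"
  proof (intro exI[of _ Q] conjI allI impI)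
    have h1: "blim (\<lambda>z. \<Sum>i<n. \<Sum>j<n. tcoeff A i * cnj (tcoeff B j) * (X z * (u z ^ i * cnj (u z) ^ j)))
        (\<Sum>i<n. \<Sum>j<n. tcoeff A i * cnj (tcoeff B j) * 0)"
      by (intro blim_sum blim_cmult blim_monomials[OF u X X1 X2]) (auto intro!: X cu)
    have hQ: "Q z = (\<Sum>i<n. \<Sum>j<n. tcoeff A i * cnj (tcoeff B j) * (X z * (u z ^ i * cnj (u z) ^ j)))" for z
      unfolding Q_def cnj_sum sum_product unfolding sum_distrib_left by (simp add: mult_ac)
    show "blim Q 0" using blim_cong[OF h1 hQ[symmetric]] by simp
  next
    fix r :: real assume "0 < r \<and> r < 1"
    hence r: "0 < r" "r < 1" "\<bar>r\<bar> < 1" by auto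
    have RA: "circ_mean r (\<lambda>z. norm (R n A z)) \<le> sqrt (t n)" "circ_mean r (\<lambda>z. (norm (R n A z))\<^sup>2) \<le> t n"
      using R2[OF A r(1,2), of n] t0[OF B, of n]
      by (auto simp: t_def intro!: circ_mean_le_sqrt cR A r)
    have RB: "circ_mean r (\<lambda>z. norm (R n B z)) \<le> sqrt (t n)" "circ_mean r (\<lambda>z. (norm (R n B z))\<^sup>2) \<le> t n"
      using R2[OF B r(1,2), of n] t0[OF A, of n]
      by (auto simp: t_def intro!: circ_mean_le_sqrt cR B r)
    let ?a = "\<lambda>z. norm (R n A z)" and ?b = "\<lambda>z. norm (R n B z)"
    have ca: "cb ?a" and cb': "cb ?b" using cR[OF A, of n] cR[OF B, of n] by auto
    have "norm (circ_mean r ?F - circ_mean r Q) = norm (circ_mean r (\<lambda>z. ?F z - Q z))"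
      by (subst circ_mean_diff[OF r(3) cb_cont[OF cF] cb_cont[OF cQ]]) simp
    also have "\<dots> \<le> circ_mean r (\<lambda>z. norm (?F z - Q z))"
      by (rule norm_circ_mean_le[OF r(3)]) (intro cb_cont cb_diff cF cQ)
    \<comment> \<open>The difference is linear in one remainder or the product of both. The product
      ab is split as (a^2 + b^2)/2, so that only means and square means of single remainders
      occur.\<close>
    also have "\<dots> \<le> circ_mean r (\<lambda>z. K * L * ?a z + K * L * ?b z + K / 2 * (?a z)\<^sup>2 + K / 2 * (?b z)\<^sup>2)"
    proof (rule circ_mean_mono[OF r(3)])
      show "continuous_on (ball 0 1) (\<lambda>z. norm (?F z - Q z))" by (intro cb_cont cb_norm cb_diff cF cQ)
      show "continuous_on (ball 0 1) (\<lambda>z. K * L * ?a z + K * L * ?b z + K / 2 * (?a z)\<^sup>2 + K / 2 * (?b z)\<^sup>2)"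
        by (intro cb_cont cb_intros ca cb')
      fix z :: complex assume "norm z = \<bar>r\<bar>"
      hence z: "norm z < 1" using r by simp
      have zu: "norm (u z) < 1" by (rule inner_like_norm_lt[OF u z])
      have eA: "(\<Sum>i<n. tcoeff A i * u z ^ i) = A (u z) - R n A z" unfolding R_def
        by (subst tcoeff_expand[of A "u z" n]) simp
      have eB: "(\<Sum>i<n. tcoeff B i * u z ^ i) = B (u z) - R n B z" unfolding R_def
        by (subst tcoeff_expand[of B "u z" n]) simp
      have "?F z - Q z = X z * (R n A z * cnj (B (u z)) + A (u z) * cnj (R n B z) - R n A z * cnj (R n B z))"
        unfolding Q_def eA eB by (simp add: algebra_simps)
      also have "norm \<dots> \<le> K * (?a z * L + L * ?b z + ?a z * ?b z)"
        unfolding norm_mult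
      proof (intro mult_mono K z order_trans[OF norm_triangle_ineq4] add_mono order_trans[OF norm_triangle_ineq])
        show "norm (R n A z * cnj (B (u z))) \<le> ?a z * L" using L(3)[OF zu] by (simp add: norm_mult mult_left_mono)
        show "norm (A (u z) * cnj (R n B z)) \<le> L * ?b z" using L(2)[OF zu] by (simp add: norm_mult mult_right_mono)
      qed (use K L in \<open>auto simp: norm_mult\<close>)
      also have "?a z * ?b z \<le> ((?a z)\<^sup>2 + (?b z)\<^sup>2) / 2"
        using sum_squares_bound[of "?a z" "?b z"] by simp
      finally show "norm (?F z - Q z) \<le> K * L * ?a z + K * L * ?b z + K / 2 * (?a z)\<^sup>2 + K / 2 * (?b z)\<^sup>2"
        using K(1) by (simp add: algebra_simps add_divide_distrib)
    qed
    also have "\<dots> = K * L * circ_mean r ?a + K * L * circ_mean r ?b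
        + K / 2 * circ_mean r (\<lambda>z. (?a z)\<^sup>2) + K / 2 * circ_mean r (\<lambda>z. (?b z)\<^sup>2)"
    proof -
      have c: "cb (\<lambda>z. K * L * ?a z)" "cb (\<lambda>z. K * L * ?b z)" "cb (\<lambda>z. K / 2 * (?a z)\<^sup>2)" "cb (\<lambda>z. K / 2 * (?b z)\<^sup>2)"
        "cb (\<lambda>z. (?a z)\<^sup>2)" "cb (\<lambda>z. (?b z)\<^sup>2)"
        by (intro cb_intros ca cb')+
      show ?thesis
        using circ_mean_add[OF r(3) cb_cont cb_cont, OF cb_add[OF cb_add[OF c(1,2)] c(3)] c(4)]
          circ_mean_add[OF r(3) cb_cont cb_cont, OF cb_add[OF c(1,2)] c(3)]
          circ_mean_add[OF r(3) cb_cont cb_cont, OF c(1,2)]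
          circ_mean_cmult[OF r(3) cb_cont[OF ca], of "K * L"] circ_mean_cmult[OF r(3) cb_cont[OF cb'], of "K * L"]
          circ_mean_cmult[OF r(3) cb_cont[OF c(5)], of "K / 2"] circ_mean_cmult[OF r(3) cb_cont[OF c(6)], of "K / 2"]
        by simp
    qed
    also have "\<dots> \<le> K * L * sqrt (t n) + K * L * sqrt (t n) + K / 2 * t n + K / 2 * t n"
      using RA RB K L by (intro add_mono mult_left_mono) auto
    also have "\<dots> = K * (2 * L * sqrt (t n) + t n)" by (simp add: algebra_simps)
    finally show "norm (circ_mean r ?F - circ_mean r Q) \<le> e" using n by simp
  qed
qed

section \<open>Conditional expectations\<close>

text \<open>\<open>ceq u X Y\<close> says that \<open>X\<close> and \<open>Y\<close> have the same conditional expectation given the boundary values of \<open>u\<close>.\<close>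
definition ceq :: "(complex \<Rightarrow> complex) \<Rightarrow> (complex \<Rightarrow> complex) \<Rightarrow> (complex \<Rightarrow> complex) \<Rightarrow> bool" where
  "ceq u X Y \<longleftrightarrow> cb X \<and> cb Y \<and>
     (\<forall>A B. bh A \<longrightarrow> bh B \<longrightarrow> blim (\<lambda>z. (X z - Y z) * (A (u z) * cnj (B (u z)))) 0)"

lemma ceqD:
  assumes "ceq u X Y"
  shows "cb X" "cb Y" "bh A \<Longrightarrow> bh B \<Longrightarrow> blim (\<lambda>z. (X z - Y z) * (A (u z) * cnj (B (u z)))) 0"
  using assms by (auto simp: ceq_def)

text \<open>By \<open>blim_orthogonal\<close> it is enough to test against powers of u and powers of
  its conjugate.\<close>

lemma ceqI:
  assumes "inner_like u" "cb X" "cb Y"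
    "\<And>m. blim (\<lambda>z. (X z - Y z) * u z ^ m) 0" "\<And>m. blim (\<lambda>z. (X z - Y z) * cnj (u z) ^ m) 0"
  shows "ceq u X Y"
  unfolding ceq_def
proof (intro conjI allI impI)
  fix A B assume "bh A" "bh B"
  thus "blim (\<lambda>z. (X z - Y z) * (A (u z) * cnj (B (u z)))) 0"
    by (intro blim_orthogonal assms cb_diff)
qed (use assms in auto)

lemma ceq_refl: "cb X \<Longrightarrow> ceq u X X"
  using blim_const[of "0::complex"] by (simp add: ceq_def)

lemma ceq_lincomb:
  assumes u: "inner_like u" and 1: "ceq u X Y" and 2: "ceq u X' Y'"
  shows "ceq u (\<lambda>z. c * X z + d * X' z) (\<lambda>z. c * Y z + d * Y' z)"
  unfolding ceq_def
proof (intro conjI allI impI)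
  note c = ceqD(1,2)[OF 1] ceqD(1,2)[OF 2]
  show "cb (\<lambda>z. c * X z + d * X' z)" "cb (\<lambda>z. c * Y z + d * Y' z)" by (intro cb_intros c)+
  fix A B assume AB: "bh A" "bh B"
  note c' = inner_like_cb_compose[OF u AB(1)] inner_like_cb_compose[OF u AB(2)]
  have "blim (\<lambda>z. c * ((X z - Y z) * (A (u z) * cnj (B (u z)))) + d * ((X' z - Y' z) * (A (u z) * cnj (B (u z)))))
     (c * 0 + d * 0)"
    by (intro blim_add blim_cmult ceqD(3)[OF 1] ceqD(3)[OF 2] AB cb_intros c c')
  thus "blim (\<lambda>z. (c * X z + d * X' z - (c * Y z + d * Y' z)) * (A (u z) * cnj (B (u z)))) 0"
    by (simp add: algebra_simps)
qed

lemma ceq_add: "inner_like u \<Longrightarrow> ceq u X Y \<Longrightarrow> ceq u X' Y' \<Longrightarrow> ceq u (\<lambda>z. X z + X' z) (\<lambda>z. Y z + Y' z)"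
  using ceq_lincomb[of u X Y X' Y' 1 1] by simp

lemma ceq_cmult: "inner_like u \<Longrightarrow> ceq u X Y \<Longrightarrow> ceq u (\<lambda>z. c * X z) (\<lambda>z. c * Y z)"
  using ceq_lincomb[of u X Y "\<lambda>_. 0" "\<lambda>_. 0" c 0] ceq_refl[of "\<lambda>_. 0" u] by simp

lemma ceq_trans [trans]:
  assumes u: "inner_like u" and 1: "ceq u X Y" and 2: "ceq u Y Z"
  shows "ceq u X Z"
  unfolding ceq_def
proof (intro conjI allI impI)
  fix A B assume AB: "bh A" "bh B"
  note c' = inner_like_cb_compose[OF u AB(1)] inner_like_cb_compose[OF u AB(2)]
  have "blim (\<lambda>z. (X z - Y z) * (A (u z) * cnj (B (u z))) + (Y z - Z z) * (A (u z) * cnj (B (u z)))) (0 + 0)"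
    by (intro blim_add ceqD(3)[OF 1] ceqD(3)[OF 2] AB cb_intros ceqD(1,2)[OF 1] ceqD(1,2)[OF 2] c')
  thus "blim (\<lambda>z. (X z - Z z) * (A (u z) * cnj (B (u z)))) 0" by (simp add: algebra_simps)
qed (use ceqD[OF 1] ceqD[OF 2] in auto)

lemma ceq_cnj:
  assumes u: "inner_like u" and 1: "ceq u X Y"
  shows "ceq u (\<lambda>z. cnj (X z)) (\<lambda>z. cnj (Y z))"
  unfolding ceq_def
proof (intro conjI allI impI)
  fix A B assume AB: "bh A" "bh B"
  note c' = inner_like_cb_compose[OF u AB(1)] inner_like_cb_compose[OF u AB(2)]
  have "blim (\<lambda>z. cnj ((X z - Y z) * (B (u z) * cnj (A (u z))))) (cnj 0)"
    by (intro blim_cnj ceqD(3)[OF 1] AB cb_intros ceqD(1,2)[OF 1] c')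
  thus "blim (\<lambda>z. (cnj (X z) - cnj (Y z)) * (A (u z) * cnj (B (u z)))) 0" by (simp add: mult_ac)
qed (use ceqD[OF 1] in auto)

lemma ceq_bnull:
  assumes u: "inner_like u" and "cb X" "cb Y" "bnull (\<lambda>z. X z - Y z)"
  shows "ceq u X Y"
  unfolding ceq_def
proof (intro conjI allI impI)
  fix A B assume AB: "bh A" "bh B"
  note c' = inner_like_cb_compose[OF u AB(1)] inner_like_cb_compose[OF u AB(2)]
  show "blim (\<lambda>z. (X z - Y z) * (A (u z) * cnj (B (u z)))) 0"
    by (intro bnull_imp_blim bnull_mult assms cb_intros c')
qed (use assms in auto)

text \<open>The boundary values of f(u) carry less information than those of u: a test function of
  f(u) is a test function of u.\<close>

lemma ceq_compose:
  assumes "inner_like f" "ceq u X Y"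
  shows "ceq (\<lambda>z. f (u z)) X Y"
  unfolding ceq_def
proof (intro conjI allI impI)
  fix A B assume "bh A" "bh B"
  from ceqD(3)[OF assms(2) inner_like_bh_compose[OF assms(1) this(1)] inner_like_bh_compose[OF assms(1) this(2)]]
  show "blim (\<lambda>z. (X z - Y z) * (A (f (u z)) * cnj (B (f (u z))))) 0" .
qed (use ceqD[OF assms(2)] in auto)

text \<open>A supply of functions determined by the boundary values of u, closed under what is
  needed for Riesz products. These may be pulled out of conditional expectations
  (\<open>ceq_mult_alg\<close>).\<close>

inductive alg :: "(complex \<Rightarrow> complex) \<Rightarrow> (complex \<Rightarrow> complex) \<Rightarrow> bool" for u where
  base: "bh A \<Longrightarrow> alg u (\<lambda>z. A (u z))"
| cnj_base: "bh A \<Longrightarrow> alg u (\<lambda>z. cnj (A (u z)))"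
| add: "alg u X \<Longrightarrow> alg u Y \<Longrightarrow> alg u (\<lambda>z. X z + Y z)"
| mult: "alg u X \<Longrightarrow> alg u Y \<Longrightarrow> alg u (\<lambda>z. X z * Y z)"

lemma alg_const: "alg u (\<lambda>z. c)"
  using alg.base[of "\<lambda>_. c" u] by simp

lemma alg_self: "alg u (\<lambda>z. u z)"
  using alg.base[of "\<lambda>z. z" u] by simp

lemma alg_compose: assumes "inner_like f" "alg (\<lambda>z. f (u z)) X" shows "alg u X"
  using assms(2)
proof induction
  case (base A) from alg.base[OF inner_like_bh_compose[OF assms(1) base]] show ?case .
next
  case (cnj_base A) from alg.cnj_base[OF inner_like_bh_compose[OF assms(1) cnj_base]] show ?case .
qed (auto intro: alg.intros(3,4))

lemma alg_prod: "(\<And>i. i \<in> S \<Longrightarrow> alg u (X i)) \<Longrightarrow> alg u (\<lambda>z. \<Prod>i\<in>S. X i z)"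
  by (induction S rule: infinite_finite_induct) (auto intro: alg_const alg.mult)

text \<open>A factor A(u) is absorbed into the holomorphic test function, a factor cnj (A(u)) into
  the antiholomorphic one.\<close>

lemma ceq_mult_alg:
  assumes u: "inner_like u" and "alg u P" "ceq u X Y"
  shows "ceq u (\<lambda>z. X z * P z) (\<lambda>z. Y z * P z)"
  using assms(2,3)
proof (induction arbitrary: X Y)
  case (base A)
  show ?case unfolding ceq_def
  proof (intro conjI allI impI cb_intros ceqD(1,2)[OF base(2)] inner_like_cb_compose[OF u base(1)])
    fix A' B assume "bh A'" "bh B"
    from ceqD(3)[OF base(2) bh_mult[OF base(1) this(1)] this(2)]
    show "blim (\<lambda>z. (X z * A (u z) - Y z * A (u z)) * (A' (u z) * cnj (B (u z)))) 0" by (simp add: algebra_simps)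
  qed
next
  case (cnj_base A)
  show ?case unfolding ceq_def
  proof (intro conjI allI impI cb_intros ceqD(1,2)[OF cnj_base(2)] inner_like_cb_compose[OF u cnj_base(1)])
    fix A' B assume "bh A'" "bh B"
    from ceqD(3)[OF cnj_base(2) this(1) bh_mult[OF cnj_base(1) this(2)]]
    show "blim (\<lambda>z. (X z * cnj (A (u z)) - Y z * cnj (A (u z))) * (A' (u z) * cnj (B (u z)))) 0" by (simp add: algebra_simps)
  qed
next
  case (add P Q)
  from ceq_add[OF u add.IH(1)[OF add.prems] add.IH(2)[OF add.prems]] show ?case by (simp add: algebra_simps)
next
  case (mult P Q)
  from mult.IH(2)[OF mult.IH(1)[OF mult.prems]] show ?case by (simp add: mult.assoc)
qed

lemma ceq_blim: assumes "ceq u X Y" "blim Y L" shows "blim X L"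
proof -
  have "blim (\<lambda>z. X z - Y z) 0" using ceqD(3)[OF assms(1) bh_const[of 1] bh_const[of 1]] by simp
  from blim_add[OF this assms(2)] ceqD(1,2)[OF assms(1)] show ?thesis by auto
qed

text \<open>f(z)^m is z^m times the m-th power of f(z)/z, so its first m coefficients
  vanish.\<close>

lemma tcoeff_inner_power:
  assumes "inner_like f"
  shows "tcoeff (\<lambda>z. f z ^ m) i = (if i < m then 0 else tcoeff (\<lambda>z. shift f z ^ m) (i - m))"
proof -
  have "shift f holomorphic_on ball 0 1" using assms by (intro shift_holomorphic) (simp add: inner_like_def)
  hence "(\<lambda>z. shift f z ^ m) holomorphic_on ball 0 1" by (intro holomorphic_intros)
  from tcoeff_mult_ident_pow[OF this, of m i] have
    "tcoeff (\<lambda>z. z ^ m * shift f z ^ m) i = (if i < m then 0 else tcoeff (\<lambda>z. shift f z ^ m) (i - m))" .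
  moreover have "f z ^ m = z ^ m * shift f z ^ m" for z
    using assms by (subst shift_eq[of f z]) (simp add: inner_like_def power_mult_distrib)
  ultimately show ?thesis by simp
qed

lemma tcoeff_inner_power_1:
  assumes "inner_like f" shows "tcoeff (\<lambda>z. f z ^ m) 1 = (if m = 1 then tcoeff f 1 else 0)"
proof -
  consider "m = 0" | "m = 1" | "m > 1" by linarith
  thus ?thesis by cases (use tcoeff_inner_power[OF assms, of m 1] in \<open>auto simp: tcoeff_const\<close>)
qed

lemma tcoeff_inner_power_2:
  assumes "inner_like f"
  shows "tcoeff (\<lambda>z. f z ^ m) 2 = (if m = 1 then tcoeff f 2 else if m = 2 then (tcoeff f 1)\<^sup>2 else 0)"
proof -
  consider "m = 0" | "m = 1" | "m = 2" | "m > 2" by linarith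
  thus ?thesis
  proof cases
    case 3
    thus ?thesis using tcoeff_inner_power[OF assms, of m 2] tcoeff_Suc[of f 0] by simp
  qed (use tcoeff_inner_power[OF assms, of m 2] in \<open>auto simp: tcoeff_const\<close>)
qed

section \<open>First and second conditional moments of u given f(u)\<close>

context
  fixes f u :: "complex \<Rightarrow> complex" and v :: "complex \<Rightarrow> complex" and l :: complex
  assumes f: "inner_like f" and u: "inner_like u"
  defines "v \<equiv> \<lambda>z. f (u z)" and "l \<equiv> tcoeff f 1"
begin

lemma inner_v: "inner_like v"
  unfolding v_def by (rule inner_like_compose[OF f u])

lemma cb_uv: "cb u" "cb v"
  using bh_imp_cb[OF inner_like_bh[OF u]] bh_imp_cb[OF inner_like_bh[OF inner_v]] by simp_all

lemma blim_cnj_u_v: "blim (\<lambda>z. cnj (u z) ^ i * v z ^ m) (tcoeff (\<lambda>z. f z ^ m) i)"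
  unfolding v_def by (rule blim_inner_cnj_power[OF u bh_power[OF inner_like_bh[OF f]]])

lemma blim_cnj_v_v: "blim (\<lambda>z. cnj (v z) ^ i * v z ^ m) (if i = m then 1 else 0)"
  using blim_inner_cnj_power[OF inner_v bh_power[OF bh_ident], of i m] by (simp add: tcoeff_power)

lemma blim_v_power: "blim (\<lambda>z. v z ^ m) (if m = 0 then 1 else 0)"
  using blim_cnj_v_v[of 0 m] by simp

text \<open>Uses |v| = 1 on the boundary to cancel one conjugate factor.\<close>

lemma blim_v_pow_reduce:
  assumes "blim (\<lambda>z. X z * v z ^ m) L" "cb X"
  shows "blim (\<lambda>z. X z * (cnj (v z) * v z ^ Suc m)) L"
proof (rule blim_bnull_diff[OF assms(1)])
  have "bnull (\<lambda>z. (v z * cnj (v z) - 1) * (X z * v z ^ m))"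
    by (rule inner_like_bnull[OF inner_v]) (intro cb_intros cb_uv assms)
  thus "bnull (\<lambda>z. X z * (cnj (v z) * v z ^ Suc m) - X z * v z ^ m)" by (simp add: algebra_simps)
qed (intro cb_intros cb_uv assms)+

lemma blim_u_pow_v: "blim (\<lambda>z. u z ^ Suc i * v z ^ m) 0"
proof -
  have "(\<lambda>z. u z ^ Suc i * v z ^ m) holomorphic_on ball 0 1"
    using inner_likeD(1)[OF u] inner_likeD(1)[OF inner_v] by (intro holomorphic_intros)
  from blim_holomorphic[OF this] show ?thesis using inner_likeD(3)[OF u] by simp
qed

text \<open>Among the powers f(z)^m only m = 1 has a first Taylor coefficient, so u correlates with
  v alone among the powers of v. Against conjugated test powers the function is holomorphic with
  value 0 at the origin.\<close>

lemma ceq_diff_zero: "ceq v (\<lambda>z. u z - cnj l * v z) (\<lambda>z. 0)"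
proof (rule ceqI[OF inner_v])
  fix m
  have "blim (\<lambda>z. u z ^ Suc 0 * v z ^ m - cnj l * v z ^ Suc m) (0 - cnj l * (if Suc m = 0 then 1 else 0))"
    by (intro blim_diff blim_cmult blim_u_pow_v blim_v_power cb_intros cb_uv)
  thus "blim (\<lambda>z. (u z - cnj l * v z - 0) * v z ^ m) 0" by (simp add: algebra_simps)
  have "blim (\<lambda>z. cnj (cnj (u z) ^ 1 * v z ^ m - l * (cnj (v z) ^ 1 * v z ^ m)))
     (cnj (tcoeff (\<lambda>z. f z ^ m) 1 - l * (if 1 = m then 1 else 0)))"
    by (intro blim_cnj blim_diff blim_cmult blim_cnj_u_v blim_cnj_v_v cb_intros cb_uv)
  thus "blim (\<lambda>z. (u z - cnj l * v z - 0) * cnj (v z) ^ m) 0"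
    unfolding tcoeff_inner_power_1[OF f] by (simp add: algebra_simps l_def split: if_splits)
qed (intro cb_intros cb_uv)+

text \<open>Expanding the square produces 1 + |l|^2 - 2 |l|^2 against the constant and 0 against
  positive powers of v. The function being real, the conjugate powers follow by conjugation.\<close>

lemma ceq_diff_norm: "ceq v (\<lambda>z. (u z - cnj l * v z) * cnj (u z - cnj l * v z)) (\<lambda>z. 1 - l * cnj l)"
proof -
  let ?X = "\<lambda>z. (u z - cnj l * v z) * cnj (u z - cnj l * v z) - (1 - l * cnj l)"
  have cX: "cb ?X" by (intro cb_intros cb_uv)
  have 0: "blim (\<lambda>z. ?X z * v z ^ m) 0" for m
  proof -
    let ?\<delta> = "(if m = 0 then 1 else 0) :: complex"
    have 1: "blim (\<lambda>z. u z * cnj (u z) * v z ^ m) ?\<delta>"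
    proof (rule blim_bnull_diff[OF blim_v_power])
      have "bnull (\<lambda>z. (u z * cnj (u z) - 1) * v z ^ m)"
        by (rule inner_like_bnull[OF u]) (intro cb_intros cb_uv)
      thus "bnull (\<lambda>z. u z * cnj (u z) * v z ^ m - v z ^ m)" by (simp add: algebra_simps)
    qed (intro cb_intros cb_uv)+
    have 2: "blim (\<lambda>z. 1 * (cnj (v z) * v z ^ Suc m)) ?\<delta>"
      by (rule blim_v_pow_reduce) (use blim_v_power in auto)
    have 3: "blim (\<lambda>z. u z * cnj (v z) * v z ^ m) (cnj l * ?\<delta>)"
    proof (cases m)
      case 0
      have "blim (\<lambda>z. cnj (cnj (u z) ^ 1 * v z ^ 1)) (cnj (tcoeff (\<lambda>z. f z ^ 1) 1))"
        by (intro blim_cnj blim_cnj_u_v cb_intros cb_uv)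
      thus ?thesis using 0 by (simp add: l_def)
    next
      case (Suc k)
      have "blim (\<lambda>z. u z * (cnj (v z) * v z ^ Suc k)) 0"
        by (rule blim_v_pow_reduce) (use blim_u_pow_v[of 0 k] cb_uv in auto)
      thus ?thesis using Suc by (simp add: mult.assoc)
    qed
    have 4: "blim (\<lambda>z. cnj (u z) ^ 1 * v z ^ Suc m) (l * ?\<delta>)"
      using blim_cnj_u_v[of 1 "Suc m"] unfolding tcoeff_inner_power_1[OF f] by (auto simp: l_def split: if_splits)
    have "blim (\<lambda>z. u z * cnj (u z) * v z ^ m + (l * cnj l) * (1 * (cnj (v z) * v z ^ Suc m))
        - l * (u z * cnj (v z) * v z ^ m) - cnj l * (cnj (u z) ^ 1 * v z ^ Suc m) - (1 - l * cnj l) * v z ^ m)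
       (?\<delta> + (l * cnj l) * ?\<delta> - l * (cnj l * ?\<delta>) - cnj l * (l * ?\<delta>) - (1 - l * cnj l) * ?\<delta>)"
      by (intro blim_diff blim_add blim_cmult 1 2 3 4 blim_v_power cb_intros cb_uv)
    thus ?thesis by (simp add: algebra_simps split: if_splits)
  qed
  show ?thesis
  proof (rule ceqI[OF inner_v])
    fix m
    show "blim (\<lambda>z. ?X z * v z ^ m) 0" by (rule 0)
    have "blim (\<lambda>z. cnj (?X z * v z ^ m)) (cnj 0)" by (intro blim_cnj 0 cb_intros cX cb_uv)
    thus "blim (\<lambda>z. ?X z * cnj (v z) ^ m) 0" by (simp add: mult_ac)
  qed (intro cb_intros cb_uv)+
qed

text \<open>Only f and f^2 (as a power) have a second Taylor coefficient. The contributions of v^2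
  cancel as l^2 - 2 l^2 + l^2, while the coefficient of v survives. This surviving term is the
  source of the second-order error in the Riesz product.\<close>

lemma ceq_diff_square: "ceq v (\<lambda>z. (u z - cnj l * v z)\<^sup>2) (\<lambda>z. cnj (tcoeff f 2) * v z)"
proof (rule ceqI[OF inner_v])
  fix m
  let ?c = "tcoeff f 2"
  have "blim (\<lambda>z. u z ^ Suc 1 * v z ^ m - (2 * cnj l) * (u z ^ Suc 0 * v z ^ Suc m)
      + (cnj l)\<^sup>2 * v z ^ Suc (Suc m) - cnj ?c * v z ^ Suc m)
      (0 - (2 * cnj l) * 0 + (cnj l)\<^sup>2 * (if Suc (Suc m) = 0 then 1 else 0) - cnj ?c * (if Suc m = 0 then 1 else 0))"
    by (intro blim_diff blim_add blim_cmult blim_u_pow_v blim_v_power cb_intros cb_uv)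
  thus "blim (\<lambda>z. ((u z - cnj l * v z)\<^sup>2 - cnj ?c * v z) * v z ^ m) 0"
    by (simp add: power2_eq_square algebra_simps)
  have 2: "blim (\<lambda>z. cnj (u z) * (cnj (v z) * v z ^ m)) (if m = 2 then l else 0)"
  proof (cases m)
    case 0
    have "blim (\<lambda>z. cnj (u z ^ Suc 0 * v z ^ 1)) (cnj 0)"
      by (intro blim_cnj blim_u_pow_v cb_intros cb_uv)
    thus ?thesis using 0 by simp
  next
    case (Suc k)
    have "blim (\<lambda>z. cnj (u z) * (cnj (v z) * v z ^ Suc k)) (tcoeff (\<lambda>z. f z ^ k) 1)"
      by (rule blim_v_pow_reduce) (use blim_cnj_u_v[of 1 k] cb_uv in auto)
    thus ?thesis using Suc unfolding tcoeff_inner_power_1[OF f] by (simp add: l_def split: if_splits)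
  qed
  have "blim (\<lambda>z. cnj (cnj (u z) ^ 2 * v z ^ m - (2 * l) * (cnj (u z) * (cnj (v z) * v z ^ m))
       + l\<^sup>2 * (cnj (v z) ^ 2 * v z ^ m) - ?c * (cnj (v z) ^ 1 * v z ^ m)))
      (cnj (tcoeff (\<lambda>z. f z ^ m) 2 - (2 * l) * (if m = 2 then l else 0) + l\<^sup>2 * (if 2 = m then 1 else 0)
       - ?c * (if 1 = m then 1 else 0)))"
    by (intro blim_cnj blim_diff blim_add blim_cmult blim_cnj_u_v blim_cnj_v_v 2 cb_intros cb_uv)
  also have "cnj (tcoeff (\<lambda>z. f z ^ m) 2 - (2 * l) * (if m = 2 then l else 0) + l\<^sup>2 * (if 2 = m then 1 else 0)
       - ?c * (if 1 = m then 1 else 0)) = 0"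
    unfolding tcoeff_inner_power_2[OF f] by (auto simp: l_def power2_eq_square)
  finally show "blim (\<lambda>z. ((u z - cnj l * v z)\<^sup>2 - cnj ?c * v z) * cnj (v z) ^ m) 0"
    by (simp add: power2_eq_square algebra_simps)
qed (intro cb_intros cb_uv)+

end

section \<open>Riesz products\<close>

text \<open>The condition 2 delta <= 1 keeps the factors nonnegative, since |b_k d_k| <= 2; delta <=
  1 - |f'(0)| keeps the correlation bound \<open>xbd\<close> at most 1.\<close>

locale riesz_product =
  fixes f :: "complex \<Rightarrow> complex" and b :: "nat \<Rightarrow> complex" and \<delta> :: real
  assumes f: "inner_like f" and b: "\<And>n. norm (b n) \<le> 1"
    and l: "norm (tcoeff f 1) < 1"
    and \<delta>: "0 < \<delta>" "2 * \<delta> \<le> 1" "\<delta> \<le> 1 - norm (tcoeff f 1)"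
begin

definition mult0 :: complex where "mult0 = tcoeff f 1"

definition incr :: "nat \<Rightarrow> complex \<Rightarrow> complex" where
  "incr k z = (f ^^ k) z - cnj mult0 * (f ^^ Suc k) z"

text \<open>This is 1 + delta Re(b_k d_k), written with the conjugate so that it visibly lies in the
  algebra \<open>alg\<close>.\<close>

definition fac :: "nat \<Rightarrow> complex \<Rightarrow> complex" where
  "fac k z = 1 + of_real (\<delta> / 2) * (b k * incr k z + cnj (b k * incr k z))"

definition rprod :: "nat \<Rightarrow> nat \<Rightarrow> complex \<Rightarrow> complex" where
  "rprod j N z = (\<Prod>i\<in>{j..<N}. fac i z)"

lemma inner_it: "inner_like (f ^^ k)"
  by (rule inner_like_iterate[OF f])

lemma cb_it: "cb (f ^^ k)"
  by (rule bh_imp_cb[OF inner_like_bh[OF inner_it]])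

lemma it_Suc: "(f ^^ Suc k) = (\<lambda>z. f ((f ^^ k) z))"
  by (simp add: o_def)

lemma it_norm: "norm z < 1 \<Longrightarrow> norm ((f ^^ k) z) < 1"
  by (rule inner_like_norm_lt[OF inner_it])

lemma cb_incr: "cb (incr k)"
  unfolding incr_def[abs_def] by (intro cb_intros cb_it)

lemma cb_fac: "cb (fac k)"
  unfolding fac_def[abs_def] by (intro cb_intros cb_incr)

lemma cb_rprod: "cb (rprod j N)"
  unfolding rprod_def[abs_def] by (intro cb_intros cb_fac)

lemma norm_incr: assumes "norm z < 1" shows "norm (incr k z) \<le> 2"
proof -
  have "norm (incr k z) \<le> norm ((f ^^ k) z) + norm (cnj mult0 * (f ^^ Suc k) z)"
    unfolding incr_def by (rule norm_triangle_ineq4)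
  also have "\<dots> \<le> 1 + 1 * 1"
    unfolding norm_mult using it_norm[OF assms, of k] it_norm[OF assms, of "Suc k"] l
    by (intro add_mono mult_mono) (auto simp: mult0_def)
  finally show ?thesis by simp
qed

lemma fac_real: "fac k z = of_real (1 + \<delta> * Re (b k * incr k z))"
proof -
  have "b k * incr k z + cnj (b k * incr k z) = of_real (2 * Re (b k * incr k z))"
    by (rule complex_add_cnj)
  thus ?thesis by (simp add: fac_def)
qed

lemma fac_nonneg: assumes "norm z < 1" shows "1 + \<delta> * Re (b k * incr k z) \<ge> 0"
proof -
  have "norm (b k * incr k z) \<le> 1 * 2" unfolding norm_mult
    by (intro mult_mono b norm_incr assms) auto
  hence "\<bar>Re (b k * incr k z)\<bar> \<le> 2" using abs_Re_le_cmod[of "b k * incr k z"] by linarith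
  hence "\<delta> * Re (b k * incr k z) \<ge> \<delta> * (-2)" using \<delta> by (intro mult_left_mono) auto
  thus ?thesis using \<delta> by linarith
qed

lemma rprod_norm: assumes "norm z < 1" shows "rprod j N z = of_real (norm (rprod j N z))"
proof -
  have "norm (rprod j N z) = (\<Prod>i\<in>{j..<N}. norm (fac i z))" by (simp add: rprod_def prod_norm)
  also have "of_real \<dots> = (\<Prod>i\<in>{j..<N}. complex_of_real (norm (fac i z)))" by simp
  also have "\<dots> = rprod j N z"
    unfolding rprod_def
    by (rule prod.cong[OF refl]) (simp only: fac_real norm_of_real abs_of_nonneg[OF fac_nonneg[OF assms]])
  finally show ?thesis by simp
qed

lemma alg_iterate: "j \<le> k \<Longrightarrow> alg (f ^^ k) X \<Longrightarrow> alg (f ^^ j) X"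
proof (induction k rule: dec_induct)
  case (step n)
  from alg_compose[OF f step.prems[unfolded it_Suc]] step.IH show ?case by simp
qed

lemma ceq_iterate: "j \<le> k \<Longrightarrow> ceq (f ^^ j) X Y \<Longrightarrow> ceq (f ^^ k) X Y"
proof (induction k rule: dec_induct)
  case (step n)
  from ceq_compose[OF f step.IH[OF step.prems]] show ?case by (simp add: it_Suc)
qed

lemma alg_it: "j \<le> k \<Longrightarrow> alg (f ^^ j) (f ^^ k)"
  using alg_iterate[OF _ alg_self[of "f ^^ k"]] by simp

lemma alg_cnj_it: "j \<le> k \<Longrightarrow> alg (f ^^ j) (\<lambda>z. cnj ((f ^^ k) z))"
  using alg_iterate[OF _ alg.cnj_base[OF bh_ident, of "f ^^ k"]] by simp

lemma alg_incr: assumes "j \<le> k" shows "alg (f ^^ j) (incr k)"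
proof -
  have "alg (f ^^ j) (\<lambda>z. (f ^^ k) z + (- cnj mult0) * (f ^^ Suc k) z)"
    by (intro alg.add alg.mult alg_const alg_it) (use assms in auto)
  thus ?thesis by (simp add: incr_def[abs_def])
qed

lemma alg_cnj_incr: assumes "j \<le> k" shows "alg (f ^^ j) (\<lambda>z. cnj (incr k z))"
proof -
  have "alg (f ^^ j) (\<lambda>z. cnj ((f ^^ k) z) + (- mult0) * cnj ((f ^^ Suc k) z))"
    by (intro alg.add alg.mult alg_const alg_cnj_it) (use assms in auto)
  thus ?thesis by (simp add: incr_def[abs_def])
qed

lemma alg_fac: assumes "j \<le> k" shows "alg (f ^^ j) (fac k)"
proof -
  have "alg (f ^^ j) (\<lambda>z. 1 + of_real (\<delta> / 2) * (b k * incr k z + cnj (b k) * cnj (incr k z)))"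
    by (intro alg.add alg.mult alg_const alg_incr alg_cnj_incr assms)
  thus ?thesis by (simp add: fac_def[abs_def])
qed

lemma alg_rprod: "j \<le> k \<Longrightarrow> alg (f ^^ j) (rprod k N)"
  unfolding rprod_def[abs_def] by (intro alg_prod alg_fac) auto

lemma ceq_incr: "ceq (f ^^ Suc k) (incr k) (\<lambda>z. 0)"
  using ceq_diff_zero[OF f inner_it[of k]] unfolding incr_def[abs_def] it_Suc mult0_def .

lemma ceq_cnj_incr: "ceq (f ^^ Suc k) (\<lambda>z. cnj (incr k z)) (\<lambda>z. 0)"
  using ceq_cnj[OF inner_it ceq_incr[of k]] by simp

lemma ceq_incr_norm: "ceq (f ^^ Suc k) (\<lambda>z. incr k z * cnj (incr k z)) (\<lambda>z. 1 - mult0 * cnj mult0)"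
  using ceq_diff_norm[OF f inner_it[of k]] unfolding incr_def[abs_def] it_Suc mult0_def .

lemma ceq_incr_square: "ceq (f ^^ Suc k) (\<lambda>z. (incr k z)\<^sup>2) (\<lambda>z. cnj (tcoeff f 2) * (f ^^ Suc k) z)"
  using ceq_diff_square[OF f inner_it[of k]] unfolding incr_def[abs_def] it_Suc mult0_def .

lemma ceq_fac: "ceq (f ^^ Suc k) (fac k) (\<lambda>z. 1)"
proof -
  have "ceq (f ^^ Suc k) (\<lambda>z. 1 + of_real (\<delta> / 2) * (b k * incr k z + cnj (b k) * cnj (incr k z)))
      (\<lambda>z. 1 + of_real (\<delta> / 2) * (b k * 0 + cnj (b k) * 0))"
    by (intro ceq_add ceq_cmult ceq_refl cb_const inner_it ceq_incr ceq_cnj_incr)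
  thus ?thesis by (simp add: fac_def[abs_def])
qed

text \<open>The conditional expectation of d_k times its own factor, given the next iterate: d_k^2
  and |d_k|^2 are replaced by their conditional moments.\<close>

definition drift :: "nat \<Rightarrow> complex \<Rightarrow> complex" where
  "drift k z = of_real (\<delta> / 2) * (b k * (cnj (tcoeff f 2) * (f ^^ Suc k) z) + cnj (b k) * (1 - mult0 * cnj mult0))"

lemma ceq_incr_fac: "ceq (f ^^ Suc k) (\<lambda>z. incr k z * fac k z) (drift k)"
proof -
  have "ceq (f ^^ Suc k) (\<lambda>z. incr k z + of_real (\<delta> / 2) * (b k * (incr k z)\<^sup>2 + cnj (b k) * (incr k z * cnj (incr k z))))
      (\<lambda>z. 0 + of_real (\<delta> / 2) * (b k * (cnj (tcoeff f 2) * (f ^^ Suc k) z) + cnj (b k) * (1 - mult0 * cnj mult0)))"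
    by (intro ceq_add ceq_cmult inner_it ceq_incr ceq_incr_norm ceq_incr_square)
  thus ?thesis by (simp add: fac_def[abs_def] drift_def[abs_def] algebra_simps power2_eq_square)
qed

text \<open>Split f^k into conj(l) f^(k+1) and d_k; the first part only sees that the factor has
  conditional expectation 1.\<close>

lemma ceq_it_fac: "ceq (f ^^ Suc k) (\<lambda>z. (f ^^ k) z * fac k z) (\<lambda>z. cnj mult0 * (f ^^ Suc k) z + drift k z)"
proof -
  have "ceq (f ^^ Suc k) (\<lambda>z. cnj mult0 * (fac k z * (f ^^ Suc k) z) + incr k z * fac k z)
      (\<lambda>z. cnj mult0 * (1 * (f ^^ Suc k) z) + drift k z)"
    by (intro ceq_add ceq_cmult inner_it ceq_incr_fac ceq_mult_alg alg_it ceq_fac order_refl)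
  thus ?thesis by (simp add: incr_def algebra_simps)
qed

lemma rprod_Suc: "j \<le> k \<Longrightarrow> rprod j (Suc k) z = rprod j k z * fac k z"
  by (simp add: rprod_def)

lemma rprod_split: "j \<le> k \<Longrightarrow> k \<le> N \<Longrightarrow> rprod j N z = rprod j k z * rprod k N z"
  by (simp add: rprod_def prod.atLeastLessThan_concat)

lemma rprod_first: "k < N \<Longrightarrow> rprod k N z = fac k z * rprod (Suc k) N z"
  by (simp add: rprod_def prod.atLeast_Suc_lessThan)

text \<open>Each factor has conditional expectation 1 given the next iterate, and the conditioning
  only gets coarser along the iterates.\<close>

lemma ceq_rprod: "j \<le> k \<Longrightarrow> ceq (f ^^ k) (rprod j k) (\<lambda>z. 1)"
proof (induction k rule: dec_induct)
  case base
  show ?case by (simp add: rprod_def[abs_def] ceq_refl)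
next
  case (step n)
  have "ceq (f ^^ n) (\<lambda>z. rprod j n z * fac n z) (\<lambda>z. 1 * fac n z)"
    by (rule ceq_mult_alg[OF inner_it alg_fac step.IH]) simp
  hence "ceq (f ^^ Suc n) (\<lambda>z. rprod j n z * fac n z) (\<lambda>z. 1 * fac n z)"
    by (rule ceq_iterate[rotated]) simp
  also have "ceq (f ^^ Suc n) (\<lambda>z. 1 * fac n z) (\<lambda>z. 1)" using ceq_fac[of n] by simp
  finally (ceq_trans[OF inner_it]) have "ceq (f ^^ Suc n) (\<lambda>z. rprod j n z * fac n z) (\<lambda>z. 1)" .
  moreover have "rprod j (Suc n) = (\<lambda>z. rprod j n z * fac n z)" using step by (intro ext) (simp add: rprod_Suc)
  ultimately show ?case by (simp only:)
qed

lemma blim_rprod: "j \<le> k \<Longrightarrow> blim (rprod j k) 1"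
  by (rule ceq_blim[OF ceq_rprod blim_const])

lemma blim_norm_rprod: assumes "j \<le> k" shows "blim (\<lambda>z. norm (rprod j k z)) 1"
proof -
  have "blim (\<lambda>z. Re (rprod j k z)) (Re 1)"
    by (rule blim_linear[OF blim_rprod[OF assms] cb_rprod bounded_linear_Re])
  moreover have "Re (rprod j k z) = norm (rprod j k z)" if "norm z < 1" for z
    using arg_cong[OF rprod_norm[OF that, of j k], of Re] by simp
  ultimately show ?thesis
    using blim_cong[of "\<lambda>z. Re (rprod j k z)" "Re 1" "\<lambda>z. norm (rprod j k z)"] by simp
qed

lemma norm_tcoeff_2: "norm (tcoeff f 2) \<le> 1"
proof -
  have "(\<Sum>i<3. (norm (tcoeff f i))\<^sup>2) \<le> 1\<^sup>2"
    by (rule tcoeff_square_sum_le[OF inner_like_bh[OF f]]) (use inner_like_norm_lt[OF f] in \<open>auto intro: less_imp_le\<close>)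
  moreover have "(norm (tcoeff f 2))\<^sup>2 \<le> (\<Sum>i<3. (norm (tcoeff f i))\<^sup>2)"
    by (rule member_le_sum) auto
  ultimately have "(norm (tcoeff f 2))\<^sup>2 \<le> 1" by simp
  thus ?thesis by (simp add: power_le_one_iff abs_square_le_1)
qed

text \<open>The fixed point of x = |l| x + delta, which makes the bound reproduce itself in the
  downward induction of \<open>blim_it_rprod\<close>.\<close>

definition xbd :: real where "xbd = \<delta> / (1 - norm mult0)"

lemma xbd: "0 < xbd" "xbd \<le> 1" "norm mult0 * xbd + \<delta> = xbd"
  using \<delta> l by (auto simp: xbd_def mult0_def field_simps)

lemma norm_one_minus: "1 - mult0 * cnj mult0 = of_real (1 - (norm mult0)\<^sup>2)" "0 \<le> 1 - (norm mult0)\<^sup>2" "1 - (norm mult0)\<^sup>2 \<le> 1"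
  using l by (simp_all add: complex_norm_square[symmetric] mult0_def power_le_one del: of_real_power)

lemma blim_it_rprod: "k \<le> N \<Longrightarrow> \<exists>x. blim (\<lambda>z. (f ^^ k) z * rprod k N z) x \<and> norm x \<le> xbd"
proof (induction k rule: inc_induct)
  case base
  have "blim (f ^^ N) ((f ^^ N) 0)"
    using inner_likeD(1)[OF inner_it[of N]] by (rule blim_holomorphic)
  thus ?case using xbd inner_likeD(3)[OF inner_it[of N]] by (intro exI[of _ 0]) (simp add: rprod_def)
next
  case (step k)
  then obtain x where x: "blim (\<lambda>z. (f ^^ Suc k) z * rprod (Suc k) N z) x" "norm x \<le> xbd" by blast
  \<comment> \<open>Conditioning on f^(k+1) expresses the correlation at k through the one at k+1.
    Both terms in the bracket have modulus at most 1, as x does, hence the increment delta.\<close>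
  let ?y = "cnj mult0 * x + of_real (\<delta> / 2) * (b k * (cnj (tcoeff f 2) * x) + cnj (b k) * (1 - mult0 * cnj mult0) * 1)"
  have P: "blim (rprod (Suc k) N) 1" using step by (intro blim_rprod) simp
  have "ceq (f ^^ Suc k) (\<lambda>z. (f ^^ k) z * fac k z * rprod (Suc k) N z) (\<lambda>z. (cnj mult0 * (f ^^ Suc k) z + drift k z) * rprod (Suc k) N z)"
    by (rule ceq_mult_alg[OF inner_it alg_rprod ceq_it_fac]) simp
  moreover have "blim (\<lambda>z. cnj mult0 * ((f ^^ Suc k) z * rprod (Suc k) N z)
      + of_real (\<delta> / 2) * (b k * (cnj (tcoeff f 2) * ((f ^^ Suc k) z * rprod (Suc k) N z))
        + cnj (b k) * (1 - mult0 * cnj mult0) * rprod (Suc k) N z)) ?y"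
    by (intro blim_add blim_cmult x P cb_intros cb_it cb_rprod)
  hence "blim (\<lambda>z. (cnj mult0 * (f ^^ Suc k) z + drift k z) * rprod (Suc k) N z) ?y"
    by (simp add: drift_def algebra_simps)
  ultimately have "blim (\<lambda>z. (f ^^ k) z * fac k z * rprod (Suc k) N z) ?y" by (rule ceq_blim)
  moreover have "norm ?y \<le> norm mult0 * xbd + \<delta> / 2 * (1 * (1 * 1) + 1 * 1 * 1)"
  proof -
    have "norm (1 - mult0 * cnj mult0) \<le> 1" unfolding norm_one_minus(1) norm_of_real using norm_one_minus(2,3) by simp
    hence 2: "norm (cnj (b k) * (1 - mult0 * cnj mult0) * 1) \<le> 1 * 1 * 1"
      unfolding norm_mult complex_mod_cnj using b[of k] by (intro mult_mono) auto
    have "norm x \<le> 1" using x xbd by simp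
    hence 1: "norm (b k * (cnj (tcoeff f 2) * x)) \<le> 1 * (1 * 1)"
      unfolding norm_mult complex_mod_cnj using b[of k] norm_tcoeff_2 by (intro mult_mono) auto
    have 3: "norm (cnj mult0 * x) \<le> norm mult0 * xbd"
      unfolding norm_mult complex_mod_cnj using x by (intro mult_left_mono) auto
    have "norm (of_real (\<delta> / 2) * (b k * (cnj (tcoeff f 2) * x) + cnj (b k) * (1 - mult0 * cnj mult0) * 1))
        \<le> \<delta> / 2 * (1 * (1 * 1) + 1 * 1 * 1)"
      unfolding norm_mult[of "of_real _"]
      using \<delta> by (intro mult_mono norm_triangle_le[OF add_mono[OF 1 2]]) auto
    with 3 show ?thesis by (rule norm_triangle_le[OF add_mono])
  qed
  ultimately show ?case using xbd step by (intro exI[of _ ?y]) (simp add: rprod_first mult.assoc)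
qed

text \<open>The factors before n average out given f^n, those after n given f^(n+1). The factor of
  index n yields the main term through |d_n|^2 and the error through d_n^2.\<close>

lemma blim_rprod_incr:
  assumes "j \<le> n" "n < N"
  shows "\<exists>\<theta>. blim (\<lambda>z. rprod j N z * incr n z) \<theta> \<and>
    norm (\<theta> - of_real (\<delta> / 2 * (1 - (norm mult0)\<^sup>2)) * cnj (b n)) \<le> \<delta> / 2 * xbd"
proof -
  obtain x where x: "blim (\<lambda>z. (f ^^ Suc n) z * rprod (Suc n) N z) x" "norm x \<le> xbd"
    using blim_it_rprod[of "Suc n" N] assms by auto
  have P: "blim (rprod (Suc n) N) 1" using assms by (intro blim_rprod) simp
  let ?y = "of_real (\<delta> / 2) * (b n * (cnj (tcoeff f 2) * x) + cnj (b n) * (1 - mult0 * cnj mult0) * 1)"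
  have 1: "ceq (f ^^ Suc n) (\<lambda>z. incr n z * fac n z * rprod (Suc n) N z) (\<lambda>z. drift n z * rprod (Suc n) N z)"
    by (rule ceq_mult_alg[OF inner_it alg_rprod ceq_incr_fac]) simp
  have "blim (\<lambda>z. of_real (\<delta> / 2) * (b n * (cnj (tcoeff f 2) * ((f ^^ Suc n) z * rprod (Suc n) N z))
        + cnj (b n) * (1 - mult0 * cnj mult0) * rprod (Suc n) N z)) ?y"
    by (intro blim_add blim_cmult x P cb_intros cb_it cb_rprod)
  hence "blim (\<lambda>z. drift n z * rprod (Suc n) N z) ?y"
    by (simp add: drift_def algebra_simps)
  with 1 have 2: "blim (\<lambda>z. incr n z * fac n z * rprod (Suc n) N z) ?y" by (rule ceq_blim)
  \<comment> \<open>The remaining factors are functions of f^n, so the initial product may be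
    replaced by 1.\<close>
  have "ceq (f ^^ n) (\<lambda>z. rprod j n z * (incr n z * fac n z * rprod (Suc n) N z)) (\<lambda>z. 1 * (incr n z * fac n z * rprod (Suc n) N z))"
    by (intro ceq_mult_alg inner_it alg.mult alg_incr alg_fac alg_rprod ceq_rprod assms) auto
  from ceq_blim[OF this] 2 have "blim (\<lambda>z. rprod j n z * (incr n z * fac n z * rprod (Suc n) N z)) ?y" by simp
  moreover have "rprod j n z * (incr n z * fac n z * rprod (Suc n) N z) = rprod j N z * incr n z" for z
    using rprod_split[of j n N z] rprod_first[of n N z] assms by simp
  ultimately have h1: "blim (\<lambda>z. rprod j N z * incr n z) ?y" by simp
  have h2: "?y - of_real (\<delta> / 2 * (1 - (norm mult0)\<^sup>2)) * cnj (b n) = of_real (\<delta> / 2) * (b n * (cnj (tcoeff f 2) * x))"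
    by (simp add: norm_one_minus(1) algebra_simps)
  have h3: "norm (of_real (\<delta> / 2) * (b n * (cnj (tcoeff f 2) * x))) \<le> \<delta> / 2 * (1 * (1 * xbd))"
    unfolding norm_mult complex_mod_cnj using \<delta> x xbd b norm_tcoeff_2 by (intro mult_mono) auto
  have "norm (?y - of_real (\<delta> / 2 * (1 - (norm mult0)\<^sup>2)) * cnj (b n)) \<le> \<delta> / 2 * xbd"
    unfolding h2 using h3 by (simp only: mult_1)
  with h1 show ?thesis by blast
qed

text \<open>Inserting the product leaves the square mean of a function of f^N unchanged in the
  limit. This controls the block of the series beyond the last factor.\<close>

lemma ceq_rprod_tail:
  assumes "j \<le> N" "bh G"
  shows "blim (\<lambda>z. (rprod j N z - 1) * (G ((f ^^ N) z) * cnj (G ((f ^^ N) z)))) 0"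
  by (rule ceqD(3)[OF ceq_rprod[OF assms(1)] assms(2,2)])

end

section \<open>Mixing\<close>

text \<open>Cauchy's estimate on the circle of radius 1/2, the region where the iterates become
  small.\<close>

lemma tcoeff_le_half:
  assumes "bh G" "\<And>z. norm z = 1/2 \<Longrightarrow> norm (G z) \<le> C"
  shows "norm (tcoeff G j) \<le> 2 ^ j * C"
proof -
  have "circ_mean (1/2) (\<lambda>z. cnj z ^ j * G z) = of_real (1/2) ^ (2 * j) * tcoeff G j"
    by (rule circ_mean_cnj_power[OF assms(1)]) auto
  moreover have "norm (circ_mean (1/2) (\<lambda>z. cnj z ^ j * G z)) \<le> (1/2) ^ j * C"
  proof (rule circ_mean_le_bound)
    show "continuous_on (ball 0 1) (\<lambda>z. cnj z ^ j * G z)" by (intro cb_cont cb_intros bh_imp_cb[OF assms(1)])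
    fix z :: complex assume "norm z = \<bar>1/2\<bar>"
    hence z: "norm z = 1/2" by simp
    have "norm (cnj z ^ j * G z) = (1/2) ^ j * norm (G z)"
      by (simp only: norm_mult norm_power complex_mod_cnj z)
    thus "norm (cnj z ^ j * G z) \<le> (1/2) ^ j * C" using assms(2)[OF z] by (simp add: divide_right_mono)
  qed auto
  ultimately have "norm (of_real (1/2) ^ (2 * j) * tcoeff G j) \<le> (1/2) ^ j * C" by simp
  hence "(1/2) ^ (2 * j) * norm (tcoeff G j) \<le> (1/2) ^ j * C"
    by (simp only: norm_mult norm_power norm_of_real abs_of_pos zero_less_divide_1_iff zero_less_numeral)
  hence "2 ^ (2 * j) * ((1/2) ^ (2 * j) * norm (tcoeff G j)) \<le> 2 ^ (2 * j) * ((1/2) ^ j * C)"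
    by (intro mult_left_mono) auto
  moreover have "(2::real) ^ (2 * j) * (1/2) ^ j = 2 ^ j" "(2::real) ^ (2 * j) * (1/2) ^ (2 * j) = 1"
    by (simp_all add: power_mult power2_eq_square power_mult_distrib field_simps)
  ultimately show ?thesis by (simp only: mult.assoc[symmetric] mult_1)
qed

text \<open>By compactness |f(z)/z| has a maximum below 1 on |z| <= 1/2; f maps this disc into
  itself, so the contraction can be repeated.\<close>

lemma iterate_contract:
  assumes f: "inner_like f" and s: "\<And>z. norm z < 1 \<Longrightarrow> norm (shift f z) < 1"
  obtains \<kappa> where "0 \<le> \<kappa>" "\<kappa> < 1" "\<And>k z. norm z \<le> 1/2 \<Longrightarrow> norm ((f ^^ k) z) \<le> \<kappa> ^ k"
proof -
  have "continuous_on (cball 0 (1/2)) (\<lambda>z. norm (shift f z))"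
    using shift_holomorphic[OF inner_likeD(1)[OF f]]
    by (intro continuous_on_norm holomorphic_on_imp_continuous_on) (auto elim: holomorphic_on_subset)
  from continuous_attains_sup[OF _ _ this] obtain w where
    w: "norm w \<le> 1/2" "\<And>z. norm z \<le> 1/2 \<Longrightarrow> norm (shift f z) \<le> norm (shift f w)" by auto
  define \<kappa> where "\<kappa> = norm (shift f w)"
  have k: "0 \<le> \<kappa>" "\<kappa> < 1" using s[of w] w by (auto simp: \<kappa>_def)
  have "norm ((f ^^ k) z) \<le> \<kappa> ^ k \<and> norm ((f ^^ k) z) \<le> 1/2" if z: "norm z \<le> 1/2" for k z
  proof (induction k)
    case 0 thus ?case using z by simp
  next
    case (Suc k)
    let ?w = "(f ^^ k) z"
    have "f ?w = ?w * shift f ?w" using shift_eq[of f ?w] inner_likeD(3)[OF f] by simp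
    hence "norm (f ?w) = norm (shift f ?w) * norm ?w" by (simp add: norm_mult mult.commute)
    moreover have "norm (shift f ?w) \<le> \<kappa>" using Suc w(2) by (auto simp: \<kappa>_def)
    ultimately have 1: "norm (f ?w) \<le> \<kappa> * norm ?w" by (simp add: mult_right_mono)
    have "\<kappa> * norm ?w \<le> \<kappa> * \<kappa> ^ k" using Suc k by (intro mult_left_mono) auto
    moreover have "\<kappa> * norm ?w \<le> 1 * (1/2)" using Suc k by (intro mult_mono) auto
    ultimately show ?case using 1 by auto
  qed
  thus ?thesis using that k by blast
qed

text \<open>Given a late iterate, p has conditional expectation uniformly close to a constant.
  Uniform closeness matters because the error is later integrated against Riesz products, of which
  only the mean is controlled.\<close>

definition mixing :: "(complex \<Rightarrow> complex) \<Rightarrow> (complex \<Rightarrow> complex) \<Rightarrow> bool" where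
  "mixing f p \<longleftrightarrow> (\<exists>c. \<forall>e>0. \<exists>K. \<forall>k\<ge>K. \<exists>V. ceq (f ^^ k) p (\<lambda>z. c + V z) \<and> (\<forall>z. norm z < 1 \<longrightarrow> norm (V z) \<le> e))"

lemma mixing_add:
  assumes f: "inner_like f" and "mixing f p" "mixing f q"
  shows "mixing f (\<lambda>z. p z + q z)"
proof -
  from assms obtain c d where
    c: "\<And>e. e > 0 \<Longrightarrow> \<exists>K. \<forall>k\<ge>K. \<exists>V. ceq (f ^^ k) p (\<lambda>z. c + V z) \<and> (\<forall>z. norm z < 1 \<longrightarrow> norm (V z) \<le> e)" and
    d: "\<And>e. e > 0 \<Longrightarrow> \<exists>K. \<forall>k\<ge>K. \<exists>V. ceq (f ^^ k) q (\<lambda>z. d + V z) \<and> (\<forall>z. norm z < 1 \<longrightarrow> norm (V z) \<le> e)"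
    unfolding mixing_def by blast
  show ?thesis unfolding mixing_def
  proof (intro exI[of _ "c + d"] allI impI)
    fix e :: real assume "e > 0"
    obtain K where K: "\<And>k. k \<ge> K \<Longrightarrow> \<exists>V. ceq (f ^^ k) p (\<lambda>z. c + V z) \<and> (\<forall>z. norm z < 1 \<longrightarrow> norm (V z) \<le> e / 2)"
      using c[of "e / 2"] \<open>e > 0\<close> by auto
    obtain L where L: "\<And>k. k \<ge> L \<Longrightarrow> \<exists>V. ceq (f ^^ k) q (\<lambda>z. d + V z) \<and> (\<forall>z. norm z < 1 \<longrightarrow> norm (V z) \<le> e / 2)"
      using d[of "e / 2"] \<open>e > 0\<close> by auto
    show "\<exists>K. \<forall>k\<ge>K. \<exists>V. ceq (f ^^ k) (\<lambda>z. p z + q z) (\<lambda>z. c + d + V z) \<and> (\<forall>z. norm z < 1 \<longrightarrow> norm (V z) \<le> e)"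
    proof (intro exI[of _ "max K L"] allI impI)
      fix k assume k: "max K L \<le> k"
      obtain V where V: "ceq (f ^^ k) p (\<lambda>z. c + V z)" "\<And>z. norm z < 1 \<Longrightarrow> norm (V z) \<le> e / 2" using K[of k] k by auto
      obtain U where U: "ceq (f ^^ k) q (\<lambda>z. d + U z)" "\<And>z. norm z < 1 \<Longrightarrow> norm (U z) \<le> e / 2" using L[of k] k by auto
      have "ceq (f ^^ k) (\<lambda>z. p z + q z) (\<lambda>z. (c + V z) + (d + U z))"
        by (rule ceq_add[OF inner_like_iterate[OF f] V(1) U(1)])
      moreover have "norm (V z + U z) \<le> e" if "norm z < 1" for z
        using V(2)[OF that] U(2)[OF that] norm_triangle_ineq[of "V z" "U z"] by simp
      ultimately show "\<exists>V. ceq (f ^^ k) (\<lambda>z. p z + q z) (\<lambda>z. c + d + V z) \<and> (\<forall>z. norm z < 1 \<longrightarrow> norm (V z) \<le> e)"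
        by (intro exI[of _ "\<lambda>z. V z + U z"]) (simp add: algebra_simps)
    qed
  qed
qed

lemma mixing_cmult:
  assumes f: "inner_like f" and "mixing f p"
  shows "mixing f (\<lambda>z. a * p z)"
proof -
  from assms obtain c where
    c: "\<And>e. e > 0 \<Longrightarrow> \<exists>K. \<forall>k\<ge>K. \<exists>V. ceq (f ^^ k) p (\<lambda>z. c + V z) \<and> (\<forall>z. norm z < 1 \<longrightarrow> norm (V z) \<le> e)"
    unfolding mixing_def by blast
  show ?thesis unfolding mixing_def
  proof (intro exI[of _ "a * c"] allI impI)
    fix e :: real assume "e > 0"
    hence "e / (norm a + 1) > 0" by (simp add: add_nonneg_pos)
    from c[OF this] obtain K where
      K: "\<And>k. k \<ge> K \<Longrightarrow> \<exists>V. ceq (f ^^ k) p (\<lambda>z. c + V z) \<and> (\<forall>z. norm z < 1 \<longrightarrow> norm (V z) \<le> e / (norm a + 1))"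
      by auto
    show "\<exists>K. \<forall>k\<ge>K. \<exists>V. ceq (f ^^ k) (\<lambda>z. a * p z) (\<lambda>z. a * c + V z) \<and> (\<forall>z. norm z < 1 \<longrightarrow> norm (V z) \<le> e)"
    proof (intro exI[of _ K] allI impI)
      fix k assume k: "K \<le> k"
      obtain V where V: "ceq (f ^^ k) p (\<lambda>z. c + V z)" "\<And>z. norm z < 1 \<Longrightarrow> norm (V z) \<le> e / (norm a + 1)" using K[OF k] by auto
      have "ceq (f ^^ k) (\<lambda>z. a * p z) (\<lambda>z. a * (c + V z))"
        by (rule ceq_cmult[OF inner_like_iterate[OF f] V(1)])
      moreover have "norm (a * V z) \<le> e" if "norm z < 1" for z
      proof -
        have "norm (a * V z) \<le> (norm a + 1) * (e / (norm a + 1))"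
          unfolding norm_mult by (intro mult_mono V(2) that) (use \<open>e > 0\<close> in auto)
        also have "norm a + 1 \<noteq> 0" using norm_ge_zero[of a] by linarith
        hence "(norm a + 1) * (e / (norm a + 1)) = e" by simp
        finally show ?thesis .
      qed
      ultimately show "\<exists>V. ceq (f ^^ k) (\<lambda>z. a * p z) (\<lambda>z. a * c + V z) \<and> (\<forall>z. norm z < 1 \<longrightarrow> norm (V z) \<le> e)"
        by (intro exI[of _ "\<lambda>z. a * V z"]) (simp add: algebra_simps)
    qed
  qed
qed

lemma mixing_cnj:
  assumes f: "inner_like f" and "mixing f p"
  shows "mixing f (\<lambda>z. cnj (p z))"
proof -
  from assms obtain c where
    c: "\<And>e. e > 0 \<Longrightarrow> \<exists>K. \<forall>k\<ge>K. \<exists>V. ceq (f ^^ k) p (\<lambda>z. c + V z) \<and> (\<forall>z. norm z < 1 \<longrightarrow> norm (V z) \<le> e)"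
    unfolding mixing_def by blast
  show ?thesis unfolding mixing_def
  proof (intro exI[of _ "cnj c"] allI impI)
    fix e :: real assume "e > 0"
    from c[OF this] obtain K where
      K: "\<And>k. k \<ge> K \<Longrightarrow> \<exists>V. ceq (f ^^ k) p (\<lambda>z. c + V z) \<and> (\<forall>z. norm z < 1 \<longrightarrow> norm (V z) \<le> e)"
      by auto
    show "\<exists>K. \<forall>k\<ge>K. \<exists>V. ceq (f ^^ k) (\<lambda>z. cnj (p z)) (\<lambda>z. cnj c + V z) \<and> (\<forall>z. norm z < 1 \<longrightarrow> norm (V z) \<le> e)"
    proof (intro exI[of _ K] allI impI)
      fix k assume k: "K \<le> k"
      obtain V where V: "ceq (f ^^ k) p (\<lambda>z. c + V z)" "\<And>z. norm z < 1 \<Longrightarrow> norm (V z) \<le> e" using K[OF k] by auto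
      have "ceq (f ^^ k) (\<lambda>z. cnj (p z)) (\<lambda>z. cnj (c + V z))"
        by (rule ceq_cnj[OF inner_like_iterate[OF f] V(1)])
      thus "\<exists>V. ceq (f ^^ k) (\<lambda>z. cnj (p z)) (\<lambda>z. cnj c + V z) \<and> (\<forall>z. norm z < 1 \<longrightarrow> norm (V z) \<le> e)"
        using V(2) by (intro exI[of _ "\<lambda>z. cnj (V z)"]) simp
    qed
  qed
qed

lemma mixing_bnull:
  assumes f: "inner_like f" and "mixing f p" "cb p" "cb q" "bnull (\<lambda>z. q z - p z)"
  shows "mixing f q"
proof -
  have *: "ceq (f ^^ k) q X" if "ceq (f ^^ k) p X" for k X
    by (rule ceq_trans[OF inner_like_iterate[OF f] ceq_bnull[OF inner_like_iterate[OF f]] that]) (use assms in auto)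
  show ?thesis using assms(2) unfolding mixing_def by (meson *)
qed

text \<open>The powers of g and their conjugates form an orthonormal system on the boundary. A
  positive power of z is orthogonal to the conjugate powers and to the constants, and it meets g^i
  only for i up to its own degree.\<close>

lemma ceq_power_iterate:
  assumes g: "inner_like g"
  shows "ceq g (\<lambda>z. z ^ Suc j) (\<lambda>z. \<Sum>i=1..Suc j. cnj (tcoeff (\<lambda>z. g z ^ i) (Suc j)) * g z ^ i)"
    (is "ceq g ?X (\<lambda>z. sum (?Y z) _)")
proof (rule ceqI[OF g])
  have bg: "bh g" and cg: "cb g" using g by (auto intro: inner_like_bh bh_imp_cb)
  fix m
  have hol: "(\<lambda>z. (?X z - (\<Sum>i=1..Suc j. ?Y z i)) * g z ^ m) holomorphic_on ball 0 1"
    using inner_likeD(1)[OF g] by (intro holomorphic_intros)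
  have "(\<Sum>i=1..Suc j. ?Y 0 i) = 0"
    using inner_likeD(3)[OF g] by (intro sum.neutral) auto
  hence "(?X 0 - (\<Sum>i=1..Suc j. ?Y 0 i)) * g 0 ^ m = 0" by (simp only: power_Suc mult_zero_left diff_self)
  with blim_holomorphic[OF hol] show "blim (\<lambda>z. (?X z - (\<Sum>i=1..Suc j. ?Y z i)) * g z ^ m) 0" by (simp only:)
  let ?c = "\<lambda>i. cnj (tcoeff (\<lambda>z. g z ^ i) (Suc j))"
  have 1: "blim (\<lambda>z. cnj z ^ Suc j * g z ^ m) (tcoeff (\<lambda>z. g z ^ m) (Suc j))"
    by (rule blim_inner_cnj_power[OF inner_like_ident bh_power[OF bg]])
  have 2: "blim (\<lambda>z. cnj (g z) ^ i * g z ^ m) (if i = m then 1 else 0)" for i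
    using blim_inner_cnj_power[OF g bh_power[OF bh_ident], of i m] by (simp add: tcoeff_power)
  have "blim (\<lambda>z. cnj (cnj z ^ Suc j * g z ^ m - (\<Sum>i=1..Suc j. cnj (?c i) * (cnj (g z) ^ i * g z ^ m))))
    (cnj (tcoeff (\<lambda>z. g z ^ m) (Suc j) - (\<Sum>i=1..Suc j. cnj (?c i) * (if i = m then 1 else 0))))"
    by (intro blim_cnj blim_diff blim_sum blim_cmult 1 2 cb_intros cg finite_atLeastAtMost)
  also have "(\<Sum>i=1..Suc j. cnj (?c i) * (if i = m then 1 else 0)) = (\<Sum>i=1..Suc j. if i = m then cnj (?c i) else 0)"
    by (intro sum.cong) auto
  also have "\<dots> = (if m \<in> {1..Suc j} then cnj (?c m) else 0)" by (rule sum.delta) simp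
  also have "tcoeff (\<lambda>z. g z ^ m) (Suc j) - \<dots> = 0"
  proof (cases "m \<in> {1..Suc j}")
    case False
    hence "m = 0 \<or> Suc j < m" by auto
    thus ?thesis
    proof
      assume "m = 0" thus ?thesis by (simp add: tcoeff_const)
    next
      assume "Suc j < m" thus ?thesis by (simp add: tcoeff_inner_power[OF g])
    qed
  qed simp
  finally show "blim (\<lambda>z. (?X z - (\<Sum>i=1..Suc j. ?Y z i)) * cnj (g z) ^ m) 0"
    by (simp add: algebra_simps sum_distrib_left sum_distrib_right del: sum.cl_ivl_Suc)
qed (intro cb_intros bh_imp_cb[OF inner_like_bh[OF g]])+

text \<open>The number of terms in the conditional expectation stays fixed as k grows, while
  Cauchy's estimate on |z| = 1/2 bounds each coefficient by 2^j kappa^k.\<close>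

lemma mixing_power:
  assumes f: "inner_like f" and s: "\<And>z. norm z < 1 \<Longrightarrow> norm (shift f z) < 1"
  shows "mixing f (\<lambda>z. z ^ j)"
proof (cases j)
  case 0
  have "ceq (f ^^ k) (\<lambda>z. 1) (\<lambda>z. 1 + 0)" for k using ceq_refl[of "\<lambda>z. 1"] by simp
  thus ?thesis using 0 unfolding mixing_def by (intro exI[of _ 1]) (force intro!: exI[of _ "\<lambda>_. 0"])
next
  case (Suc i)
  obtain \<kappa> where k: "0 \<le> \<kappa>" "\<kappa> < 1" "\<And>k z. norm z \<le> 1/2 \<Longrightarrow> norm ((f ^^ k) z) \<le> \<kappa> ^ k"
    using iterate_contract[OF f s] by blast
  show ?thesis unfolding mixing_def
  proof (intro exI[of _ "0::complex"] allI impI)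
    fix e :: real assume e: "e > 0"
    have "(\<lambda>k. real j * (2 ^ j * \<kappa> ^ k)) \<longlonglongrightarrow> real j * (2 ^ j * 0)"
      using k by (intro tendsto_intros LIMSEQ_power_zero) auto
    hence "eventually (\<lambda>k. real j * (2 ^ j * \<kappa> ^ k) < e) sequentially" using e by (intro order_tendstoD) auto
    then obtain K where K: "\<And>k. k \<ge> K \<Longrightarrow> real j * (2 ^ j * \<kappa> ^ k) < e" by (auto simp: eventually_sequentially)
    show "\<exists>K. \<forall>k\<ge>K. \<exists>V. ceq (f ^^ k) (\<lambda>z. z ^ j) (\<lambda>z. 0 + V z) \<and> (\<forall>z. norm z < 1 \<longrightarrow> norm (V z) \<le> e)"
    proof (intro exI[of _ K] allI impI)
      fix k' assume k': "K \<le> k'"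
      let ?g = "f ^^ k'"
      have g: "inner_like ?g" by (rule inner_like_iterate[OF f])
      let ?V = "\<lambda>z. \<Sum>i=1..j. cnj (tcoeff (\<lambda>z. ?g z ^ i) j) * ?g z ^ i"
      have "norm (?V z) \<le> e" if z: "norm z < 1" for z
      proof -
        have "norm (?V z) \<le> (\<Sum>i=1..j. 2 ^ j * \<kappa> ^ k')"
        proof (rule sum_norm_le)
          fix i assume i: "i \<in> {1..j}"
          have "norm (tcoeff (\<lambda>z. ?g z ^ i) j) \<le> 2 ^ j * \<kappa> ^ k'"
          proof (rule tcoeff_le_half)
            show "bh (\<lambda>z. ?g z ^ i)" by (intro bh_power inner_like_bh g)
            fix w :: complex assume "norm w = 1/2"
            hence w: "norm (?g w) \<le> \<kappa> ^ k'" by (intro k) simp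
            have "norm (?g w ^ i) \<le> norm (?g w) ^ 1"
              unfolding norm_power using i inner_like_norm_lt[OF g, of w] \<open>norm w = 1/2\<close>
              by (intro power_decreasing) auto
            thus "norm (?g w ^ i) \<le> \<kappa> ^ k'" using w by simp
          qed
          moreover have "norm (?g z) ^ i \<le> 1" using inner_like_norm_lt[OF g z] by (intro power_le_one) auto
          ultimately have "norm (tcoeff (\<lambda>z. ?g z ^ i) j) * norm (?g z) ^ i \<le> (2 ^ j * \<kappa> ^ k') * 1"
            using k by (intro mult_mono) auto
          thus "norm (cnj (tcoeff (\<lambda>z. ?g z ^ i) j) * ?g z ^ i) \<le> 2 ^ j * \<kappa> ^ k'"
            by (simp add: norm_mult norm_power)
        qed
        thus ?thesis using K[OF k'] by simp
      qed
      moreover have "ceq ?g (\<lambda>z. z ^ j) ?V" using ceq_power_iterate[OF g, of i] Suc by simp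
      ultimately show "\<exists>V. ceq ?g (\<lambda>z. z ^ j) (\<lambda>z. 0 + V z) \<and> (\<forall>z. norm z < 1 \<longrightarrow> norm (V z) \<le> e)"
        by (intro exI[of _ ?V]) simp
    qed
  qed
qed

text \<open>On the circle a monomial in z and its conjugate reduces to a pure power of one of
  them.\<close>

lemma mixing_monomial:
  assumes f: "inner_like f" and s: "\<And>z. norm z < 1 \<Longrightarrow> norm (shift f z) < 1"
  shows "mixing f (\<lambda>z. z ^ i * cnj z ^ j)"
proof (induction i arbitrary: j)
  case 0
  show ?case using mixing_cnj[OF f mixing_power[OF f s, of j]] by simp
next
  case (Suc i)
  show ?case
  proof (cases j)
    case 0
    thus ?thesis using mixing_power[OF f s, of "Suc i"] by simp
  next
    case j: (Suc k)
    show ?thesis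
    proof (rule mixing_bnull[OF f Suc.IH[of k]])
      have "bnull (\<lambda>z. (z * cnj z - 1) * (z ^ i * cnj z ^ k))"
        by (rule inner_like_bnull[OF inner_like_ident]) (intro cb_intros)
      thus "bnull (\<lambda>z. z ^ Suc i * cnj z ^ j - z ^ i * cnj z ^ k)" by (simp add: j algebra_simps)
    qed (intro cb_intros)+
  qed
qed

text \<open>Polynomials in z and its conjugate: the form in which the approximants of the
  Stone-Weierstrass theorem reduce to monomials that mix.\<close>

inductive cpoly :: "(complex \<Rightarrow> complex) \<Rightarrow> bool" where
  monomial: "cpoly (\<lambda>z. c * (z ^ i * cnj z ^ j))"
| add: "cpoly p \<Longrightarrow> cpoly q \<Longrightarrow> cpoly (\<lambda>z. p z + q z)"

lemma cpoly_mult_monomial: "cpoly p \<Longrightarrow> cpoly (\<lambda>z. c * (z ^ i * cnj z ^ j) * p z)"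
proof (induction rule: cpoly.induct)
  case (monomial c' i' j')
  from cpoly.monomial[of "c * c'" "i + i'" "j + j'"] show ?case by (simp add: power_add mult_ac)
next
  case (add p q)
  from cpoly.add[OF add.IH] show ?case by (simp add: algebra_simps)
qed

lemma cpoly_mult: "cpoly p \<Longrightarrow> cpoly q \<Longrightarrow> cpoly (\<lambda>z. p z * q z)"
proof (induction rule: cpoly.induct)
  case (monomial c i j) thus ?case by (rule cpoly_mult_monomial)
next
  case (add p p')
  from cpoly.add[OF add.IH(1)[OF add.prems] add.IH(2)[OF add.prems]] show ?case by (simp add: algebra_simps)
qed

lemma cpoly_linear: "bounded_linear L \<Longrightarrow> cpoly (\<lambda>z. complex_of_real (L z))"
proof -
  assume "bounded_linear L"
  then interpret bounded_linear L .
  \<comment> \<open>L z = Re z * L 1 + Im z * L i, with Re and Im rewritten through z and its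
    conjugate.\<close>
  define R where "R = (\<lambda>z. (of_real (L 1) / 2 - \<i> * of_real (L \<i>) / 2) * (z ^ 1 * cnj z ^ 0) +
      (of_real (L 1) / 2 + \<i> * of_real (L \<i>) / 2) * (z ^ 0 * cnj z ^ 1))"
  have "complex_of_real (L z) = (of_real (L 1) / 2 - \<i> * of_real (L \<i>) / 2) * (z ^ 1 * cnj z ^ 0) +
      (of_real (L 1) / 2 + \<i> * of_real (L \<i>) / 2) * (z ^ 0 * cnj z ^ 1)" for z
  proof -
    have "z = Re z *\<^sub>R 1 + Im z *\<^sub>R \<i>" by (simp add: complex_eq_iff)
    hence "L z = Re z * L 1 + Im z * L \<i>" by (metis add real_scaleR_def scale)
    thus ?thesis by (simp add: complex_eq_iff algebra_simps)
  qed
  hence "(\<lambda>z. complex_of_real (L z)) = R" unfolding R_def by (intro ext)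
  moreover have "cpoly R" unfolding R_def by (intro cpoly.add cpoly.monomial)
  ultimately show ?thesis by (simp only:)
qed

lemma cpoly_real_polynomial: "real_polynomial_function p \<Longrightarrow> cpoly (\<lambda>z. complex_of_real (p z))"
proof (induction rule: real_polynomial_function.induct)
  case (linear p) thus ?case by (rule cpoly_linear)
next
  case (const c) show ?case using cpoly.monomial[of "of_real c" 0 0] by simp
next
  case (add p q) from cpoly.add[OF add.IH] show ?case by simp
next
  case (mult p q) from cpoly_mult[OF mult.IH] show ?case by simp
qed

lemma mixing_cpoly:
  assumes f: "inner_like f" and s: "\<And>z. norm z < 1 \<Longrightarrow> norm (shift f z) < 1" and "cpoly p"
  shows "mixing f p"
  using assms(3)
  by induction (auto intro!: mixing_add mixing_cmult mixing_monomial f s)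

section \<open>Summation by parts: recovering the coefficients from the differences\<close>

primrec ar_sum :: "complex \<Rightarrow> (nat \<Rightarrow> complex) \<Rightarrow> nat \<Rightarrow> complex" where
  "ar_sum q a 0 = a 0"
| "ar_sum q a (Suc n) = a (Suc n) + q * ar_sum q a n"

lemma norm_ar_sum_le:
  assumes "norm q < 1" "\<And>n. norm (a n) \<le> A"
  shows "norm (ar_sum q a n) \<le> A / (1 - norm q)"
proof (induction n)
  case 0
  have "A \<ge> 0" using assms(2)[of 0] norm_ge_zero order_trans by blast
  hence "A * (1 - norm q) \<le> A" using assms by (simp add: mult_left_le)
  hence "A \<le> A / (1 - norm q)" using assms by (simp add: field_simps)
  thus ?case using assms(2)[of 0] by simp
next
  case (Suc n)
  have "norm (ar_sum q a (Suc n)) \<le> A + norm q * (A / (1 - norm q))"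
    unfolding ar_sum.simps
    by (rule norm_triangle_le[OF add_mono]) (auto simp only: norm_mult intro!: mult_left_mono Suc assms(2) norm_ge_zero)
  also have "\<dots> = A / (1 - norm q)" using assms by (simp add: field_simps)
  finally show ?case .
qed

lemma ar_sum_eq_0: "(\<And>n. n < k \<Longrightarrow> a n = 0) \<Longrightarrow> n < k \<Longrightarrow> ar_sum q a n = 0"
  by (induction n) auto

text \<open>The recursion inverts to a_(n+1) = c_(n+1) - q c_n.\<close>

lemma summable_of_ar_sum:
  assumes "summable (\<lambda>n. norm (ar_sum q a n))"
  shows "summable (\<lambda>n. norm (a n))"
proof -
  have "summable (\<lambda>n. norm (a (Suc n)))"
  proof (rule summable_comparison_test')
    show "summable (\<lambda>n. norm (ar_sum q a (Suc n)) + norm q * norm (ar_sum q a n))"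
      using assms by (intro summable_add summable_mult iffD2[OF summable_Suc_iff])
    fix n :: nat
    have "a (Suc n) = ar_sum q a (Suc n) - q * ar_sum q a n" by simp
    thus "norm (norm (a (Suc n))) \<le> norm (ar_sum q a (Suc n)) + norm q * norm (ar_sum q a n)"
      unfolding real_norm_def abs_norm_cancel norm_mult[symmetric] by (metis norm_triangle_ineq4)
  qed
  thus ?thesis by (simp add: summable_Suc_iff[of "\<lambda>n. norm (a n)"])
qed

text \<open>The boundary term at N+1 need not tend to 0; it stays bounded by
  \<open>norm_ar_sum_le\<close>, which is enough.\<close>

lemma (in riesz_product) sum_iterates_incr:
  "(\<Sum>n<Suc N. a n * (f ^^ n) z) =
     (\<Sum>n<Suc N. ar_sum (cnj mult0) a n * incr n z) + cnj mult0 * ar_sum (cnj mult0) a N * (f ^^ Suc N) z"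
proof (induction N)
  case (Suc N)
  let ?c = "ar_sum (cnj mult0) a"
  have "(\<Sum>n<Suc (Suc N). a n * (f ^^ n) z) = (\<Sum>n<Suc N. a n * (f ^^ n) z) + a (Suc N) * (f ^^ Suc N) z" by simp
  also have "\<dots> = (\<Sum>n<Suc N. ?c n * incr n z) + ?c (Suc N) * (f ^^ Suc N) z"
    unfolding Suc by (simp add: algebra_simps)
  also have "?c (Suc N) * (f ^^ Suc N) z = ?c (Suc N) * incr (Suc N) z + cnj mult0 * ?c (Suc N) * (f ^^ Suc (Suc N)) z"
    unfolding incr_def by (simp add: algebra_simps del: ar_sum.simps funpow.simps)
  finally show ?case by (simp add: add.assoc del: ar_sum.simps funpow.simps)
qed (simp add: incr_def algebra_simps)

section \<open>The weight over the arc and its correlation with the differences\<close>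

lemma cpoly_cb: "cpoly p \<Longrightarrow> cb p"
  by (induction rule: cpoly.induct) (auto intro!: cb_intros)

text \<open>A polynomial p replaces the weight up to e, and its conditional expectation given a late
  iterate is c up to e. Comparing means, c differs from the mean w of the weight by at most
  2e.\<close>

lemma weight_mixing:
  assumes f: "inner_like f" and s: "\<And>z. norm z < 1 \<Longrightarrow> norm (shift f z) < 1"
    and W: "continuous_on (cball 0 1) W" "blim W w" and e: "e > 0"
  obtains p c V k where "cb p" "\<And>z. norm z < 1 \<Longrightarrow> norm (of_real (W z) - p z) \<le> e"
    "ceq (f ^^ k) p (\<lambda>z. c + V z)" "cb V" "\<And>z. norm z < 1 \<Longrightarrow> norm (V z) \<le> e" "norm (c - of_real w) \<le> 2 * e"
proof -
  obtain q where q: "real_polynomial_function q" "\<And>x. x \<in> cball 0 1 \<Longrightarrow> \<bar>W x - q x\<bar> < e"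
    using Stone_Weierstrass_real_polynomial_function[OF compact_cball W(1) e] by blast
  define p where "p z = complex_of_real (q z)" for z
  have cp: "cpoly p" unfolding p_def using cpoly_real_polynomial[OF q(1)] .
  have p: "cb p" by (rule cpoly_cb[OF cp])
  have Wp: "norm (of_real (W z) - p z) \<le> e" if "norm z < 1" for z
  proof -
    have "norm (of_real (W z) - p z) = \<bar>W z - q z\<bar>"
      unfolding p_def by (metis norm_of_real of_real_diff real_norm_def)
    thus ?thesis using q(2)[of z] that by simp
  qed
  have "mixing f p" by (rule mixing_cpoly[OF f s cp])
  then obtain c where "\<And>e. e > 0 \<Longrightarrow> \<exists>K. \<forall>k\<ge>K. \<exists>V. ceq (f ^^ k) p (\<lambda>z. c + V z) \<and> (\<forall>z. norm z < 1 \<longrightarrow> norm (V z) \<le> e)"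
    unfolding mixing_def by blast
  from this[OF e] obtain k V where V: "ceq (f ^^ k) p (\<lambda>z. c + V z)" "\<And>z. norm z < 1 \<Longrightarrow> norm (V z) \<le> e"
    by blast
  have cV: "cb V" using cb_diff[OF ceqD(2)[OF V(1)] cb_const[of c]] by simp
  have cW: "cb (\<lambda>z. complex_of_real (W z))"
    by (rule cb_of_real[OF continuous_on_cball_imp_cb[OF W(1)]])
  have WR: "blim (\<lambda>z. complex_of_real (W z)) (of_real w)"
  proof (rule Lim_transform_eventually)
    show "((\<lambda>r. complex_of_real (circ_mean r W)) \<longlongrightarrow> of_real w) (at_left 1)" by (intro tendsto_of_real W)
    show "\<forall>\<^sub>F r in at_left 1. complex_of_real (circ_mean r W) = circ_mean r (\<lambda>z. complex_of_real (W z))"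
      using eventually_at_left_1
      by eventually_elim (subst circ_mean_of_real, auto intro: continuous_on_subset[OF W(1)])
  qed
  have d: "blim (\<lambda>z. p z - (c + V z)) 0"
    using ceqD(3)[OF V(1) bh_const[of 1] bh_const[of 1]] by simp
  have a1: "((\<lambda>r. norm (c - circ_mean r (\<lambda>z. of_real (W z)))) \<longlongrightarrow> norm (c - of_real w)) (at_left 1)"
    by (intro tendsto_intros WR)
  have a2: "((\<lambda>r. 2 * e + norm (circ_mean r (\<lambda>z. p z - (c + V z)))) \<longlongrightarrow> 2 * e + norm (0::complex)) (at_left 1)"
    by (intro tendsto_intros d)
  have a3: "\<forall>\<^sub>F r in at_left 1. norm (c - circ_mean r (\<lambda>z. of_real (W z))) \<le> 2 * e + norm (circ_mean r (\<lambda>z. p z - (c + V z)))"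
    using eventually_at_left_1
  proof eventually_elim
    case (elim r)
    hence r: "\<bar>r\<bar> < 1" by simp
    have 1: "norm (circ_mean r (\<lambda>z. of_real (W z) - p z)) \<le> e"
      by (rule circ_mean_le_bound[OF r]) (use Wp r in \<open>auto intro!: cb_cont cW p\<close>)
    have 2: "norm (circ_mean r V) \<le> e"
      by (rule circ_mean_le_bound[OF r]) (use V r in \<open>auto intro!: cb_cont cV\<close>)
    have "circ_mean r (\<lambda>z. p z - (c + V z)) = circ_mean r p - (c + circ_mean r V)"
      using circ_mean_diff[OF r cb_cont[OF p] cb_cont[OF cb_add[OF cb_const cV]]]
        circ_mean_add[OF r cb_cont[OF cb_const] cb_cont[OF cV]] by (simp add: circ_mean_const[OF r])
    moreover have "circ_mean r (\<lambda>z. of_real (W z) - p z) = circ_mean r (\<lambda>z. of_real (W z)) - circ_mean r p"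
      by (rule circ_mean_diff[OF r cb_cont[OF cW] cb_cont[OF p]])
    ultimately have "c - circ_mean r (\<lambda>z. of_real (W z)) =
       - circ_mean r (\<lambda>z. of_real (W z) - p z) - circ_mean r V - circ_mean r (\<lambda>z. p z - (c + V z))"
      by (simp add: algebra_simps)
    also have "norm \<dots> \<le> norm (circ_mean r (\<lambda>z. complex_of_real (W z) - p z)) + norm (circ_mean r V) + norm (circ_mean r (\<lambda>z. p z - (c + V z)))"
      by (intro order_trans[OF norm_triangle_ineq4] add_mono) (auto intro: order_trans[OF norm_triangle_ineq4])
    finally show ?case using 1 2 by linarith
  qed
  have "norm (c - of_real w) \<le> 2 * e + norm (0::complex)"
    by (rule tendsto_le[OF trivial_limit_at_left_real a2 a1 a3])
  thus ?thesis using that[OF p Wp V(1) cV V(2)] by simp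
qed

lemma norm_triangle5:
  fixes a b c d e :: "'a::real_normed_vector"
  shows "norm (a + b + c + d + e) \<le> norm a + norm b + norm c + norm d + norm e"
  using norm_triangle_ineq[of "a + b + c + d" e] norm_triangle_ineq[of "a + b + c" d]
    norm_triangle_ineq[of "a + b" c] norm_triangle_ineq[of a b] by linarith

lemma (in riesz_product) weighted_lower_bound:
  assumes W: "cb W" "\<And>z. norm z < 1 \<Longrightarrow> norm (of_real (W z) - p z) \<le> e" and p: "cb p"
    and V: "ceq (f ^^ j) p (\<lambda>z. c + V z)" "cb V" "\<And>z. norm z < 1 \<Longrightarrow> norm (V z) \<le> e"
    and c: "norm (c - of_real w) \<le> 2 * e" and jn: "j \<le> n" "n < N" and e: "e \<ge> 0"
  obtains \<theta> E where "norm (\<theta> - of_real (\<delta> / 2 * (1 - (norm mult0)\<^sup>2)) * cnj (b n)) \<le> \<delta> / 2 * xbd"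
    "(E \<longlongrightarrow> 8 * e) (at_left 1)"
    "\<And>r. 0 < r \<Longrightarrow> r < 1 \<Longrightarrow> norm (circ_mean r (\<lambda>z. of_real (W z) * rprod j N z * incr n z) - of_real w * \<theta>) \<le> E r"
proof -
  obtain \<theta> where \<theta>: "blim (\<lambda>z. rprod j N z * incr n z) \<theta>"
    "norm (\<theta> - of_real (\<delta> / 2 * (1 - (norm mult0)\<^sup>2)) * cnj (b n)) \<le> \<delta> / 2 * xbd"
    using blim_rprod_incr[OF jn] by blast
  let ?P = "rprod j N" and ?d = "incr n"
  let ?Pd = "\<lambda>z. ?P z * ?d z"
  have cPd: "cb ?Pd" by (intro cb_intros cb_rprod cb_incr)
  have cWc: "cb (\<lambda>z. complex_of_real (W z))" using W(1) by (rule cb_of_real)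
  have jN: "j \<le> N" using jn by simp
  note nP = blim_norm_rprod[OF jN]
  have bnd: "norm (circ_mean r (\<lambda>z. X z * ?Pd z)) \<le> C * 2 * circ_mean r (\<lambda>z. norm (?P z))"
    if X: "cb X" "\<And>z. norm z < 1 \<Longrightarrow> norm (X z) \<le> C" and r: "0 < r" "r < 1" for X C r
  proof -
    have C: "C \<ge> 0" using X(2)[of 0] norm_ge_zero order_trans by (metis norm_zero zero_less_one)
    have r': "\<bar>r\<bar> < 1" using r by simp
    have "norm (circ_mean r (\<lambda>z. X z * ?Pd z)) \<le> circ_mean r (\<lambda>z. norm (X z * ?Pd z))"
      by (rule norm_circ_mean_le[OF r']) (intro cb_cont cb_intros X cb_rprod cb_incr)
    also have "\<dots> \<le> circ_mean r (\<lambda>z. (C * 2) * norm (?P z))"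
    proof (rule circ_mean_mono[OF r'])
      fix z :: complex assume "norm z = \<bar>r\<bar>"
      hence z: "norm z < 1" using r by simp
      have "norm (X z * ?Pd z) \<le> C * (norm (?P z) * 2)"
        unfolding norm_mult using X(2)[OF z] norm_incr[OF z, of n] C by (intro mult_mono) auto
      thus "norm (X z * ?Pd z) \<le> (C * 2) * norm (?P z)" by (simp add: mult_ac)
    qed (intro cb_cont cb_intros X cb_rprod cb_incr)+
    also have "\<dots> = C * 2 * circ_mean r (\<lambda>z. norm (?P z))"
      by (rule circ_mean_cmult[OF r']) (intro cb_cont cb_intros cb_rprod)
    finally show ?thesis .
  qed
  have n\<theta>: "norm \<theta> \<le> 2"
  proof (rule tendsto_le[OF trivial_limit_at_left_real])
    show "((\<lambda>r. norm (circ_mean r ?Pd)) \<longlongrightarrow> norm \<theta>) (at_left 1)" by (intro tendsto_norm \<theta>)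
    show "((\<lambda>r. 1 * 2 * circ_mean r (\<lambda>z. norm (?P z))) \<longlongrightarrow> 2) (at_left 1)"
      using tendsto_mult[OF tendsto_const nP, of "1 * 2"] by simp
    show "\<forall>\<^sub>F r in at_left 1. norm (circ_mean r ?Pd) \<le> 1 * 2 * circ_mean r (\<lambda>z. norm (?P z))"
      using eventually_at_left_1 by eventually_elim (use bnd[of "\<lambda>_. 1" 1] in simp)
  qed
  \<comment> \<open>The errors of W - p and of V each count e times the bound 2 for the difference,
    and the replacement of c by w counts 2e times the bound 2 for the correlation; together 8e in
    the limit.\<close>
  define E where "E r = e * 2 * circ_mean r (\<lambda>z. norm (?P z)) + e * 2 * circ_mean r (\<lambda>z. norm (?P z))
      + norm (circ_mean r (\<lambda>z. (p z - (c + V z)) * ?Pd z)) + norm c * norm (circ_mean r ?Pd - \<theta>) + 2 * e * 2" for r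
  have "alg (f ^^ j) ?Pd" by (intro alg.mult alg_rprod alg_incr) (use jn in auto)
  from ceq_mult_alg[OF inner_it this V(1)] have cq: "ceq (f ^^ j) (\<lambda>z. p z * ?Pd z) (\<lambda>z. (c + V z) * ?Pd z)" .
  have 1: "blim (\<lambda>z. (p z - (c + V z)) * ?Pd z) 0"
    using ceqD(3)[OF cq bh_const[of 1] bh_const[of 1]] by (simp add: algebra_simps)
  have "(E \<longlongrightarrow> e * 2 * 1 + e * 2 * 1 + norm (0::complex) + norm c * norm (\<theta> - \<theta>) + 2 * e * 2) (at_left 1)"
    unfolding E_def[abs_def] by (intro tendsto_intros nP 1 \<theta>)
  hence E: "(E \<longlongrightarrow> 8 * e) (at_left 1)" by simp
  have "norm (circ_mean r (\<lambda>z. of_real (W z) * ?P z * ?d z) - of_real w * \<theta>) \<le> E r" if r: "0 < r" "r < 1" for r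
  proof -
    have r': "\<bar>r\<bar> < 1" using r by simp
    let ?A = "\<lambda>z. (of_real (W z) - p z) * ?Pd z" and ?B = "\<lambda>z. (p z - (c + V z)) * ?Pd z" and ?C = "\<lambda>z. V z * ?Pd z"
      and ?D = "\<lambda>z. c * ?Pd z"
    have cA: "cb ?A" and cB: "cb ?B" and cC: "cb ?C" and cD: "cb ?D" by (intro cb_intros cWc p V cb_rprod cb_incr)+
    have "circ_mean r (\<lambda>z. of_real (W z) * ?P z * ?d z) = circ_mean r (\<lambda>z. ?A z + ?B z + ?C z + ?D z)"
      by (rule circ_mean_cong[OF r']) (simp add: algebra_simps)
    also have "\<dots> = circ_mean r ?A + circ_mean r ?B + circ_mean r ?C + c * circ_mean r ?Pd"
      using circ_mean_add[OF r' cb_cont cb_cont, OF cb_add[OF cb_add[OF cA cB] cC] cD]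
        circ_mean_add[OF r' cb_cont cb_cont, OF cb_add[OF cA cB] cC]
        circ_mean_add[OF r' cb_cont cb_cont, OF cA cB] circ_mean_cmult[OF r' cb_cont[OF cPd], of c] by (simp only:)
    finally have eq: "circ_mean r (\<lambda>z. of_real (W z) * ?P z * ?d z) - of_real w * \<theta> =
       circ_mean r ?A + circ_mean r ?C + circ_mean r ?B + c * (circ_mean r ?Pd - \<theta>) + (c - of_real w) * \<theta>"
      by (simp add: algebra_simps)
    have "norm (circ_mean r (\<lambda>z. of_real (W z) * ?P z * ?d z) - of_real w * \<theta>)
        \<le> norm (circ_mean r ?A) + norm (circ_mean r ?C) + norm (circ_mean r ?B)
        + norm (c * (circ_mean r ?Pd - \<theta>)) + norm ((c - of_real w) * \<theta>)"
      unfolding eq by (rule norm_triangle5)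
    also have "\<dots> \<le> E r"
    proof -
      have "norm (circ_mean r ?A) \<le> e * 2 * circ_mean r (\<lambda>z. norm (?P z))"
        by (rule bnd[OF _ W(2) r]) (intro cb_intros cWc p)
      moreover have "norm (circ_mean r ?C) \<le> e * 2 * circ_mean r (\<lambda>z. norm (?P z))"
        by (rule bnd[OF V(2,3) r])
      moreover have "norm (c * (circ_mean r ?Pd - \<theta>)) \<le> norm c * norm (circ_mean r ?Pd - \<theta>)" by (simp add: norm_mult)
      moreover have "norm ((c - of_real w) * \<theta>) \<le> 2 * e * 2" unfolding norm_mult using c n\<theta> e by (intro mult_mono) auto
      ultimately show ?thesis unfolding E_def by linarith
    qed
    finally show ?thesis .
  qed
  from that[OF \<theta>(2) E this] show ?thesis .
qed

lemma mult_cnj_sgn: "z * cnj (sgn z) = of_real (norm z)"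
proof -
  have "z * cnj z = of_real (norm z) * of_real (norm z)"
    by (metis complex_norm_square of_real_power power2_eq_square)
  moreover have "z * cnj (sgn z) = z * cnj z / of_real (norm z)" by (simp add: sgn_eq)
  ultimately show ?thesis by simp
qed

text \<open>Only the set where W > 0 needs a bound for F, and only near the circle. The hypothesis
  on S is mean-square convergence, uniform over the radii.\<close>

theorem Riesz_product_summable:
  fixes f F :: "complex \<Rightarrow> complex" and \<alpha> :: "nat \<Rightarrow> complex" and W :: "complex \<Rightarrow> real"
  assumes f: "inner_like f" and s: "\<And>z. norm z < 1 \<Longrightarrow> norm (shift f z) < 1"
    and \<alpha>: "\<And>n. norm (\<alpha> n) \<le> A"
    and F: "continuous_on (ball 0 1) F"
    and W: "continuous_on (cball 0 1) W" "\<And>z. norm z \<le> 1 \<Longrightarrow> 0 \<le> W z \<and> W z \<le> 1"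
    and w: "blim W w" "w > 0"
    and M: "\<And>z. 1/2 < norm z \<Longrightarrow> norm z < 1 \<Longrightarrow> W z > 0 \<Longrightarrow> norm (F z) \<le> M"
    and S: "\<And>N r. 0 < r \<Longrightarrow> r < 1 \<Longrightarrow> circ_mean r (\<lambda>z. (norm (F z - (\<Sum>n<Suc N. \<alpha> n * (f ^^ n) z)))\<^sup>2) \<le> S N"
    and S0: "S \<longlonglongrightarrow> 0"
  shows "summable (\<lambda>n. norm (\<alpha> n))"
proof -
  define l where "l = tcoeff f 1"
  have norm_l: "norm l < 1" using s[of 0] by (simp add: l_def tcoeff_def)
  define m where "m = 1 - (norm l)\<^sup>2"
  have m: "0 < m" "m \<le> 1" using norm_l by (auto simp: m_def power_less_one_iff abs_square_less_1)
  \<comment> \<open>With this choice \<open>xbd\<close> equals m/2, so the second-order error is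
    half of the main term.\<close>
  define \<delta> where "\<delta> = (1 - norm l) * m / 2"
  have \<delta>_pos: "0 < \<delta>" using norm_l m by (simp add: \<delta>_def)
  have \<delta>1: "\<delta> \<le> (1 - norm l) / 2" using norm_l m by (simp add: \<delta>_def mult_left_le)
  have "2 * \<delta> \<le> 1 - norm l" using \<delta>1 by simp
  hence \<delta>2: "2 * \<delta> \<le> 1" and \<delta>3: "\<delta> \<le> 1 - norm l" using norm_l \<delta>_pos norm_ge_zero[of l] by linarith+
  \<comment> \<open>The limiting weighted error 8e is then w delta m / 8, half of the guaranteed
    gain w delta m / 4 per unit of |C_n|.\<close>
  define e where "e = w * \<delta> * m / 64"
  have e: "e > 0" using w \<delta>_pos m by (simp add: e_def)
  obtain p c V k where p: "cb p" "\<And>z. norm z < 1 \<Longrightarrow> norm (of_real (W z) - p z) \<le> e"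
    and V: "ceq (f ^^ k) p (\<lambda>z. c + V z)" "cb V" "\<And>z. norm z < 1 \<Longrightarrow> norm (V z) \<le> e" and c: "norm (c - of_real w) \<le> 2 * e"
    by (rule weight_mixing[OF f s W(1) w(1) e]; (assumption | (rule that; assumption)))
  \<comment> \<open>The first k coefficients are set aside (they form L below), so that the product
    can start at the iterate f^k, given which the weight has mixed.\<close>
  define \<alpha>' where "\<alpha>' n = (if n < k then 0 else \<alpha> n)" for n
  define C where "C = ar_sum (cnj l) \<alpha>'"
  \<comment> \<open>The correlation of the product with d_n points in the direction of cnj (b n), so
    this choice turns C_n times it into a multiple of |C_n| up to the error.\<close>
  define b where "b n = sgn (C n)" for n
  interpret riesz_product f b \<delta>
    by unfold_locales (use f norm_l \<delta>_pos \<delta>2 \<delta>3 in \<open>auto simp: b_def l_def norm_sgn\<close>)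
  have ml: "mult0 = l" by (simp add: mult0_def l_def)
  have xm: "xbd = m / 2" unfolding xbd_def ml using norm_l by (simp add: \<delta>_def field_simps)
  have A0: "A \<ge> 0" using \<alpha>[of 0] norm_ge_zero order_trans by blast
  have C_le: "norm (C n) \<le> A / (1 - norm l)" for n
    unfolding C_def using norm_ar_sum_le[of "cnj l" \<alpha>' A n] norm_l \<alpha> A0 by (auto simp: \<alpha>'_def)
  have C0: "C n = 0" if "n < k" for n unfolding C_def by (rule ar_sum_eq_0[OF _ that]) (simp add: \<alpha>'_def)
  define L where "L z = (\<Sum>n<k. \<alpha> n * (f ^^ n) z)" for z
  have L: "norm (L z) \<le> real k * A" if "norm z < 1" for z
  proof -
    have "norm (L z) \<le> (\<Sum>n<k. A)" unfolding L_def
    proof (rule sum_norm_le)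
      fix n
      have "norm (\<alpha> n * (f ^^ n) z) \<le> A * 1" unfolding norm_mult
        using \<alpha>[of n] it_norm[OF that, of n] A0 by (intro mult_mono) auto
      thus "norm (\<alpha> n * (f ^^ n) z) \<le> A" by simp
    qed
    thus ?thesis by simp
  qed
  define M' where "M' = max M 0"
  have "Bseq S" using S0 by (intro convergent_imp_Bseq convergentI)
  then obtain B where B: "\<And>n. S n \<le> B" unfolding Bseq_def by (metis abs_le_D1 real_norm_def)
  define G where "G N z = F z - (\<Sum>n<Suc N. \<alpha> n * (f ^^ n) z)" for N z
  have cG: "continuous_on (ball 0 1) (G N)" for N
    unfolding G_def[abs_def] by (intro continuous_intros F cb_cont[OF cb_it])
  define Ctot where "Ctot = M' + real k * A + A / (1 - norm l) + 1/2"
  have bound: "w * \<delta> * m / 8 * (\<Sum>n<Suc N. norm (C n)) \<le> Ctot + 2 * B + 1" if N: "k \<le> N" for N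
  proof -
    let ?P = "rprod k (Suc N)"
    have cW: "cb W" by (rule continuous_on_cball_imp_cb[OF W(1)])
    have cWc: "cb (\<lambda>z. complex_of_real (W z))" using cW by (rule cb_of_real)
    \<comment> \<open>KP depends on N, as the product does. The cut N' is therefore chosen
      afterwards, far enough for the remainder to absorb KP.\<close>
    obtain KP where KP: "KP > 0" "\<And>z. norm z < 1 \<Longrightarrow> norm (?P z) \<le> KP" using cb_bound[OF cb_rprod] by metis
    have "(\<lambda>n. KP * sqrt (S n)) \<longlonglongrightarrow> KP * sqrt 0" by (intro tendsto_intros S0)
    hence "eventually (\<lambda>n. KP * sqrt (S n) < 1) sequentially" by (intro order_tendstoD) auto
    then obtain N' where N': "N \<le> N'" "KP * sqrt (S N') < 1"
      unfolding eventually_sequentially by (metis nle_le order_refl)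
    \<comment> \<open>The block of terms between N and N', written as a function of f^(N+1) to make
      \<open>ceq_rprod_tail\<close> applicable.\<close>
    define Rg where "Rg z = (\<Sum>i<N' - N. \<alpha> (Suc N + i) * (f ^^ i) z)" for z
    have bRg: "bh Rg" unfolding Rg_def[abs_def] by (intro bh_sum bh_mult bh_const inner_like_bh inner_it)
    define R where "R z = Rg ((f ^^ Suc N) z)" for z
    have cR: "cb R" unfolding R_def[abs_def] by (rule inner_like_cb_compose[OF inner_it bRg])
    have RG: "R z = G N z - G N' z" for z
    proof -
      have "R z = (\<Sum>i<N' - N. \<alpha> (Suc N + i) * (f ^^ (i + Suc N)) z)"
        unfolding R_def Rg_def funpow_add by simp
      also have "\<dots> = (\<Sum>n\<in>{Suc N..<Suc N'}. \<alpha> n * (f ^^ n) z)"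
        by (rule sum.reindex_bij_witness[of _ "\<lambda>n. n - Suc N" "\<lambda>i. i + Suc N"]) (auto simp: add.commute)
      also have "\<dots> = (\<Sum>n<Suc N'. \<alpha> n * (f ^^ n) z) - (\<Sum>n<Suc N. \<alpha> n * (f ^^ n) z)"
        unfolding lessThan_atLeast0 by (rule sum_diff_nat_ivl[symmetric]) (use N' in auto)
      finally show ?thesis by (simp add: G_def)
    qed
    define \<Sigma> where "\<Sigma> z = (\<Sum>n<Suc N. C n * incr n z)" for z
    define q where "q z = cnj l * C N * (f ^^ Suc N) z" for z
    have Sig: "\<Sigma> z = F z - L z - R z - G N' z - q z" for z
    proof -
      have "(\<Sum>n<Suc N. \<alpha>' n * (f ^^ n) z) = \<Sigma> z + q z"
        unfolding \<Sigma>_def q_def C_def using sum_iterates_incr[of \<alpha>' z N] unfolding ml .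
      moreover have "(\<Sum>n<Suc N. \<alpha> n * (f ^^ n) z) = L z + (\<Sum>n<Suc N. \<alpha>' n * (f ^^ n) z)"
      proof -
        have *: "(\<Sum>n<Suc N. g n) = (\<Sum>n<k. g n) + (\<Sum>n\<in>{k..<Suc N}. g n)" for g :: "nat \<Rightarrow> complex"
          unfolding lessThan_atLeast0 by (rule sum.atLeastLessThan_concat[symmetric]) (use N in auto)
        have "(\<Sum>n<k. \<alpha>' n * (f ^^ n) z) = 0" by (rule sum.neutral) (simp add: \<alpha>'_def)
        moreover have "(\<Sum>n\<in>{k..<Suc N}. \<alpha>' n * (f ^^ n) z) = (\<Sum>n\<in>{k..<Suc N}. \<alpha> n * (f ^^ n) z)"
          by (rule sum.cong) (auto simp: \<alpha>'_def)
        ultimately show ?thesis by (simp only: * L_def add_0_left)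
      qed
      ultimately have "F z = L z + \<Sigma> z + q z + G N z" by (simp add: G_def)
      thus ?thesis using RG[of z] by simp
    qed
    have q: "norm (q z) \<le> A / (1 - norm l)" if "norm z < 1" for z
    proof -
      have "norm (q z) \<le> 1 * (A / (1 - norm l)) * 1" unfolding q_def norm_mult
        using norm_l C_le[of N] it_norm[OF that, of "Suc N"] A0 by (intro mult_mono) auto
      thus ?thesis by simp
    qed
    define Q where "Q n \<theta> E \<longleftrightarrow> norm (\<theta> - of_real (\<delta> / 2 * m) * cnj (b n)) \<le> \<delta> / 2 * (m / 2) \<and> (E \<longlongrightarrow> 8 * e) (at_left 1) \<and>
       (\<forall>r. 0 < r \<and> r < 1 \<longrightarrow> norm (circ_mean r (\<lambda>z. of_real (W z) * ?P z * incr n z) - of_real w * \<theta>) \<le> E r)"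
      for n \<theta> E
    have "\<forall>n\<in>{k..<Suc N}. \<exists>\<theta>. \<exists>E. Q n \<theta> E"
    proof
      fix n assume "n \<in> {k..<Suc N}"
      hence n: "k \<le> n" "n < Suc N" by auto
      have e0: "0 \<le> e" using e by simp
      show "\<exists>\<theta>. \<exists>E. Q n \<theta> E" unfolding Q_def
        by (rule weighted_lower_bound[OF cW p(2,1) V(1,2,3) c n e0]) (auto simp: ml m_def xm)
    qed
    from bchoice[OF this] obtain \<theta> where "\<forall>n\<in>{k..<Suc N}. \<exists>E. Q n (\<theta> n) E" ..
    from bchoice[OF this] obtain E where Q: "\<forall>n\<in>{k..<Suc N}. Q n (\<theta> n) (E n)" ..
    have \<theta>: "norm (\<theta> n - of_real (\<delta> / 2 * m) * cnj (b n)) \<le> \<delta> / 2 * (m / 2)" if "n \<in> {k..<Suc N}" for n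
      using bspec[OF Q that] unfolding Q_def by (rule conjunct1)
    have E: "(E n \<longlongrightarrow> 8 * e) (at_left 1)" if "n \<in> {k..<Suc N}" for n
      using bspec[OF Q that] unfolding Q_def by (elim conjE)
    have ET: "norm (circ_mean r (\<lambda>z. of_real (W z) * ?P z * incr n z) - of_real w * \<theta> n) \<le> E n r"
      if "n \<in> {k..<Suc N}" "0 < r" "r < 1" for n r
      using bspec[OF Q that(1)] that(2,3) unfolding Q_def by simp
    have Re\<theta>: "Re (C n * \<theta> n) \<ge> norm (C n) * (\<delta> * m / 4)" if n: "n \<in> {k..<Suc N}" for n
    proof -
      have "C n * cnj (b n) = of_real (norm (C n))"
        unfolding b_def by (rule mult_cnj_sgn)
      hence eq: "C n * \<theta> n = of_real (norm (C n) * (\<delta> / 2 * m)) + C n * (\<theta> n - of_real (\<delta> / 2 * m) * cnj (b n))"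
        by (simp add: algebra_simps)
      have "norm (C n * (\<theta> n - of_real (\<delta> / 2 * m) * cnj (b n))) \<le> norm (C n) * (\<delta> / 2 * (m / 2))"
        unfolding norm_mult by (intro mult_left_mono \<theta> n) auto
      hence "Re (C n * (\<theta> n - of_real (\<delta> / 2 * m) * cnj (b n))) \<ge> - (norm (C n) * (\<delta> / 2 * (m / 2)))"
        using abs_Re_le_cmod[of "C n * (\<theta> n - of_real (\<delta> / 2 * m) * cnj (b n))"] by linarith
      moreover have "Re (C n * \<theta> n) = norm (C n) * (\<delta> / 2 * m) + Re (C n * (\<theta> n - of_real (\<delta> / 2 * m) * cnj (b n)))"
        unfolding eq by (simp only: plus_complex.simps Re_complex_of_real)
      moreover have "norm (C n) * (\<delta> / 2 * m) - norm (C n) * (\<delta> / 2 * (m / 2)) = norm (C n) * (\<delta> * m / 4)"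
        by (simp add: algebra_simps)
      ultimately show ?thesis by linarith
    qed
    define lower where "lower r = (\<Sum>n\<in>{k..<Suc N}. norm (C n) * (w * \<delta> * m / 4 - E n r))" for r
    define upper where "upper r = Ctot * circ_mean r (\<lambda>z. norm (?P z))
       + 1/2 * (Re (circ_mean r (\<lambda>z. (?P z - 1) * (R z * cnj (R z)))) + 4 * B) + 1" for r
    \<comment> \<open>The radii are restricted to r > 1/2 because M bounds F only there; both sides
      have limits as r tends to 1.\<close>
    have le: "lower r \<le> upper r" if "1/2 < r" "r < 1" for r
    proof -
      have r: "0 < r" "r < 1" "\<bar>r\<bar> < 1" using that by auto
      have cSig: "cb \<Sigma>" unfolding \<Sigma>_def[abs_def] by (intro cb_intros cb_incr)
      let ?T = "\<lambda>n. circ_mean r (\<lambda>z. of_real (W z) * ?P z * incr n z)"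
      have "circ_mean r (\<lambda>z. of_real (W z) * ?P z * \<Sigma> z) = circ_mean r (\<lambda>z. \<Sum>n<Suc N. C n * (of_real (W z) * ?P z * incr n z))"
        unfolding \<Sigma>_def sum_distrib_left by (simp only: mult_ac)
      also have "\<dots> = (\<Sum>n<Suc N. C n * ?T n)"
      proof -
        have c: "cb (\<lambda>z. of_real (W z) * ?P z * incr n z)" "cb (\<lambda>z. C n * (of_real (W z) * ?P z * incr n z))" for n
          by (intro cb_intros cWc cb_rprod cb_incr)+
        show ?thesis
          by (subst circ_mean_sum[OF r(3) finite_lessThan cb_cont[OF c(2)]])
            (simp only: circ_mean_cmult[OF r(3) cb_cont[OF c(1)]])
      qed
      also have "\<dots> = (\<Sum>n\<in>{k..<Suc N}. C n * ?T n)"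
        by (rule sum.mono_neutral_right) (auto simp: C0)
      finally have TS: "circ_mean r (\<lambda>z. of_real (W z) * ?P z * \<Sigma> z) = (\<Sum>n\<in>{k..<Suc N}. C n * ?T n)" .
      have "lower r \<le> (\<Sum>n\<in>{k..<Suc N}. Re (C n * ?T n))"
        unfolding lower_def
      proof (rule sum_mono)
        fix n assume n: "n \<in> {k..<Suc N}"
        have "norm (C n * (?T n - of_real w * \<theta> n)) \<le> norm (C n) * E n r"
          unfolding norm_mult by (intro mult_left_mono ET n r) auto
        hence "Re (C n * (?T n - of_real w * \<theta> n)) \<ge> - (norm (C n) * E n r)"
          using abs_Re_le_cmod[of "C n * (?T n - of_real w * \<theta> n)"] by linarith
        moreover have "Re (C n * ?T n) = w * Re (C n * \<theta> n) + Re (C n * (?T n - of_real w * \<theta> n))"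
          by (simp add: algebra_simps)
        moreover have "w * Re (C n * \<theta> n) \<ge> w * (norm (C n) * (\<delta> * m / 4))"
          by (rule mult_left_mono[OF Re\<theta>[OF n]]) (use w in simp)
        ultimately show "norm (C n) * (w * \<delta> * m / 4 - E n r) \<le> Re (C n * ?T n)"
          by (simp add: algebra_simps)
      qed
      also have "\<dots> = Re (circ_mean r (\<lambda>z. of_real (W z) * ?P z * \<Sigma> z))" unfolding TS by simp
      also have "\<dots> \<le> norm (circ_mean r (\<lambda>z. of_real (W z) * ?P z * \<Sigma> z))" by (rule complex_Re_le_cmod)
      also have "\<dots> \<le> circ_mean r (\<lambda>z. norm (of_real (W z) * ?P z * \<Sigma> z))"
        by (rule norm_circ_mean_le[OF r(3)]) (intro cb_cont cb_intros cWc cb_rprod cSig)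
      also have "\<dots> \<le> circ_mean r (\<lambda>z. Ctot * norm (?P z) + 1/2 * Re (?P z * (R z * cnj (R z))) + KP * norm (G N' z))"
      proof (rule circ_mean_mono[OF r(3)])
        show "continuous_on (ball 0 1) (\<lambda>z. norm (of_real (W z) * ?P z * \<Sigma> z))"
          by (intro cb_cont cb_intros cWc cb_rprod cSig)
        show "continuous_on (ball 0 1) (\<lambda>z. Ctot * norm (?P z) + 1/2 * Re (?P z * (R z * cnj (R z))) + KP * norm (G N' z))"
          by (intro continuous_on_add continuous_on_mult[OF continuous_on_const continuous_on_norm[OF cG]] cb_cont cb_intros cb_rprod cR)
        fix z :: complex assume "norm z = \<bar>r\<bar>"
        hence z: "norm z < 1" "1/2 < norm z" using r that by auto
        have Wz: "0 \<le> W z" "W z \<le> 1" using W(2)[of z] z by auto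
        have WF: "W z * norm (F z) \<le> M'"
        proof (cases "W z > 0")
          case True
          have "W z * norm (F z) \<le> 1 * M'" using M[OF z(2,1) True] Wz by (intro mult_mono) (auto simp: M'_def)
          thus ?thesis by simp
        qed (use Wz in \<open>auto simp: M'_def\<close>)
        have W1: "W z * x \<le> x" if "x \<ge> 0" for x using Wz that by (simp add: mult_left_le_one_le)
        have "norm (\<Sigma> z) \<le> norm (F z) + norm (L z) + norm (R z) + norm (G N' z) + norm (q z)"
          unfolding Sig using norm_triangle5[of "F z" "- L z" "- R z" "- G N' z" "- q z"] by simp
        hence "W z * norm (\<Sigma> z) \<le> W z * (norm (F z) + norm (L z) + norm (R z) + norm (G N' z) + norm (q z))"
          using Wz by (intro mult_left_mono) auto
        also have "\<dots> = W z * norm (F z) + W z * norm (L z) + W z * norm (R z) + W z * norm (G N' z) + W z * norm (q z)"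
          by (simp add: algebra_simps)
        also have "\<dots> \<le> M' + real k * A + (1/2 + 1/2 * (norm (R z))\<^sup>2) + norm (G N' z) + A / (1 - norm l)"
        proof (intro add_mono WF)
          show "W z * norm (L z) \<le> real k * A" using W1[of "norm (L z)"] L[OF z(1)] by simp
          show "W z * norm (q z) \<le> A / (1 - norm l)" using W1[of "norm (q z)"] q[OF z(1)] by simp
          \<comment> \<open>The tail identity concerns R times its conjugate, so the first power of
            |R| is traded for its square; the constant 1/2 goes into Ctot.\<close>
          have "0 \<le> (norm (R z) - 1)\<^sup>2" by simp
          hence "norm (R z) \<le> 1/2 + 1/2 * (norm (R z))\<^sup>2" by (simp add: power2_diff)
          thus "W z * norm (R z) \<le> 1/2 + 1/2 * (norm (R z))\<^sup>2" using W1[of "norm (R z)"] by simp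
          show "W z * norm (G N' z) \<le> norm (G N' z)" by (rule W1) simp
        qed
        finally have 1: "W z * norm (\<Sigma> z) \<le> Ctot + 1/2 * (norm (R z))\<^sup>2 + norm (G N' z)" by (simp add: Ctot_def)
        have "norm (of_real (W z) * ?P z * \<Sigma> z) = norm (?P z) * (W z * norm (\<Sigma> z))"
          using Wz by (simp add: norm_mult)
        also have "\<dots> \<le> norm (?P z) * (Ctot + 1/2 * (norm (R z))\<^sup>2 + norm (G N' z))"
          by (rule mult_left_mono[OF 1]) simp
        also have "\<dots> = Ctot * norm (?P z) + 1/2 * (norm (?P z) * (norm (R z))\<^sup>2) + norm (?P z) * norm (G N' z)"
          by (simp add: algebra_simps)
        also have "norm (?P z) * (norm (R z))\<^sup>2 = Re (of_real (norm (?P z)) * of_real ((norm (R z))\<^sup>2))"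
          unfolding of_real_mult[symmetric] Re_complex_of_real ..
        also have "\<dots> = Re (?P z * (R z * cnj (R z)))"
          unfolding rprod_norm[OF z(1), symmetric] complex_norm_square ..
        also have "norm (?P z) * norm (G N' z) \<le> KP * norm (G N' z)"
          using KP(2)[OF z(1)] by (rule mult_right_mono) simp
        finally show "norm (of_real (W z) * ?P z * \<Sigma> z)
            \<le> Ctot * norm (?P z) + 1/2 * Re (?P z * (R z * cnj (R z))) + KP * norm (G N' z)" by simp
      qed
      also have "\<dots> = Ctot * circ_mean r (\<lambda>z. norm (?P z)) + 1/2 * Re (circ_mean r (\<lambda>z. ?P z * (R z * cnj (R z))))
          + KP * circ_mean r (\<lambda>z. norm (G N' z))"
      proof -
        have c1: "cb (\<lambda>z. Ctot * norm (?P z))" and c2: "cb (\<lambda>z. 1/2 * Re (?P z * (R z * cnj (R z))))"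
          and c2': "cb (\<lambda>z. Re (?P z * (R z * cnj (R z))))" and c2'': "cb (\<lambda>z. ?P z * (R z * cnj (R z)))"
          and c1': "cb (\<lambda>z. norm (?P z))"
          by (intro cb_intros cb_rprod cR)+
        have c3': "continuous_on (ball 0 1) (\<lambda>z. norm (G N' z))" by (intro continuous_on_norm cG)
        have c3: "continuous_on (ball 0 1) (\<lambda>z. KP * norm (G N' z))" by (intro continuous_on_mult continuous_on_const c3')
        show ?thesis
          using circ_mean_add[OF r(3) cb_cont[OF cb_add[OF c1 c2]] c3] circ_mean_add[OF r(3) cb_cont[OF c1] cb_cont[OF c2]]
            circ_mean_cmult[OF r(3) cb_cont[OF c1'], of Ctot] circ_mean_cmult[OF r(3) cb_cont[OF c2'], of "1/2"]
            circ_mean_Re[OF r(3) cb_cont[OF c2'']] circ_mean_cmult[OF r(3) c3', of KP]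
          by (simp only:)
      qed
      also have "\<dots> \<le> upper r"
      proof -
        have "(circ_mean r (\<lambda>z. norm (G N' z)))\<^sup>2 \<le> circ_mean r (\<lambda>z. (norm (G N' z))\<^sup>2)"
          by (rule circ_mean_power2_le[OF continuous_on_norm[OF cG] r(3)])
        also have "\<dots> \<le> S N'" unfolding G_def by (rule S[OF r(1,2)])
        finally have "circ_mean r (\<lambda>z. norm (G N' z)) \<le> sqrt (S N')" by (rule real_le_rsqrt)
        hence "KP * circ_mean r (\<lambda>z. norm (G N' z)) \<le> KP * sqrt (S N')" using KP by (intro mult_left_mono) auto
        hence G1: "KP * circ_mean r (\<lambda>z. norm (G N' z)) \<le> 1" using N' by simp
        have "circ_mean r (\<lambda>z. (norm (R z))\<^sup>2) \<le> circ_mean r (\<lambda>z. 2 * (norm (G N z))\<^sup>2 + 2 * (norm (G N' z))\<^sup>2)"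
        proof (rule circ_mean_mono[OF r(3)])
          fix z :: complex
          have "(norm (R z))\<^sup>2 \<le> (norm (G N z) + norm (G N' z))\<^sup>2"
            unfolding RG by (intro power_mono norm_triangle_ineq4) auto
          also have "\<dots> \<le> 2 * (norm (G N z))\<^sup>2 + 2 * (norm (G N' z))\<^sup>2"
            using sum_squares_bound[of "norm (G N z)" "norm (G N' z)"] by (simp add: power2_sum)
          finally show "(norm (R z))\<^sup>2 \<le> 2 * (norm (G N z))\<^sup>2 + 2 * (norm (G N' z))\<^sup>2" .
        qed (intro cb_cont cb_intros cR continuous_intros cG)+
        also have "\<dots> = 2 * circ_mean r (\<lambda>z. (norm (G N z))\<^sup>2) + 2 * circ_mean r (\<lambda>z. (norm (G N' z))\<^sup>2)"
        proof -
          have c: "continuous_on (ball 0 1) (\<lambda>z. (norm (G n z))\<^sup>2)" "continuous_on (ball 0 1) (\<lambda>z. 2 * (norm (G n z))\<^sup>2)" for n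
            by (intro continuous_intros cG)+
          show ?thesis using circ_mean_add[OF r(3) c(2)[of N] c(2)[of N']]
              circ_mean_cmult[OF r(3) c(1)[of N], of 2] circ_mean_cmult[OF r(3) c(1)[of N'], of 2] by (simp only:)
        qed
        also have "\<dots> \<le> 2 * B + 2 * B"
          using S[OF r(1,2), of N] S[OF r(1,2), of N'] B[of N] B[of N'] unfolding G_def by linarith
        finally have R2: "circ_mean r (\<lambda>z. (norm (R z))\<^sup>2) \<le> 4 * B" by simp
        have cRR: "cb (\<lambda>z. R z * cnj (R z))" and cPR: "cb (\<lambda>z. (?P z - 1) * (R z * cnj (R z)))"
          and cR2: "cb (\<lambda>z. (norm (R z))\<^sup>2)"
          by (intro cb_intros cb_rprod cR)+
        \<comment> \<open>The first part vanishes in the limit by \<open>ceq_rprod_tail\<close>; the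
          second is at most 4B, a bound independent of N and N'.\<close>
        have "circ_mean r (\<lambda>z. ?P z * (R z * cnj (R z))) = circ_mean r (\<lambda>z. (?P z - 1) * (R z * cnj (R z)) + R z * cnj (R z))"
          by (simp add: algebra_simps)
        also have "\<dots> = circ_mean r (\<lambda>z. (?P z - 1) * (R z * cnj (R z))) + circ_mean r (\<lambda>z. R z * cnj (R z))"
          by (rule circ_mean_add[OF r(3) cb_cont[OF cPR] cb_cont[OF cRR]])
        also have "circ_mean r (\<lambda>z. R z * cnj (R z)) = of_real (circ_mean r (\<lambda>z. (norm (R z))\<^sup>2))"
          unfolding complex_norm_square[symmetric] by (rule circ_mean_of_real[OF r(3) cb_cont[OF cR2]])
        finally have "Re (circ_mean r (\<lambda>z. ?P z * (R z * cnj (R z)))) \<le> Re (circ_mean r (\<lambda>z. (?P z - 1) * (R z * cnj (R z)))) + 4 * B"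
          using R2 by simp
        hence "1/2 * Re (circ_mean r (\<lambda>z. ?P z * (R z * cnj (R z))))
            \<le> 1/2 * (Re (circ_mean r (\<lambda>z. (?P z - 1) * (R z * cnj (R z)))) + 4 * B)"
          by (rule mult_left_mono) simp
        thus ?thesis unfolding upper_def by (rule add_mono[OF add_left_mono G1])
      qed
      finally show ?thesis .
    qed
    have kN: "k \<le> Suc N" using N by simp
    note P1 = blim_norm_rprod[OF kN]
    have PR: "blim (\<lambda>z. (?P z - 1) * (R z * cnj (R z))) 0"
      unfolding R_def by (rule ceq_rprod_tail[OF kN bRg])
    have l1: "(lower \<longlongrightarrow> (\<Sum>n\<in>{k..<Suc N}. norm (C n) * (w * \<delta> * m / 4 - 8 * e))) (at_left 1)"
      unfolding lower_def[abs_def] by (intro tendsto_intros E)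
    have l2: "(upper \<longlongrightarrow> Ctot * 1 + 1/2 * (Re 0 + 4 * B) + 1) (at_left 1)"
      unfolding upper_def[abs_def] by (intro tendsto_intros P1 PR)
    have "(\<Sum>n\<in>{k..<Suc N}. norm (C n) * (w * \<delta> * m / 4 - 8 * e)) \<le> Ctot * 1 + 1/2 * (Re 0 + 4 * B) + 1"
    proof (rule tendsto_le[OF trivial_limit_at_left_real l2 l1])
      show "\<forall>\<^sub>F r in at_left 1. lower r \<le> upper r"
        using eventually_at_left_real[of "1/2" "1::real"] by (auto elim!: eventually_mono intro!: le)
    qed
    moreover have "(\<Sum>n\<in>{k..<Suc N}. norm (C n) * (w * \<delta> * m / 4 - 8 * e)) = w * \<delta> * m / 8 * (\<Sum>n<Suc N. norm (C n))"
    proof -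
      have "(\<Sum>n<Suc N. norm (C n)) = (\<Sum>n\<in>{k..<Suc N}. norm (C n))"
        by (rule sum.mono_neutral_right) (auto simp: C0)
      thus ?thesis by (simp add: sum_distrib_left sum_distrib_right e_def algebra_simps del: sum.op_ivl_Suc sum.lessThan_Suc)
    qed
    ultimately show ?thesis by simp
  qed
  let ?\<gamma> = "w * \<delta> * m / 8"
  have g: "?\<gamma> > 0" using w \<delta>_pos m by simp
  have "summable (\<lambda>n. norm (C n))"
  proof (rule summableI_nonneg_bounded)
    fix n
    have "(\<Sum>i<n. norm (C i)) \<le> (\<Sum>i<Suc (n + k). norm (C i))" by (rule sum_mono2) auto
    also have "\<dots> \<le> (Ctot + 2 * B + 1) / ?\<gamma>"
      using bound[of "n + k"] g by (subst pos_le_divide_eq) (auto simp: mult.commute)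
    finally show "(\<Sum>i<n. norm (C i)) \<le> (Ctot + 2 * B + 1) / ?\<gamma>" .
  qed auto
  hence "summable (\<lambda>n. norm (\<alpha>' n))" unfolding C_def by (rule summable_of_ar_sum)
  thus ?thesis
    by (rule summable_cong[THEN iffD1, rotated]) (auto simp: \<alpha>'_def eventually_at_top_linorder intro!: exI[of _ k])
qed

section \<open>Boundary values of Hardy functions\<close>

text \<open>The completeness argument for L1: summable increments produce an explicit limit function
  whose integral is the limit of the integrals.\<close>

lemma L1_summable_increments:
  fixes f :: "nat \<Rightarrow> real \<Rightarrow> complex"
  assumes f: "\<And>k. continuous_on {a..b} (f k)"
    and sm: "summable (\<lambda>k. integral {a..b} (\<lambda>t. norm (f (Suc k) t - f k t)))"
  defines "g \<equiv> \<lambda>t. f 0 t + (\<Sum>k. f (Suc k) t - f k t)"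
  shows "g integrable_on {a..b}" "(\<lambda>k. integral {a..b} (f k)) \<longlonglongrightarrow> integral {a..b} g"
proof -
  let ?M = "lebesgue_on {a..b}"
  let ?d = "\<lambda>k t. f (Suc k) t - f k t"
  have ai: "h absolutely_integrable_on {a..b}" if "continuous_on {a..b} h" for h :: "real \<Rightarrow> complex"
    using that by (rule absolutely_integrable_continuous_real)
  have lint: "integrable ?M h" if "h absolutely_integrable_on {a..b}" for h :: "real \<Rightarrow> complex"
    using that by (simp add: integrable_restrict_space set_integrable_def)
  have leq: "integral\<^sup>L ?M h = integral {a..b} h" if "integrable ?M h" for h :: "real \<Rightarrow> complex"
    by (rule lebesgue_integral_eq_integral[OF that]) simp
  have leqr: "integral\<^sup>L ?M h = integral {a..b} h" if "integrable ?M h" for h :: "real \<Rightarrow> real"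
    by (rule lebesgue_integral_eq_integral[OF that]) simp
  have di: "integrable ?M (?d k)" for k by (intro lint ai continuous_intros f)
  have fi: "integrable ?M (f k)" for k by (intro lint ai f)
  have nle: "integral\<^sup>L ?M (\<lambda>t. norm (?d k t)) = integral {a..b} (\<lambda>t. norm (?d k t))" for k
    by (intro leqr integrable_norm di)
  have s2: "summable (\<lambda>k. integral\<^sup>L ?M (\<lambda>t. norm (?d k t)))" using sm by (simp add: nle)
  \<comment> \<open>By monotone convergence the sum of the norms has finite integral, hence is
    finite almost everywhere. Elsewhere the infinite sum in g is an arbitrary value on a null
    set.\<close>
  have ae: "AE t in ?M. summable (\<lambda>k. norm (?d k t))"
  proof -
    have meas: "(\<lambda>t. ennreal (norm (?d k t))) \<in> borel_measurable ?M" for k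
      using di[of k] by measurable
    have "(\<integral>\<^sup>+t. (\<Sum>k. ennreal (norm (?d k t))) \<partial>?M) = (\<Sum>k. \<integral>\<^sup>+t. ennreal (norm (?d k t)) \<partial>?M)"
      by (rule nn_integral_suminf) (rule meas)
    also have "\<dots> = (\<Sum>k. ennreal (integral\<^sup>L ?M (\<lambda>t. norm (?d k t))))"
      by (intro suminf_cong nn_integral_eq_integral integrable_norm di) auto
    also have "\<dots> = ennreal (\<Sum>k. integral\<^sup>L ?M (\<lambda>t. norm (?d k t)))"
      by (rule suminf_ennreal2[OF _ s2]) auto
    finally have "(\<integral>\<^sup>+t. (\<Sum>k. ennreal (norm (?d k t))) \<partial>?M) \<noteq> \<infinity>" by simp
    hence "AE t in ?M. (\<Sum>k. ennreal (norm (?d k t))) \<noteq> \<infinity>"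
      by (intro nn_integral_PInf_AE borel_measurable_suminf_order meas)
    thus ?thesis
      by eventually_elim (rule summable_suminf_not_top, auto)
  qed
  have gi: "integrable ?M (\<lambda>t. \<Sum>k. ?d k t)"
    by (rule integrable_suminf[OF di ae s2])
  have "integrable ?M g" unfolding g_def by (intro Bochner_Integration.integrable_add fi gi)
  hence "g absolutely_integrable_on {a..b}" by (simp add: integrable_restrict_space set_integrable_def)
  thus gint: "g integrable_on {a..b}" by (simp add: absolutely_integrable_on_def)
  have "(\<lambda>k. integral\<^sup>L ?M (?d k)) sums integral\<^sup>L ?M (\<lambda>t. \<Sum>k. ?d k t)"
    by (rule sums_integral[OF di ae s2])
  hence "(\<lambda>n. integral\<^sup>L ?M (f 0) + (\<Sum>k<n. integral\<^sup>L ?M (?d k))) \<longlonglongrightarrow> integral\<^sup>L ?M (f 0) + integral\<^sup>L ?M (\<lambda>t. \<Sum>k. ?d k t)"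
    unfolding sums_def by (intro tendsto_intros)
  also have "(\<lambda>n. integral\<^sup>L ?M (f 0) + (\<Sum>k<n. integral\<^sup>L ?M (?d k))) = (\<lambda>n. integral {a..b} (f n))"
  proof
    fix n
    have "(\<Sum>k<n. integral\<^sup>L ?M (?d k)) = (\<Sum>k<n. integral\<^sup>L ?M (f (Suc k)) - integral\<^sup>L ?M (f k))"
      by (intro sum.cong refl Bochner_Integration.integral_diff fi)
    also have "\<dots> = integral\<^sup>L ?M (f n) - integral\<^sup>L ?M (f 0)" by (rule sum_lessThan_telescope)
    finally show "integral\<^sup>L ?M (f 0) + (\<Sum>k<n. integral\<^sup>L ?M (?d k)) = integral {a..b} (f n)"
      using leq[OF fi[of n]] by simp
  qed
  also have "integral\<^sup>L ?M (f 0) + integral\<^sup>L ?M (\<lambda>t. \<Sum>k. ?d k t) = integral {a..b} g"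
  proof -
    have "integral\<^sup>L ?M (f 0) + integral\<^sup>L ?M (\<lambda>t. \<Sum>k. ?d k t) = integral\<^sup>L ?M g"
      unfolding g_def by (rule Bochner_Integration.integral_add[symmetric, OF fi gi])
    thus ?thesis using leq[OF \<open>integrable ?M g\<close>] by simp
  qed
  finally show "(\<lambda>k. integral {a..b} (f k)) \<longlonglongrightarrow> integral {a..b} g" .
qed

section \<open>Parseval's identity and coefficients of Hardy functions\<close>

lemma Parseval_partial:
  "integral {0..2*pi} (\<lambda>t. (norm (\<Sum>n<K. d n * cis t ^ n))\<^sup>2) = 2 * pi * (\<Sum>n<K. (norm (d n))\<^sup>2)"
proof (induction K)
  case (Suc K)
  \<comment> \<open>On the unit circle this polynomial is the cross term between the new term and
    the earlier ones; all its exponents K - n are positive, so its mean is G(0) = 0.\<close>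
  define G where "G z = d K * (\<Sum>n<K. cnj (d n) * z ^ (K - n))" for z
  have G1: "circ_mean 1 G = G 0"
    by (rule circ_mean_Cauchy) (auto simp: G_def[abs_def] intro!: continuous_intros holomorphic_intros)
  have "G 0 = 0" unfolding G_def by (intro mult_eq_0_iff[THEN iffD2] disjI2 sum.neutral) auto
  hence "integral {0..2*pi} (\<lambda>t. G (cis t)) = 0" using G1 by (simp add: circ_mean_def)
  moreover have cG: "continuous_on {0..2*pi} (\<lambda>t. G (cis t))" unfolding G_def by (intro continuous_intros)
  ultimately have G2: "integral {0..2*pi} (\<lambda>t. Re (G (cis t))) = 0"
    using integral_linear[OF integrable_continuous_real[OF cG] bounded_linear_Re] by (simp only: o_def zero_complex.simps)
  let ?S = "\<lambda>t. \<Sum>n<K. d n * cis t ^ n"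
  have eq: "(norm (\<Sum>n<Suc K. d n * cis t ^ n))\<^sup>2 = (norm (?S t))\<^sup>2 + ((norm (d K))\<^sup>2 + 2 * Re (G (cis t)))" for t
  proof -
    have "cnj (?S t) * (d K * cis t ^ K) = G (cis t)"
    proof -
      have "cnj (cis t) ^ n * cis t ^ K = cis t ^ (K - n)" if "n < K" for n
      proof -
        have "cis t ^ K = cis t ^ n * cis t ^ (K - n)" using that by (simp flip: power_add)
        moreover have "cnj (cis t) ^ n * cis t ^ n = 1"
          by (simp flip: power_mult_distrib add: cis_cnj cis_mult)
        ultimately show ?thesis by (simp add: mult.assoc[symmetric])
      qed
      hence "(\<Sum>n<K. cnj (d n) * cnj (cis t) ^ n * (d K * cis t ^ K)) = (\<Sum>n<K. d K * (cnj (d n) * cis t ^ (K - n)))"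
        by (intro sum.cong) (auto simp: mult_ac)
      thus ?thesis by (simp add: G_def sum_distrib_left sum_distrib_right)
    qed
    thus ?thesis by (simp add: norm_add_square norm_mult norm_power)
  qed
  have "integral {0..2*pi} (\<lambda>t. (norm (\<Sum>n<Suc K. d n * cis t ^ n))\<^sup>2) =
    integral {0..2*pi} (\<lambda>t. (norm (?S t))\<^sup>2) + (integral {0..2*pi} (\<lambda>t. (norm (d K))\<^sup>2) + integral {0..2*pi} (\<lambda>t. 2 * Re (G (cis t))))"
    unfolding eq
    by (subst Henstock_Kurzweil_Integration.integral_add,
        (auto simp: G_def intro!: integrable_continuous_real continuous_intros)[2],
        subst Henstock_Kurzweil_Integration.integral_add)
      (auto simp: G_def intro!: integrable_continuous_real continuous_intros)
  also have "integral {0..2*pi} (\<lambda>t. 2 * Re (G (cis t))) = 0"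
    using G2 by simp
  finally show ?case using Suc by (simp add: algebra_simps)
qed simp

lemma Parseval:
  assumes d: "summable (\<lambda>n. norm (d n))"
  shows "(\<lambda>n. (norm (d n))\<^sup>2) sums (1 / (2*pi) * integral {0..2*pi} (\<lambda>t. (norm (\<Sum>n. d n * cis t ^ n))\<^sup>2))"
proof -
  let ?D = "\<Sum>n. norm (d n)"
  have nle: "norm (\<Sum>n<K. d n * cis t ^ n) \<le> ?D" for K t
  proof -
    have "norm (\<Sum>n<K. d n * cis t ^ n) \<le> (\<Sum>n<K. norm (d n))"
      by (rule sum_norm_le) (simp add: norm_mult norm_power)
    also have "\<dots> \<le> ?D" by (rule sum_le_suminf[OF d]) auto
    finally show ?thesis .
  qed
  have "(\<lambda>K. integral {0..2*pi} (\<lambda>t. (norm (\<Sum>n<K. d n * cis t ^ n))\<^sup>2)) \<longlonglongrightarrow>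
      integral {0..2*pi} (\<lambda>t. (norm (\<Sum>n. d n * cis t ^ n))\<^sup>2)"
  proof (rule dominated_convergence(2))
    show "(\<lambda>t. (norm (\<Sum>n<K. d n * cis t ^ n))\<^sup>2) integrable_on {0..2*pi}" for K
      by (intro integrable_continuous_real continuous_intros)
    show "(\<lambda>t. ?D\<^sup>2) integrable_on {0..2*pi}" by (intro integrable_continuous_real continuous_intros)
    show "norm ((norm (\<Sum>n<K. d n * cis t ^ n))\<^sup>2) \<le> ?D\<^sup>2" for K t
      using nle[where K = K and t = t] by (simp add: power_mono)
    show "(\<lambda>K. (norm (\<Sum>n<K. d n * cis t ^ n))\<^sup>2) \<longlonglongrightarrow> (norm (\<Sum>n. d n * cis t ^ n))\<^sup>2" for t
    proof (intro tendsto_power tendsto_norm summable_LIMSEQ)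
      show "summable (\<lambda>n. d n * cis t ^ n)"
        by (rule summable_norm_cancel) (use d in \<open>simp add: norm_mult norm_power\<close>)
    qed
  qed
  hence "(\<lambda>K. 1 / (2*pi) * (2 * pi * (\<Sum>n<K. (norm (d n))\<^sup>2))) \<longlonglongrightarrow>
      1 / (2*pi) * integral {0..2*pi} (\<lambda>t. (norm (\<Sum>n. d n * cis t ^ n))\<^sup>2)"
    unfolding Parseval_partial by (rule tendsto_mult_left)
  thus ?thesis unfolding sums_def by simp
qed

text \<open>Parseval at radius r bounds every partial sum of |c_n|^2 r^(2n) by the square mean; r
  tends to 1 in a finite sum.\<close>

lemma hardy2_coeffs:
  assumes "F \<in> hardy2"
  defines "c \<equiv> \<lambda>n. (deriv ^^ n) F 0 / fact n"
  shows "\<And>z. norm z < 1 \<Longrightarrow> (\<lambda>n. c n * z ^ n) sums F z" "summable (\<lambda>n. (norm (c n))\<^sup>2)"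
proof -
  have hol: "F holomorphic_on ball 0 1" using assms by (simp add: hardy2_def)
  show s: "(\<lambda>n. c n * z ^ n) sums F z" if "norm z < 1" for z
    using holomorphic_power_series[OF hol, of z] that by (simp add: c_def)
  obtain C where C: "\<And>r. r \<in> {0..<1} \<Longrightarrow> square_mean F r \<le> C"
    using assms(1) unfolding hardy2_def bdd_above_def by blast
  have le: "(\<Sum>n<m. (norm (c n * of_real r ^ n))\<^sup>2) \<le> C" if r: "0 < r" "r < 1" for r m
  proof -
    define q where "q = (1 + r) / 2"
    have q: "r < q" "q < 1" "0 < q" using r by (auto simp: q_def)
    have "summable (\<lambda>n. c n * of_real q ^ n)" using s[of "of_real q"] q by (auto simp: sums_iff)
    from powser_insidea[OF this, of "of_real r"] have sm: "summable (\<lambda>n. norm (c n * of_real r ^ n))"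
      using r q by simp
    have sq: "(\<lambda>n. (norm (c n * of_real r ^ n))\<^sup>2) sums square_mean F r"
    proof -
      have "(\<Sum>n. c n * of_real r ^ n * cis t ^ n) = F (of_real r * cis t)" for t
        using s[of "of_real r * cis t"] r by (simp add: sums_iff power_mult_distrib mult.assoc norm_mult)
      thus ?thesis using Parseval[OF sm] by (simp add: square_mean_def)
    qed
    have "(\<Sum>n<m. (norm (c n * of_real r ^ n))\<^sup>2) \<le> (\<Sum>n. (norm (c n * of_real r ^ n))\<^sup>2)"
      by (rule sum_le_suminf[OF sums_summable[OF sq]]) auto
    also have "\<dots> = square_mean F r" by (rule sums_unique[OF sq, symmetric])
    also have "\<dots> \<le> C" using C[of r] r by simp
    finally show ?thesis .
  qed
  show "summable (\<lambda>n. (norm (c n))\<^sup>2)"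
  proof (rule summableI_nonneg_bounded)
    fix m
    have "((\<lambda>r. \<Sum>n<m. (norm (c n * of_real r ^ n))\<^sup>2) \<longlongrightarrow> (\<Sum>n<m. (norm (c n * of_real 1 ^ n))\<^sup>2)) (at_left 1)"
      by (intro tendsto_intros)
    hence "(\<Sum>n<m. (norm (c n * of_real 1 ^ n))\<^sup>2) \<le> C"
      by (rule tendsto_upperbound) (use eventually_at_left_1 le in \<open>auto elim!: eventually_mono\<close>)
    thus "(\<Sum>n<m. (norm (c n))\<^sup>2) \<le> C" by simp
  qed auto
qed

section \<open>The primitive of a Hardy function vanishing at 0\<close>

definition prim_coeff :: "(nat \<Rightarrow> complex) \<Rightarrow> nat \<Rightarrow> complex" where
  "prim_coeff c n = (if n = 0 then 0 else c (n - 1) / of_nat n)"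

definition prim :: "(nat \<Rightarrow> complex) \<Rightarrow> complex \<Rightarrow> complex" where
  "prim c z = (\<Sum>n. prim_coeff c n * z ^ n)"

lemma product_le_half_squares: "a * b \<le> (a\<^sup>2 + b\<^sup>2) / 2" for a b :: real
  using sum_squares_bound[of a b] by simp

context
  fixes c :: "nat \<Rightarrow> complex" and F :: "complex \<Rightarrow> complex"
  assumes c2: "summable (\<lambda>n. (norm (c n))\<^sup>2)"
    and F: "\<And>z. norm z < 1 \<Longrightarrow> (\<lambda>n. c n * z ^ n) sums F z"
begin

text \<open>Both |c_n| and 1/(n+1) are square summable, so their product is summable. This absolute
  convergence is what makes the primitive continuous on the closed disc.\<close>

lemma summable_prim_coeff: "summable (\<lambda>n. norm (prim_coeff c n))"
proof -
  have "summable (\<lambda>n. norm (prim_coeff c (Suc n)))"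
  proof (rule summable_comparison_test')
    have "summable (\<lambda>n. 1 / (real (Suc n))\<^sup>2)"
      using inverse_squares_sums by (auto simp: sums_iff)
    thus "summable (\<lambda>n. ((norm (c n))\<^sup>2 + 1 / (real (Suc n))\<^sup>2) / 2)" by (intro summable_divide summable_add c2)
    fix n
    have "norm (prim_coeff c (Suc n)) = norm (c n) * (1 / real (Suc n))"
      by (simp add: prim_coeff_def norm_divide del: of_nat_Suc)
    also have "\<dots> \<le> ((norm (c n))\<^sup>2 + (1 / real (Suc n))\<^sup>2) / 2"
      by (rule product_le_half_squares)
    finally show "norm (norm (prim_coeff c (Suc n))) \<le> ((norm (c n))\<^sup>2 + 1 / (real (Suc n))\<^sup>2) / 2"
      by (simp add: power_divide)
  qed
  thus ?thesis by (rule iffD1[OF summable_Suc_iff])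
qed

lemma continuous_prim: "continuous_on (cball 0 1) (prim c)"
proof -
  have "uniform_limit (cball 0 1) (\<lambda>n z. \<Sum>i<n. prim_coeff c i * z ^ i) (\<lambda>z. \<Sum>i. prim_coeff c i * z ^ i) sequentially"
  proof (rule Weierstrass_m_test[OF _ summable_prim_coeff])
    fix n and z :: complex assume "z \<in> cball 0 1"
    hence "norm (prim_coeff c n) * norm z ^ n \<le> norm (prim_coeff c n) * 1"
      by (intro mult_left_mono power_le_one) auto
    thus "norm (prim_coeff c n * z ^ n) \<le> norm (prim_coeff c n)" by (simp add: norm_mult norm_power)
  qed
  hence "continuous_on (cball 0 1) (\<lambda>z. \<Sum>i. prim_coeff c i * z ^ i)"
    by (rule uniform_limit_theorem[rotated]) (auto intro!: always_eventually continuous_intros)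
  thus ?thesis by (simp add: prim_def[abs_def])
qed

lemma prim_deriv:
  assumes "norm z < 1" shows "(prim c has_field_derivative F z) (at z)"
proof -
  have "((\<lambda>z. \<Sum>n. prim_coeff c n * z ^ n) has_field_derivative (\<Sum>n. diffs (prim_coeff c) n * z ^ n)) (at z)"
    by (rule termdiffs_strong[of _ 1]) (use summable_norm_cancel[OF summable_prim_coeff] assms in auto)
  moreover have "diffs (prim_coeff c) n = c n" for n
    by (simp add: diffs_def prim_coeff_def del: of_nat_Suc)
  ultimately show ?thesis using F[OF assms] by (simp add: prim_def[abs_def] sums_iff)
qed

text \<open>The squared mean-square distance on the circle between z F(z) at radius r and its
  boundary function. The exponent is n + 1 because the derivative of the primitive in the angle is i
  z F(z), not F(z).\<close>

definition defect :: "real \<Rightarrow> real" where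
  "defect r = (\<Sum>n. (norm (c n))\<^sup>2 * (1 - r ^ Suc n)\<^sup>2)"

lemma defect_bound: assumes "0 \<le> r" "r \<le> 1" shows "(norm (c n))\<^sup>2 * (1 - r ^ Suc n)\<^sup>2 \<le> (norm (c n))\<^sup>2"
proof -
  have "0 \<le> r ^ Suc n" "r ^ Suc n \<le> 1" using assms by (auto intro: power_le_one simp del: power_Suc)
  hence "(1 - r ^ Suc n)\<^sup>2 \<le> 1" by (simp add: power_le_one del: power_Suc)
  thus ?thesis by (simp add: mult_left_le)
qed

lemma defect_summable: assumes "0 \<le> r" "r \<le> 1" shows "summable (\<lambda>n. (norm (c n))\<^sup>2 * (1 - r ^ Suc n)\<^sup>2)"
  by (rule summable_comparison_test'[OF c2]) (use defect_bound[OF assms] in \<open>simp del: power_Suc\<close>)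

text \<open>The series converges uniformly in r on [0,1], so the defect is continuous there and
  vanishes at 1.\<close>

lemma defect_tendsto: "(defect \<longlongrightarrow> 0) (at_left 1)"
proof -
  have "uniform_limit {0..1} (\<lambda>n r. \<Sum>i<n. (norm (c i))\<^sup>2 * (1 - r ^ Suc i)\<^sup>2) defect sequentially"
    unfolding defect_def[abs_def]
    by (rule Weierstrass_m_test[OF _ c2]) (use defect_bound in \<open>auto simp del: power_Suc\<close>)
  hence "continuous_on {0..1} defect"
    by (rule uniform_limit_theorem[rotated]) (auto intro!: always_eventually continuous_intros)
  hence "(defect \<longlongrightarrow> defect 1) (at 1 within {0..1})" by (simp add: continuous_on)
  moreover have "at_left (1::real) = at 1 within {0..1}"
    by (rule at_within_nhd[of _ "{0<..<2}"]) auto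
  ultimately show ?thesis by (simp add: defect_def)
qed

lemma integral_square_diff:
  assumes r: "0 < r" "r < 1" and s: "0 < s" "s < 1"
  shows "integral {0..2*pi} (\<lambda>t. (norm (of_real s * cis t * F (of_real s * cis t) - of_real r * cis t * F (of_real r * cis t)))\<^sup>2)
     \<le> 2 * pi * (defect r + defect s)"
proof -
  define d where "d n = c n * of_real (s ^ Suc n - r ^ Suc n)" for n
  have sm: "summable (\<lambda>n. norm (c n * of_real x ^ n))" if "0 < x" "x < 1" for x
  proof -
    define q where "q = (1 + x) / 2"
    have q: "0 < q" "q < 1" "x < q" using that by (auto simp: q_def)
    have "summable (\<lambda>n. c n * of_real q ^ n)" using F[of "of_real q"] q by (auto simp: sums_iff)
    from powser_insidea[OF this, of "of_real x"] show ?thesis using that q by simp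
  qed
  have sd: "summable (\<lambda>n. norm (d n))"
  proof (rule summable_comparison_test')
    show "summable (\<lambda>n. norm (c n * of_real s ^ n) + norm (c n * of_real r ^ n))" by (intro summable_add sm r s)
    fix n
    have "norm (d n) = norm (of_real s * (c n * of_real s ^ n) - of_real r * (c n * of_real r ^ n))"
      by (simp add: d_def algebra_simps)
    also have "\<dots> \<le> norm (of_real s * (c n * of_real s ^ n)) + norm (of_real r * (c n * of_real r ^ n))"
      by (rule norm_triangle_ineq4)
    also have "\<dots> \<le> norm (c n * of_real s ^ n) + norm (c n * of_real r ^ n)"
      unfolding norm_mult[of "of_real _"] using r s by (intro add_mono mult_left_le_one_le) auto
    finally show "norm (norm (d n)) \<le> norm (c n * of_real s ^ n) + norm (c n * of_real r ^ n)" by simp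
  qed
  have eq: "norm (of_real s * cis t * F (of_real s * cis t) - of_real r * cis t * F (of_real r * cis t)) = norm (\<Sum>n. d n * cis t ^ n)" for t
  proof -
    have F': "(\<lambda>n. c n * (of_real x * cis t) ^ n) sums F (of_real x * cis t)" if "0 < x" "x < 1" for x
      using that by (intro F) (simp add: norm_mult)
    have "(\<lambda>n. of_real s * (c n * (of_real s * cis t) ^ n) - of_real r * (c n * (of_real r * cis t) ^ n)) sums
       (of_real s * F (of_real s * cis t) - of_real r * F (of_real r * cis t))"
      by (intro sums_diff sums_mult F' r s)
    hence "(\<lambda>n. d n * cis t ^ n) sums (of_real s * F (of_real s * cis t) - of_real r * F (of_real r * cis t))"
      by (simp add: d_def algebra_simps power_mult_distrib)
    hence "(\<Sum>n. d n * cis t ^ n) = of_real s * F (of_real s * cis t) - of_real r * F (of_real r * cis t)"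
      by (simp add: sums_iff)
    moreover have "of_real s * cis t * F (of_real s * cis t) - of_real r * cis t * F (of_real r * cis t)
      = cis t * (of_real s * F (of_real s * cis t) - of_real r * F (of_real r * cis t))" by (simp add: algebra_simps)
    ultimately show ?thesis by (simp add: norm_mult)
  qed
  have P: "(\<lambda>n. (norm (d n))\<^sup>2) sums (1 / (2*pi) * integral {0..2*pi} (\<lambda>t. (norm (\<Sum>n. d n * cis t ^ n))\<^sup>2))"
    by (rule Parseval[OF sd])
  have le: "(norm (d n))\<^sup>2 \<le> (norm (c n))\<^sup>2 * (1 - r ^ Suc n)\<^sup>2 + (norm (c n))\<^sup>2 * (1 - s ^ Suc n)\<^sup>2" for n
  proof -
    have b: "0 \<le> x ^ Suc n" "x ^ Suc n \<le> 1" if "0 < x" "x < 1" for x :: real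
      using that by (auto intro: power_le_one simp del: power_Suc)
    \<comment> \<open>Both powers lie in [0,1], so their gap is at most the larger of their
      distances to 1.\<close>
    have "\<bar>s ^ Suc n - r ^ Suc n\<bar> \<le> (1 - r ^ Suc n) \<or> \<bar>s ^ Suc n - r ^ Suc n\<bar> \<le> (1 - s ^ Suc n)"
      using b[OF r] b[OF s] by linarith
    hence "(s ^ Suc n - r ^ Suc n)\<^sup>2 \<le> (1 - r ^ Suc n)\<^sup>2 \<or> (s ^ Suc n - r ^ Suc n)\<^sup>2 \<le> (1 - s ^ Suc n)\<^sup>2"
      using power_mono[of "\<bar>s ^ Suc n - r ^ Suc n\<bar>" _ 2] by (metis abs_ge_zero power2_abs)
    hence "(s ^ Suc n - r ^ Suc n)\<^sup>2 \<le> (1 - r ^ Suc n)\<^sup>2 + (1 - s ^ Suc n)\<^sup>2"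
      by (metis add.commute add_increasing2 zero_le_power2)
    hence "(norm (c n))\<^sup>2 * (s ^ Suc n - r ^ Suc n)\<^sup>2 \<le> (norm (c n))\<^sup>2 * ((1 - r ^ Suc n)\<^sup>2 + (1 - s ^ Suc n)\<^sup>2)"
      by (rule mult_left_mono) simp
    moreover have "(norm (d n))\<^sup>2 = (norm (c n))\<^sup>2 * (s ^ Suc n - r ^ Suc n)\<^sup>2"
      unfolding d_def norm_mult norm_of_real power_mult_distrib power2_abs ..
    ultimately show ?thesis by (simp only: distrib_left)
  qed
  have "(\<Sum>n. (norm (d n))\<^sup>2) \<le> (\<Sum>n. (norm (c n))\<^sup>2 * (1 - r ^ Suc n)\<^sup>2 + (norm (c n))\<^sup>2 * (1 - s ^ Suc n)\<^sup>2)"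
    by (rule suminf_le[OF le sums_summable[OF P]]) (intro summable_add defect_summable; use r s in simp)
  also have "\<dots> = defect r + defect s"
    unfolding defect_def using r s by (intro suminf_add[symmetric] defect_summable) auto
  finally have "1 / (2*pi) * integral {0..2*pi} (\<lambda>t. (norm (\<Sum>n. d n * cis t ^ n))\<^sup>2) \<le> defect r + defect s"
    unfolding sums_unique[OF P, symmetric] .
  thus ?thesis unfolding eq by (simp add: field_simps)
qed

end

section \<open>Absolute continuity and differentiation of the primitive on the circle\<close>

lemma has_vector_derivative_cis: "(cis has_vector_derivative \<i> * cis t) (at t within S)"
proof -
  have "((\<lambda>z. exp (\<i> * z)) has_field_derivative \<i> * exp (\<i> * of_real t)) (at (of_real t))"
    by (auto intro!: derivative_eq_intros)
  from has_vector_derivative_real_field[OF this, of S] show ?thesis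
    by (simp add: cis_conv_exp[abs_def])
qed

text \<open>The density g is the L1 limit of the angular derivatives of the primitive along radii
  r_k tending to 1; continuity of the primitive up to the circle identifies its integrals.\<close>

lemma boundary_density:
  fixes c :: "nat \<Rightarrow> complex" and F :: "complex \<Rightarrow> complex"
  assumes c2: "summable (\<lambda>n. (norm (c n))\<^sup>2)"
    and F: "\<And>z. norm z < 1 \<Longrightarrow> (\<lambda>n. c n * z ^ n) sums F z"
    and hol: "F holomorphic_on ball 0 1"
  obtains g where "\<And>x y. 0 \<le> x \<Longrightarrow> x \<le> y \<Longrightarrow> y \<le> 2*pi \<Longrightarrow> g integrable_on {x..y}"
    "\<And>x y. 0 \<le> x \<Longrightarrow> x \<le> y \<Longrightarrow> y \<le> 2*pi \<Longrightarrow> integral {x..y} g = prim c (cis y) - prim c (cis x)"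
proof -
  \<comment> \<open>A squared distance of order 16^-k makes the L1 increments of order 4^-k, hence
    summable; the lower bound on r forces the radii to 1.\<close>
  have "\<exists>r. 0 < r \<and> r < 1 \<and> 1 - 1 / real (Suc k) < r \<and> defect c r < (1/16) ^ k" for k
  proof -
    have "eventually (\<lambda>r. defect c r < (1/16) ^ k) (at_left 1)"
      by (rule order_tendstoD(2)[OF defect_tendsto[OF c2 F]]) (assumption, simp add: zero_less_power)
    moreover have "eventually (\<lambda>r::real. r \<in> {1 - 1 / real (Suc k)<..<1}) (at_left 1)"
      by (rule eventually_at_left_real) simp
    ultimately have "eventually (\<lambda>r. 0 < r \<and> r < 1 \<and> 1 - 1 / real (Suc k) < r \<and> defect c r < (1/16) ^ k) (at_left 1)"
      using eventually_at_left_1 by eventually_elim auto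
    thus ?thesis using eventually_happens'[OF trivial_limit_at_left_real] by blast
  qed
  then obtain r where r: "\<And>k. 0 < r k" "\<And>k. r k < 1" "\<And>k. 1 - 1 / real (Suc k) < r k" "\<And>k. defect c (r k) < (1/16) ^ k"
    by metis
  have r1: "r \<longlonglongrightarrow> 1"
  proof (rule tendsto_sandwich)
    show "(\<lambda>k. 1 - 1 / real (Suc k)) \<longlonglongrightarrow> 1"
      using tendsto_diff[OF tendsto_const LIMSEQ_inverse_real_of_nat, of 1] by (simp add: inverse_eq_divide)
    show "(\<lambda>k. 1) \<longlonglongrightarrow> (1::real)" by simp
    show "\<forall>\<^sub>F k in sequentially. 1 - 1 / real (Suc k) \<le> r k" "\<forall>\<^sub>F k in sequentially. r k \<le> 1"
      by (intro always_eventually allI less_imp_le r)+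
  qed
  define f where "f k t = \<i> * (of_real (r k) * cis t * F (of_real (r k) * cis t))" for k t
  have contF: "continuous_on (ball 0 1) F" using hol by (rule holomorphic_on_imp_continuous_on)
  have contf: "continuous_on S (f k)" for k S
    unfolding f_def[abs_def] using r[of k]
    by (intro continuous_intros continuous_on_circle[OF contF]) auto
  have int_f: "integral {x..y} (f k) = prim c (of_real (r k) * cis y) - prim c (of_real (r k) * cis x)" if "x \<le> y" for k x y
  proof (rule integral_unique, rule fundamental_theorem_of_calculus[OF that])
    fix t assume "t \<in> {x..y}"
    have "norm (of_real (r k) * cis t) < 1" using r[of k] by simp
    from prim_deriv[OF c2 F this] have 1: "(prim c has_field_derivative F (of_real (r k) * cis t)) (at (of_real (r k) * cis t))" .
    have "((\<lambda>t. of_real (r k) * cis t) has_vector_derivative (of_real (r k) * (\<i> * cis t))) (at t within {x..y})"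
      by (intro has_vector_derivative_mult_right has_vector_derivative_cis)
    from field_vector_diff_chain_within[OF this has_field_derivative_at_within[OF 1]]
    show "((\<lambda>t. prim c (of_real (r k) * cis t)) has_vector_derivative f k t) (at t within {x..y})"
      by (simp add: o_def f_def mult_ac)
  qed
  define D where "D k t = norm (f (Suc k) t - f k t)" for k t
  have contD: "continuous_on S (D k)" for k S unfolding D_def[abs_def] by (intro continuous_intros contf)
  have intD: "D k integrable_on {x..y}" for k x y by (intro integrable_continuous_real contD)
  have Dle: "integral {0..2*pi} (D k) \<le> 3 * pi * (1/4) ^ k" for k
  proof -
    \<comment> \<open>D <= e/2 + D^2/(2e) serves as the Cauchy-Schwarz inequality; e = 4^-k balances
      the squared distance 16^-k.\<close>
    let ?e = "(1/4) ^ k :: real"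
    have "integral {0..2*pi} (D k) \<le> integral {0..2*pi} (\<lambda>t. ?e / 2 + (D k t)\<^sup>2 * (1 / (2 * ?e)))"
    proof (rule integral_le[OF intD])
      show "(\<lambda>t. ?e / 2 + (D k t)\<^sup>2 * (1 / (2 * ?e))) integrable_on {0..2*pi}"
        by (intro integrable_continuous_real continuous_intros contD)
      fix t
      have "0 \<le> (D k t - ?e)\<^sup>2 * (1 / (2 * ?e))" by simp
      also have "(D k t - ?e)\<^sup>2 * (1 / (2 * ?e)) = ?e / 2 + (D k t)\<^sup>2 * (1 / (2 * ?e)) - D k t"
        by (simp add: power2_diff power2_eq_square field_simps)
      finally show "D k t \<le> ?e / 2 + (D k t)\<^sup>2 * (1 / (2 * ?e))" by simp
    qed
    also have "\<dots> = pi * ?e + integral {0..2*pi} (\<lambda>t. (D k t)\<^sup>2) * (1 / (2 * ?e))"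
      by (subst Henstock_Kurzweil_Integration.integral_add)
        (auto intro!: integrable_continuous_real continuous_intros contD)
    also have "integral {0..2*pi} (\<lambda>t. (D k t)\<^sup>2) \<le> 2 * pi * (defect c (r k) + defect c (r (Suc k)))"
    proof -
      have "D k t = norm (of_real (r (Suc k)) * cis t * F (of_real (r (Suc k)) * cis t) - of_real (r k) * cis t * F (of_real (r k) * cis t))" for t
        unfolding D_def f_def by (simp flip: right_diff_distrib add: norm_mult)
      thus ?thesis using integral_square_diff[OF c2 F r(1,2)[of k] r(1,2)[of "Suc k"]] by simp
    qed
    also have "2 * pi * (defect c (r k) + defect c (r (Suc k))) \<le> 2 * pi * (2 * (1/16) ^ k)"
    proof (rule mult_left_mono)
      have "(1/16) ^ Suc k \<le> ((1/16) ^ k :: real)" by (rule power_decreasing) auto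
      thus "defect c (r k) + defect c (r (Suc k)) \<le> 2 * (1/16) ^ k" using r(4)[of k] r(4)[of "Suc k"] by linarith
    qed simp
    also have "pi * ?e + 2 * pi * (2 * (1/16) ^ k) * (1 / (2 * ?e)) = 3 * pi * ?e"
    proof -
      have "(1/16::real) ^ k = ?e * ?e" by (simp flip: power_mult_distrib)
      thus ?thesis by (simp add: field_simps)
    qed
    finally show ?thesis by (simp add: mult_right_mono divide_right_mono)
  qed
  define g where "g t = f 0 t + (\<Sum>k. f (Suc k) t - f k t)" for t
  have main: "g integrable_on {x..y}" "(\<lambda>k. integral {x..y} (f k)) \<longlonglongrightarrow> integral {x..y} g"
    if "0 \<le> x" "x \<le> y" "y \<le> 2*pi" for x y
  proof -
    have "summable (\<lambda>k. integral {x..y} (\<lambda>t. norm (f (Suc k) t - f k t)))"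
    proof (rule summable_comparison_test')
      show "summable (\<lambda>k. 3 * pi * (1/4) ^ k)" by (intro summable_mult summable_geometric) simp
      fix k
      have "integral {x..y} (D k) \<le> integral {0..2*pi} (D k)"
        by (rule integral_subset_le) (use that intD in \<open>auto simp: D_def\<close>)
      moreover have "integral {x..y} (D k) \<ge> 0" by (rule integral_nonneg[OF intD]) (simp add: D_def)
      ultimately show "norm (integral {x..y} (\<lambda>t. norm (f (Suc k) t - f k t))) \<le> 3 * pi * (1/4) ^ k"
        using Dle[of k] unfolding D_def[abs_def] by simp
    qed
    from L1_summable_increments[OF contf this]
    show "g integrable_on {x..y}" "(\<lambda>k. integral {x..y} (f k)) \<longlonglongrightarrow> integral {x..y} g"
      unfolding g_def[abs_def] by auto
  qed
  have lim: "(\<lambda>k. prim c (of_real (r k) * cis t)) \<longlonglongrightarrow> prim c (cis t)" for t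
  proof (rule continuous_on_tendsto_compose[OF continuous_prim[OF c2 F]])
    have "(\<lambda>k. complex_of_real (r k) * cis t) \<longlonglongrightarrow> of_real 1 * cis t" by (intro tendsto_intros r1)
    thus "(\<lambda>k. complex_of_real (r k) * cis t) \<longlonglongrightarrow> cis t" by simp
    have "\<bar>r k\<bar> \<le> 1" for k using r(1,2)[of k] by simp
    thus "\<forall>\<^sub>F k in sequentially. complex_of_real (r k) * cis t \<in> cball 0 1"
      by (intro always_eventually) simp
    show "cis t \<in> cball 0 1" unfolding mem_cball_0 by simp
  qed
  have "integral {x..y} g = prim c (cis y) - prim c (cis x)" if "0 \<le> x" "x \<le> y" "y \<le> 2*pi" for x y
  proof (rule LIMSEQ_unique[OF main(2)[OF that]])
    show "(\<lambda>k. integral {x..y} (f k)) \<longlonglongrightarrow> prim c (cis y) - prim c (cis x)"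
      unfolding int_f[OF that(2)] by (intro tendsto_diff lim)
  qed
  with main(1) that show ?thesis by blast
qed

lemma lebesgue_differentiation_interval:
  fixes g h :: "real \<Rightarrow> complex"
  assumes "\<And>x y. a \<le> x \<Longrightarrow> x \<le> y \<Longrightarrow> y \<le> b \<Longrightarrow> g integrable_on {x..y}"
    and "\<And>x y. a \<le> x \<Longrightarrow> x \<le> y \<Longrightarrow> y \<le> b \<Longrightarrow> integral {x..y} g = h y - h x"
  obtains N where "negligible N" "\<And>x. a < x \<Longrightarrow> x < b \<Longrightarrow> x \<notin> N \<Longrightarrow> (h has_vector_derivative g x) (at x)"
proof -
  \<comment> \<open>The extension by 0 makes the function integrable over every interval, as the
    differentiation theorem asks.\<close>
  define k where "k t = (if t \<in> {a..b} then g t else 0)" for t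
  have kint: "k integrable_on {x..y}" for x y
  proof -
    have "g integrable_on ({a..b} \<inter> {x..y})"
    proof (cases "max a x \<le> min b y")
      case True
      thus ?thesis using assms(1)[of "max a x" "min b y"] by (simp add: Int_atLeastAtMost)
    next
      case False
      hence "{a..b} \<inter> {x..y} = {}" by auto
      thus ?thesis by (simp only: integrable_on_empty)
    qed
    thus ?thesis unfolding k_def[abs_def] integrable_restrict_Int .
  qed
  have keq: "integral {x..y} k = h y - h x" if "a \<le> x" "x \<le> y" "y \<le> b" for x y
  proof -
    have "integral {x..y} k = integral {x..y} g"
      by (rule integral_cong) (use that in \<open>auto simp: k_def\<close>)
    thus ?thesis using assms(2)[OF that] by simp
  qed
  \<comment> \<open>The differentiation theorem averages over intervals to the right of a point; the
    reflected function supplies the left-hand averages.\<close>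
  have k'int: "(\<lambda>t. k (- t)) integrable_on {x..y}" for x y
    using kint[of "-y" "-x"] Henstock_Kurzweil_Integration.integrable_reflect_real[where f = k and a = "-y" and b = "-x"] by simp
  obtain N1 where N1: "negligible N1" "\<And>x e. \<lbrakk>x \<notin> N1; 0 < e\<rbrakk> \<Longrightarrow>
      \<exists>d>0. \<forall>h. 0 < h \<and> h < d \<longrightarrow> norm (integral (cbox x (x + h *\<^sub>R One)) k /\<^sub>R h ^ DIM(real) - k x) < e"
    using integrable_ccontinuous_explicit[of k] kint by (metis box_real(2))
  obtain N2 where N2: "negligible N2" "\<And>x e. \<lbrakk>x \<notin> N2; 0 < e\<rbrakk> \<Longrightarrow>
      \<exists>d>0. \<forall>h. 0 < h \<and> h < d \<longrightarrow> norm (integral (cbox x (x + h *\<^sub>R One)) (\<lambda>t. k (- t)) /\<^sub>R h ^ DIM(real) - k (- x)) < e"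
    using integrable_ccontinuous_explicit[of "\<lambda>t. k (- t)"] k'int by (metis box_real(2))
  have "negligible (uminus ` N2)"
    by (rule negligible_differentiable_image_negligible[OF _ N2(1)]) (auto intro!: derivative_intros)
  hence "negligible (N1 \<union> uminus ` N2)" using N1(1) by simp
  moreover have "(h has_vector_derivative g x) (at x)" if x: "a < x" "x < b" "x \<notin> N1 \<union> uminus ` N2" for x
    unfolding has_vector_derivative_def has_derivative_at_alt
  proof (intro conjI allI impI)
    show "bounded_linear (\<lambda>t. t *\<^sub>R g x)" by (rule bounded_linear_scaleR_left)
    fix e :: real assume e: "e > 0"
    have kx: "k x = g x" using x by (simp add: k_def)
    have "x \<notin> N1" "- x \<notin> N2" using x(3) by force+
    obtain d1 where d1: "d1 > 0" "\<And>t. 0 < t \<Longrightarrow> t < d1 \<Longrightarrow> norm (integral {x..x + t} k /\<^sub>R t - g x) < e"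
      using N1(2)[OF \<open>x \<notin> N1\<close> e] by (auto simp: kx)
    obtain d2 where d2: "d2 > 0" "\<And>t. 0 < t \<Longrightarrow> t < d2 \<Longrightarrow> norm (integral {- x..- x + t} (\<lambda>t. k (- t)) /\<^sub>R t - g x) < e"
      using N2(2)[OF \<open>- x \<notin> N2\<close> e] by (auto simp: kx)
    define d where "d = min (min d1 d2) (min (b - x) (x - a))"
    have "d > 0" using d1 d2 x by (simp add: d_def)
    moreover have "norm (h y - h x - (y - x) *\<^sub>R g x) \<le> e * norm (y - x)" if y: "norm (y - x) < d" for y
    proof -
      consider "y = x" | "y > x" | "y < x" by linarith
      thus ?thesis
      proof cases
        case 2
        define t where "t = y - x"
        have t: "0 < t" "t < d1" "x + t \<le> b" using 2 y by (auto simp: t_def d_def)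
        have "norm (integral {x..x + t} k /\<^sub>R t - g x) < e" by (rule d1(2)[OF t(1,2)])
        also have "integral {x..x + t} k = h y - h x" using keq[of x "x + t"] x t by (simp add: t_def)
        finally have "norm ((h y - h x) /\<^sub>R t - g x) * t \<le> e * t" using t by (intro mult_right_mono) auto
        moreover have "h y - h x - t *\<^sub>R g x = t *\<^sub>R ((h y - h x) /\<^sub>R t - g x)"
          using t by (simp add: scaleR_right_diff_distrib)
        ultimately show ?thesis using t by (simp add: t_def mult.commute)
      next
        case 3
        define t where "t = x - y"
        have t: "0 < t" "t < d2" "a \<le> y" using 3 y by (auto simp: t_def d_def)
        have "norm (integral {- x..- x + t} (\<lambda>t. k (- t)) /\<^sub>R t - g x) < e" by (rule d2(2)[OF t(1,2)])
        also have "integral {- x..- x + t} (\<lambda>t. k (- t)) = integral {y..x} k"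
          using Henstock_Kurzweil_Integration.integral_reflect_real[where f = k and a = y and b = x] by (simp add: t_def)
        also have "integral {y..x} k = h x - h y" using keq[of y x] x t 3 by simp
        finally have "norm ((h x - h y) /\<^sub>R t - g x) * t \<le> e * t" using t by (intro mult_right_mono) auto
        moreover have "h y - h x - (y - x) *\<^sub>R g x = - (t *\<^sub>R ((h x - h y) /\<^sub>R t - g x))"
          using t by (simp add: scaleR_right_diff_distrib t_def scaleR_left_diff_distrib)
        ultimately have "norm (h y - h x - (y - x) *\<^sub>R g x) \<le> e * t"
          using t by (simp add: mult.commute)
        thus ?thesis using 3 by (simp add: t_def)
      qed (use e in simp)
    qed
    ultimately show "\<exists>d>0. \<forall>y. norm (y - x) < d \<longrightarrow> norm (h y - h x - (y - x) *\<^sub>R g x) \<le> e * norm (y - x)" by blast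
  qed
  ultimately show ?thesis using that by blast
qed

section \<open>Chords and kernel estimates on the circle\<close>

lemma abs_le_chord: assumes "\<bar>x\<bar> \<le> pi" shows "\<bar>x\<bar> \<le> 2 * norm (cis x - 1)"
proof -
  \<comment> \<open>The chord is 2 |sin(x/2)| = 2 |sin(2v)|. With |tan v| >= |v| and cos(v)^2 >=
    1/2, the double angle formula gives |sin(2v)| >= |v|.\<close>
  define v where "v = x / 4"
  have "\<bar>x\<bar> < 2 * pi" using le_less_trans[OF assms, of "2 * pi"] pi_gt_zero by simp
  hence v: "\<bar>v\<bar> < pi / 2" by (simp add: v_def)
  have c0: "cos v > 0" by (rule cos_gt_zero_pi) (use v in auto)
  have "\<bar>v\<bar> * cos v \<le> \<bar>tan v\<bar> * cos v" using abs_tan_ge[OF v] c0 by (intro mult_right_mono) auto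
  also have "\<bar>tan v\<bar> * cos v = \<bar>sin v\<bar>" using c0 by (simp add: tan_def abs_mult)
  finally have s: "\<bar>v\<bar> * cos v \<le> \<bar>sin v\<bar>" .
  have "0 \<le> cos (2 * v)" by (rule cos_ge_zero) (use assms in \<open>auto simp: v_def\<close>)
  hence c2: "(cos v)\<^sup>2 \<ge> 1 / 2" by (simp add: cos_double_cos)
  have "\<bar>v\<bar> \<le> 2 * (\<bar>v\<bar> * (cos v)\<^sup>2)" using mult_left_mono[OF c2, of "\<bar>v\<bar>"] by simp
  also have "\<dots> = 2 * (\<bar>v\<bar> * cos v) * cos v" by (simp add: power2_eq_square)
  also have "\<dots> \<le> 2 * \<bar>sin v\<bar> * cos v" using s c0 by (intro mult_right_mono) auto
  also have "\<dots> = \<bar>sin (2 * v)\<bar>" using c0 by (simp add: sin_double abs_mult)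
  also have "2 * \<dots> = norm (cis x - 1)"
    using dist_exp_i_1[of x] by (simp add: cis_conv_exp v_def)
  finally show ?thesis by (simp add: v_def)
qed

lemma abs_diff_le_chord: assumes "\<bar>s - t\<bar> \<le> pi" shows "\<bar>s - t\<bar> \<le> 2 * norm (cis s - cis t)"
proof -
  have "cis s - cis t = cis t * (cis (s - t) - 1)" by (simp add: algebra_simps cis_mult)
  thus ?thesis using abs_le_chord[OF assms] by (simp add: norm_mult)
qed

text \<open>The kernel below is the tangential derivative of the Poisson kernel; unlike the kernel of Cauchy's formula for
  the derivative alone, it is integrable against a function vanishing to first order at a boundary point,
  uniformly up to the boundary.\<close>
lemma boundary_kernel_norm:
  assumes w: "norm w = 1" and z: "norm z < 1"
  shows "norm (z * (w / (w - z)\<^sup>2) - w * cnj z / (1 - w * cnj z)\<^sup>2) \<le> 2 * (1 - (norm z)\<^sup>2) / norm (w - z) ^ 3"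
proof -
  define a where "a = w - z"
  define b where "b = 1 - w * cnj z"
  have ww: "w * cnj w = 1" using w by (simp add: complex_norm_square[symmetric])
  have a0: "a \<noteq> 0" using w z by (auto simp: a_def)
  have b: "b = w * cnj a" using ww by (simp add: a_def b_def algebra_simps)
  have nb: "norm b = norm a" using w by (simp add: b norm_mult)
  have b0: "b \<noteq> 0" using a0 nb by auto
  have zz: "z * cnj z = of_real ((norm z)\<^sup>2)" by (simp only: complex_norm_square)
  \<comment> \<open>The numerator factors so that 1 - |z|^2 appears; the other factor is at most 2
    |w - z|, which lowers the fourth power in the denominator to the third.\<close>
  have n1: "z * b\<^sup>2 - cnj z * a\<^sup>2 = (1 - z * cnj z) * (z - w\<^sup>2 * cnj z)"
    by (simp add: a_def b_def power2_eq_square algebra_simps)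
  have n2: "z - w\<^sup>2 * cnj z = w * (w * cnj a - cnj w * a)"
  proof -
    have "w * (w * cnj a - cnj w * a) = w * ((w * cnj w) - w * cnj z) - (w * cnj w) * (w - z)"
      by (simp add: a_def algebra_simps)
    thus ?thesis by (simp add: ww algebra_simps power2_eq_square)
  qed
  have num: "norm (z * b\<^sup>2 - cnj z * a\<^sup>2) = (1 - (norm z)\<^sup>2) * norm (w * cnj a - cnj w * a)"
  proof -
    have "1 - z * cnj z = of_real (1 - (norm z)\<^sup>2)" by (simp only: zz of_real_diff of_real_1)
    hence "norm (1 - z * cnj z) = 1 - (norm z)\<^sup>2"
      using z by (simp only: norm_of_real) (simp add: power_le_one abs_of_nonneg)
    thus ?thesis unfolding n1 n2 using w by (simp add: norm_mult)
  qed
  have "z * (w / a\<^sup>2) - w * cnj z / b\<^sup>2 = w * (z * b\<^sup>2 - cnj z * a\<^sup>2) / (a\<^sup>2 * b\<^sup>2)"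
    using a0 b0 by (simp add: field_simps)
  hence "norm (z * (w / a\<^sup>2) - w * cnj z / b\<^sup>2) = norm (z * b\<^sup>2 - cnj z * a\<^sup>2) / norm a ^ 4"
    using w by (simp add: norm_mult norm_divide norm_power nb power_add[symmetric])
  also have "\<dots> = (1 - (norm z)\<^sup>2) * norm (w * cnj a - cnj w * a) / norm a ^ 4" by (simp add: num)
  also have "\<dots> \<le> (1 - (norm z)\<^sup>2) * (2 * norm a) / norm a ^ 4"
  proof (intro divide_right_mono mult_left_mono)
    have "norm (w * cnj a - cnj w * a) \<le> norm (w * cnj a) + norm (cnj w * a)" by (rule norm_triangle_ineq4)
    thus "norm (w * cnj a - cnj w * a) \<le> 2 * norm a" using w by (simp add: norm_mult)
    show "0 \<le> 1 - (norm z)\<^sup>2" using z by (simp add: power_le_one)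
  qed simp
  also have "\<dots> = 2 * (1 - (norm z)\<^sup>2) / norm a ^ 3" using a0 by (simp add: field_simps eval_nat_numeral)
  finally show ?thesis by (simp add: a_def b_def)
qed

lemma one_minus_mult_cnj_nonzero:
  assumes "norm z < 1" "norm w \<le> 1" shows "1 - w * cnj z \<noteq> 0"
proof
  assume "1 - w * cnj z = 0"
  hence "norm (w * cnj z) = 1" by (metis eq_iff_diff_eq_0 norm_one)
  moreover have "norm w * norm z \<le> 1 * norm z" using assms by (intro mult_right_mono) auto
  ultimately show False using assms by (simp add: norm_mult)
qed

text \<open>The Poisson kernel is the real part on the circle of a function holomorphic in w, whose
  mean is its value 1 at w = 0.\<close>

lemma Poisson_mean:
  assumes z: "norm z < 1"
  shows "integral {0..2*pi} (\<lambda>t. (1 - (norm z)\<^sup>2) / (norm (cis t - z))\<^sup>2) = 2 * pi"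
proof -
  define G where "G w = (1 + w * cnj z) / (1 - w * cnj z)" for w
  note nz = one_minus_mult_cnj_nonzero[OF z]
  have "circ_mean 1 G = G 0"
    by (rule circ_mean_Cauchy) (use nz in \<open>auto simp: G_def[abs_def] intro!: continuous_intros holomorphic_intros\<close>)
  hence i: "integral {0..2*pi} (\<lambda>t. G (cis t)) = of_real (2 * pi)"
    by (simp add: circ_mean_def G_def scaleR_conv_of_real field_simps)
  have cG: "continuous_on {0..2*pi} (\<lambda>t. G (cis t))"
    unfolding G_def by (intro continuous_intros) (use nz in auto)
  have "integral {0..2*pi} (\<lambda>t. Re (G (cis t))) = 2 * pi"
    using integral_linear[OF integrable_continuous_real[OF cG] bounded_linear_Re] i by (simp add: o_def)
  moreover have "Re (G (cis t)) = (1 - (norm z)\<^sup>2) / (norm (cis t - z))\<^sup>2" for t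
  proof -
    let ?w = "cis t"
    have n: "norm (1 - ?w * cnj z) = norm (?w - z)"
    proof -
      have "1 - ?w * cnj z = ?w * cnj (?w - z)" by (simp add: algebra_simps cis_cnj cis_mult)
      thus ?thesis by (simp only: norm_mult norm_cis complex_mod_cnj mult_1)
    qed
    have "G ?w = (1 + ?w * cnj z) * cnj (1 - ?w * cnj z) / of_real ((norm (1 - ?w * cnj z))\<^sup>2)"
    proof -
      have "cnj (1 - ?w * cnj z) \<noteq> 0" using nz[of ?w] by (metis complex_cnj_zero_iff norm_cis order_refl)
      thus ?thesis unfolding complex_norm_square G_def by (rule nonzero_mult_divide_mult_cancel_right[symmetric])
    qed
    hence "Re (G ?w) = Re ((1 + ?w * cnj z) * cnj (1 - ?w * cnj z)) / (norm (?w - z))\<^sup>2"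
      by (simp only: n Re_divide_of_real)
    also have "Re ((1 + ?w * cnj z) * cnj (1 - ?w * cnj z)) = 1 - (norm z)\<^sup>2"
    proof -
      have "(1 + ?w * cnj z) * cnj (1 - ?w * cnj z) = 1 - of_real ((norm (?w * cnj z))\<^sup>2) + (?w * cnj z - cnj (?w * cnj z))"
        unfolding complex_norm_square by (simp add: algebra_simps)
      thus ?thesis by (simp add: norm_mult del: of_real_power)
    qed
    finally show ?thesis .
  qed
  ultimately show ?thesis by simp
qed

text \<open>In the approach region |w - xi| <= (1 + alpha) |w - z|. The linear part of the modulus
  of continuity then leaves the Poisson kernel, of mean 1, and the cubic part cancels the third
  power in the kernel and leaves the small factor 1 - |z|^2.\<close>

lemma boundary_derivative_bound:
  assumes cont: "continuous_on (cball 0 1) H" and hol: "H holomorphic_on ball 0 1"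
    and \<xi>: "norm \<xi> = 1" and A: "A \<ge> 0" and B: "B \<ge> 0"
    and H: "\<And>w. norm w = 1 \<Longrightarrow> norm (H w - H \<xi>) \<le> A * norm (w - \<xi>) + B * norm (w - \<xi>) ^ 3"
    and z: "norm z < 1" and \<alpha>: "\<alpha> \<ge> 0" "norm (z - \<xi>) \<le> \<alpha> * (1 - norm z)"
  shows "norm z * norm (deriv H z) \<le> 2 * (1 + \<alpha>) * A + 2 * (1 + \<alpha>) ^ 3 * B * (1 - (norm z)\<^sup>2)"
proof -
  define G where "G w = H w - H \<xi>" for w
  have contG: "continuous_on (cball 0 1) G" and holG: "G holomorphic_on ball 0 1"
    unfolding G_def[abs_def] by (intro continuous_intros holomorphic_intros cont hol)+
  have zb: "z \<in> ball 0 1" using z by simp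
  have dG: "deriv G z = deriv H z"
  proof -
    have "(H has_field_derivative deriv H z) (at z)" by (rule holomorphic_derivI[OF hol _ zb]) simp
    hence "(G has_field_derivative deriv H z) (at z)"
      unfolding G_def[abs_def] by (auto intro!: derivative_eq_intros)
    thus ?thesis by (rule DERIV_imp_deriv)
  qed
  have wz: "w - z \<noteq> 0" if "norm w = 1" for w using that z by auto
  note nz = one_minus_mult_cnj_nonzero[OF z]
  note C = Cauchy_derivative_integral_circlepath[OF contG holG zb]
  have "contour_integral (circlepath 0 1) (\<lambda>u. G u / (u - z)\<^sup>2) = 2 * of_real pi * \<i> * deriv H z"
    using DERIV_imp_deriv[OF C(2)] by (simp add: dG field_simps)
  with C(1) have "((\<lambda>u. G u / (u - z)\<^sup>2) has_contour_integral (2 * of_real pi * \<i> * deriv H z)) (circlepath 0 1)"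
    by (metis has_contour_integral_integral)
  hence "((\<lambda>t. G (0 + of_real 1 * cis t) / (0 + of_real 1 * cis t - z)\<^sup>2 * of_real 1 * \<i> * cis t) has_integral (2 * of_real pi * \<i> * deriv H z)) {0..2*pi}"
    by (subst (asm) circlepath_def, subst (asm) has_contour_integral_part_circlepath_iff) auto
  hence "((\<lambda>t. (- \<i>) * (G (0 + of_real 1 * cis t) / (0 + of_real 1 * cis t - z)\<^sup>2 * of_real 1 * \<i> * cis t)) has_integral (- \<i>) * (2 * of_real pi * \<i> * deriv H z)) {0..2*pi}"
    by (rule has_integral_mult_right)
  hence 1: "((\<lambda>t. G (cis t) * (cis t / (cis t - z)\<^sup>2)) has_integral (2 * of_real pi * deriv H z)) {0..2*pi}"
    by (simp add: mult_ac)
  \<comment> \<open>The second half of the kernel is holomorphic in w and vanishes at w = 0, so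
    subtracting it does not change the integral.\<close>
  define E where "E w = G w * (w * cnj z / (1 - w * cnj z)\<^sup>2)" for w
  have "circ_mean 1 E = E 0"
    by (rule circ_mean_Cauchy)
      (use nz in \<open>auto simp: E_def[abs_def] intro!: continuous_intros holomorphic_intros contG holG\<close>)
  hence "integral {0..2*pi} (\<lambda>t. E (cis t)) = 0" by (simp add: circ_mean_def E_def)
  moreover have cE: "continuous_on {0..2*pi} (\<lambda>t. E (cis t))"
    unfolding E_def by (intro continuous_intros continuous_on_compose2[OF contG]) (use nz in auto)
  ultimately have 2: "((\<lambda>t. E (cis t)) has_integral 0) {0..2*pi}"
    using integrable_integral[OF integrable_continuous_real[OF cE]] by simp
  let ?\<kappa> = "\<lambda>w. z * (w / (w - z)\<^sup>2) - w * cnj z / (1 - w * cnj z)\<^sup>2"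
  have 3: "((\<lambda>t. G (cis t) * ?\<kappa> (cis t)) has_integral (z * (2 * of_real pi * deriv H z))) {0..2*pi}"
    using has_integral_diff[OF has_integral_mult_right[OF 1, of z] 2] by (simp add: E_def algebra_simps)
  let ?P = "\<lambda>t. (1 - (norm z)\<^sup>2) / (norm (cis t - z))\<^sup>2"
  let ?U = "\<lambda>t. 2 * (1 + \<alpha>) * A * ?P t + 2 * (1 + \<alpha>) ^ 3 * B * (1 - (norm z)\<^sup>2)"
  have cP: "continuous_on {0..2*pi} ?P" by (intro continuous_intros) (use wz in force)
  have le: "norm (G (cis t) * ?\<kappa> (cis t)) \<le> ?U t" for t
  proof -
    define w where "w = cis t"
    define a where "a = norm (w - z)"
    have w: "norm w = 1" by (simp add: w_def)
    have a: "a > 0" using wz[OF w] by (simp add: a_def)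
    have z1: "0 \<le> 1 - (norm z)\<^sup>2" using z by (simp add: power_le_one)
    have "1 - norm z \<le> a" using norm_triangle_ineq2[of w z] w by (simp add: a_def)
    hence "\<alpha> * (1 - norm z) \<le> \<alpha> * a" using \<alpha> by (intro mult_left_mono) auto
    moreover have "norm (w - \<xi>) \<le> a + norm (z - \<xi>)" unfolding a_def
      using norm_triangle_ineq[of "w - z" "z - \<xi>"] by simp
    ultimately have w\<xi>: "norm (w - \<xi>) \<le> (1 + \<alpha>) * a" using \<alpha> by (simp add: algebra_simps)
    have "norm (G w) \<le> A * norm (w - \<xi>) + B * norm (w - \<xi>) ^ 3" unfolding G_def by (rule H[OF w])
    also have "\<dots> \<le> A * ((1 + \<alpha>) * a) + B * ((1 + \<alpha>) * a) ^ 3"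
      using A B w\<xi> by (intro add_mono mult_left_mono power_mono) auto
    finally have "norm (G w) * norm (?\<kappa> w) \<le> (A * ((1 + \<alpha>) * a) + B * ((1 + \<alpha>) * a) ^ 3) * (2 * (1 - (norm z)\<^sup>2) / a ^ 3)"
      using boundary_kernel_norm[OF w z] a A B \<alpha> unfolding a_def by (intro mult_mono) auto
    also have "\<dots> = 2 * (1 + \<alpha>) * A * ((1 - (norm z)\<^sup>2) / a\<^sup>2) + 2 * (1 + \<alpha>) ^ 3 * B * (1 - (norm z)\<^sup>2)"
      using a by (simp add: field_simps power_mult_distrib eval_nat_numeral)
    finally show ?thesis by (simp add: norm_mult w_def a_def)
  qed
  have "norm (z * (2 * of_real pi * deriv H z)) \<le> integral {0..2*pi} ?U"
    unfolding integral_unique[OF 3, symmetric]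
  proof (rule integral_norm_bound_integral)
    show "(\<lambda>t. G (cis t) * ?\<kappa> (cis t)) integrable_on {0..2*pi}" using 3 by blast
    show "?U integrable_on {0..2*pi}"
      by (intro integrable_continuous_real continuous_on_add continuous_on_mult continuous_on_const cP)
  qed (rule le)
  also have "\<dots> = 2 * (1 + \<alpha>) * A * integral {0..2*pi} ?P + 2 * pi * (2 * (1 + \<alpha>) ^ 3 * B * (1 - (norm z)\<^sup>2))"
  proof -
    have "integral {0..2*pi} ?U = integral {0..2*pi} (\<lambda>t. 2 * (1 + \<alpha>) * A * ?P t) + integral {0..2*pi} (\<lambda>t. 2 * (1 + \<alpha>) ^ 3 * B * (1 - (norm z)\<^sup>2))"
      by (intro Henstock_Kurzweil_Integration.integral_add integrable_continuous_real continuous_on_mult continuous_on_const cP)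
    also have "integral {0..2*pi} (\<lambda>t. 2 * (1 + \<alpha>) * A * ?P t) = 2 * (1 + \<alpha>) * A * integral {0..2*pi} ?P"
      by (rule Henstock_Kurzweil_Integration.integral_mult_right)
    also have "integral {0..2*pi} (\<lambda>t. 2 * (1 + \<alpha>) ^ 3 * B * (1 - (norm z)\<^sup>2)) = 2 * pi * (2 * (1 + \<alpha>) ^ 3 * B * (1 - (norm z)\<^sup>2))"
      by simp
    finally show ?thesis .
  qed
  also have "integral {0..2*pi} ?P = 2 * pi" by (rule Poisson_mean[OF z])
  finally have "2 * pi * (norm z * norm (deriv H z)) \<le> 2 * pi * (2 * (1 + \<alpha>) * A + 2 * (1 + \<alpha>) ^ 3 * B * (1 - (norm z)\<^sup>2))"
    by (simp add: norm_mult algebra_simps)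
  thus ?thesis by (subst (asm) mult_le_cancel_left_pos) auto
qed

lemma circle_param:
  assumes "norm w = 1" obtains y where "w = cis y" "\<bar>y - t\<bar> \<le> pi"
proof
  let ?q = "w / cis t"
  have "rcis (norm ?q) (Arg ?q) = ?q" by (rule rcis_cmod_Arg)
  hence "cis (Arg ?q) = ?q" using assms by (simp add: norm_divide rcis_def)
  thus "w = cis (t + Arg ?q)" by (simp add: cis_mult[symmetric])
  show "\<bar>t + Arg ?q - t\<bar> \<le> pi" using Arg_bounded[of ?q] by (auto simp: abs_le_iff)
qed

text \<open>For points at angle at least d the chord is at least d/2, so the cubic term dominates
  2C; the constant 16 C / d^3 is chosen for that. For nearer points the local bound is converted
  from angle to chord.\<close>

lemma boundary_modulus_global:
  assumes d: "d > 0" and A: "A \<ge> 0"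
    and loc: "\<And>y. \<bar>y - t\<bar> < d \<Longrightarrow> norm (H (cis y) - H (cis t)) \<le> A / 2 * \<bar>y - t\<bar>"
    and C: "\<And>w. norm w = 1 \<Longrightarrow> norm (H w) \<le> C" and w: "norm w = 1"
  shows "norm (H w - H (cis t)) \<le> A * norm (w - cis t) + 16 * C / d ^ 3 * norm (w - cis t) ^ 3"
proof -
  have C0: "C \<ge> 0" using C[OF w] norm_ge_zero order_trans by blast
  obtain y where y: "w = cis y" "\<bar>y - t\<bar> \<le> pi" by (rule circle_param[OF w])
  have ch: "\<bar>y - t\<bar> \<le> 2 * norm (w - cis t)" using abs_diff_le_chord[OF y(2)] y(1) by simp
  show ?thesis
  proof (cases "\<bar>y - t\<bar> < d")
    case True
    have "norm (H w - H (cis t)) \<le> A / 2 * \<bar>y - t\<bar>" using loc[OF True] y(1) by simp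
    also have "\<dots> \<le> A / 2 * (2 * norm (w - cis t))" using ch A by (intro mult_left_mono) auto
    also have "\<dots> \<le> A * norm (w - cis t) + 16 * C / d ^ 3 * norm (w - cis t) ^ 3" using C0 d by simp
    finally show ?thesis .
  next
    case False
    hence "d / 2 \<le> norm (w - cis t)" using ch by simp
    hence "(d / 2) ^ 3 \<le> norm (w - cis t) ^ 3" using d by (intro power_mono) auto
    hence "16 * C / d ^ 3 * (d / 2) ^ 3 \<le> 16 * C / d ^ 3 * norm (w - cis t) ^ 3"
      using C0 d by (intro mult_left_mono) auto
    moreover have "16 * C / d ^ 3 * (d / 2) ^ 3 = 2 * C" using d by (simp add: power_divide)
    moreover have "norm (H w - H (cis t)) \<le> C + C"
      using C[OF w] C[of "cis t"] by (intro order_trans[OF norm_triangle_ineq4] add_mono) auto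
    moreover have "A * norm (w - cis t) \<ge> 0" using A by simp
    ultimately show ?thesis by linarith
  qed
qed

section \<open>Fatou's theorem and boundedness near a smaller arc\<close>

context
  fixes c :: "nat \<Rightarrow> complex" and F :: "complex \<Rightarrow> complex"
  assumes c2: "summable (\<lambda>n. (norm (c n))\<^sup>2)"
    and F: "\<And>z. norm z < 1 \<Longrightarrow> (\<lambda>n. c n * z ^ n) sums F z"
    and hol: "F holomorphic_on ball 0 1"
begin

lemma prim_holomorphic: "prim c holomorphic_on ball 0 1"
  unfolding holomorphic_on_def field_differentiable_def
  using prim_deriv[OF c2 F] has_field_derivative_at_within by (metis mem_ball_0)

lemma prim_bounded: obtains C where "\<And>w. norm w \<le> 1 \<Longrightarrow> norm (prim c w) \<le> C"
proof -
  have "bounded (prim c ` cball 0 1)"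
    by (intro compact_imp_bounded compact_continuous_image continuous_prim[OF c2 F]) auto
  thus ?thesis using that unfolding bounded_iff by (metis image_eqI mem_cball_0)
qed

theorem Fatou_nontangential:
  assumes h: "((\<lambda>t. prim c (cis t)) has_vector_derivative g) (at t)"
  shows "nontangential_limit F (cis t) (g / (\<i> * cis t))"
  unfolding nontangential_limit_def
proof (intro allI impI)
  fix \<alpha> :: real assume \<alpha>: "\<alpha> > 1"
  define D where "D = g / (\<i> * cis t)"
  \<comment> \<open>Subtracting D w makes the tangential derivative at t vanish, so the local
    Lipschitz constant A/2 can be taken arbitrarily small; the derivative of H is F - D.\<close>
  define H where "H w = prim c w - D * w" for w
  have contH: "continuous_on (cball 0 1) H"
    unfolding H_def[abs_def] by (intro continuous_intros continuous_prim[OF c2 F])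
  have holH: "H holomorphic_on ball 0 1"
    unfolding H_def[abs_def] by (intro holomorphic_intros prim_holomorphic)
  have dH: "deriv H z = F z - D" if "norm z < 1" for z
    by (rule DERIV_imp_deriv, unfold H_def[abs_def]) (auto intro!: derivative_eq_intros prim_deriv[OF c2 F] that)
  obtain C0 where C0: "\<And>w. norm w \<le> 1 \<Longrightarrow> norm (prim c w) \<le> C0" using prim_bounded by blast
  define C where "C = C0 + norm D"
  have C: "norm (H w) \<le> C" if "norm w = 1" for w
    unfolding H_def C_def using C0[of w] that
    by (intro order_trans[OF norm_triangle_ineq4] add_mono) (auto simp: norm_mult)
  have Cn: "C \<ge> 0" using C[of 1] norm_ge_zero order_trans by (metis norm_one)
  have "((\<lambda>t. H (cis t)) has_vector_derivative (g - D * (\<i> * cis t))) (at t)"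
    unfolding H_def by (intro has_vector_derivative_diff h has_vector_derivative_mult_right has_vector_derivative_cis)
  moreover have "g - D * (\<i> * cis t) = 0" by (simp add: D_def)
  ultimately have d0: "((\<lambda>t. H (cis t)) has_vector_derivative 0) (at t)" by simp
  show "(F \<longlongrightarrow> g / (\<i> * cis t)) (at (cis t) within stolz_region (cis t) \<alpha>)"
    unfolding D_def[symmetric] Lim_within
  proof (intro allI impI)
    fix e :: real assume e: "e > 0"
    \<comment> \<open>With this A the linear term is e/8, and dividing by |z| > 1/2 leaves e/4; the
      radius d' below makes the cubic term at most e/2.\<close>
    define A where "A = e / (16 * (1 + \<alpha>))"
    have A: "A > 0" using e \<alpha> by (simp add: A_def)
    obtain d where d: "d > 0" "\<And>y. \<bar>y - t\<bar> < d \<Longrightarrow> norm (H (cis y) - H (cis t)) \<le> A / 2 * \<bar>y - t\<bar>"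
    proof -
      have "\<forall>e>0. \<exists>d>0. \<forall>y. norm (y - t) < d \<longrightarrow> norm (H (cis y) - H (cis t) - (y - t) *\<^sub>R 0) \<le> e * norm (y - t)"
        using d0 unfolding has_vector_derivative_def has_derivative_at_alt by (rule conjunct2)
      from this[rule_format, OF half_gt_zero[OF A]] show ?thesis using that by (auto simp: real_norm_def)
    qed
    define B where "B = 16 * C / d ^ 3"
    have B: "B \<ge> 0" using Cn d by (simp add: B_def)
    define K where "K = 8 * (1 + \<alpha>) ^ 3 * B"
    have K: "K \<ge> 0" using B \<alpha> by (simp add: K_def)
    define d' where "d' = min (1/2) (e / (2 * (K + 1)))"
    have "d' > 0" using e K by (simp add: d'_def)
    moreover have "dist (F z) D < e" if z: "z \<in> stolz_region (cis t) \<alpha>" "dist z (cis t) < d'" for z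
    proof -
      have z1: "norm z < 1" "norm (z - cis t) < \<alpha> * (1 - norm z)" using z(1) by (auto simp: stolz_region_def dist_norm)
      have near: "1 - norm z \<le> dist z (cis t)"
        using norm_triangle_ineq2[of "cis t" z] by (simp add: dist_norm norm_minus_commute)
      hence zh: "norm z > 1/2" using z(2) by (simp add: d'_def)
      have "norm z * norm (deriv H z) \<le> 2 * (1 + \<alpha>) * A + 2 * (1 + \<alpha>) ^ 3 * B * (1 - (norm z)\<^sup>2)"
      proof (rule boundary_derivative_bound[OF contH holH norm_cis])
        fix w :: complex assume "norm w = 1"
        thus "norm (H w - H (cis t)) \<le> A * norm (w - cis t) + B * norm (w - cis t) ^ 3"
          unfolding B_def by (intro boundary_modulus_global d C) (use A in auto)
      qed (use A B z1 \<alpha> in auto)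
      also have "\<dots> \<le> 2 * (1 + \<alpha>) * A + 2 * (1 + \<alpha>) ^ 3 * B * (2 * dist z (cis t))"
      proof (intro add_left_mono mult_left_mono)
        have "1 - (norm z)\<^sup>2 = (1 - norm z) * (1 + norm z)" by (simp add: power2_eq_square algebra_simps)
        also have "\<dots> \<le> dist z (cis t) * 2" using near z1 by (intro mult_mono) auto
        finally show "1 - (norm z)\<^sup>2 \<le> 2 * dist z (cis t)" by simp
      qed (use B \<alpha> in auto)
      finally have le: "norm z * norm (deriv H z) \<le> 2 * (1 + \<alpha>) * A + 2 * (1 + \<alpha>) ^ 3 * B * (2 * dist z (cis t))" .
      have e1: "2 * (1 + \<alpha>) * A = e / 8" unfolding A_def using \<alpha> by (simp add: divide_simps)
      have e2: "2 * (1 + \<alpha>) ^ 3 * B * (2 * dist z (cis t)) = K / 2 * dist z (cis t)" by (simp add: K_def)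
      note le[unfolded e1 e2]
      moreover have "1/2 * norm (deriv H z) \<le> norm z * norm (deriv H z)" using zh by (intro mult_right_mono) auto
      ultimately have "norm (deriv H z) \<le> e / 4 + K * dist z (cis t)" by linarith
      also have "K * dist z (cis t) \<le> (K + 1) * (e / (2 * (K + 1)))"
        using z(2) K by (intro mult_mono) (auto simp: d'_def)
      also have "\<dots> = e / 2"
      proof -
        have *: "k * (e / (2 * k)) = e / 2" if "k \<noteq> 0" for k :: real using that by simp
        show ?thesis by (rule *) (use K in linarith)
      qed
      finally have "norm (deriv H z) \<le> e / 4 + e / 2" by simp
      thus ?thesis using dH[OF z1(1)] e by (simp add: dist_norm)
    qed
    ultimately show "\<exists>d>0. \<forall>x\<in>stolz_region (cis t) \<alpha>. 0 < dist x (cis t) \<and> dist x (cis t) < d \<longrightarrow> dist (F x) D < e"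
      by blast
  qed
qed

text \<open>At almost every angle Fatou's theorem recognizes the density as i cis(t) times a
  nontangential limit of F, so the hypothesis bounds it by M; integration gives the Lipschitz
  estimate.\<close>

lemma prim_Lipschitz:
  assumes \<tau>: "\<tau> \<le> 2 * pi" and M: "M \<ge> 0"
    and bd: "\<And>t w. 0 < t \<Longrightarrow> t < \<tau> \<Longrightarrow> nontangential_limit F (cis t) w \<Longrightarrow> norm w \<le> M"
    and xy: "0 \<le> x" "x \<le> y" "y \<le> \<tau>"
  shows "norm (prim c (cis y) - prim c (cis x)) \<le> M * (y - x)"
proof -
  obtain g where g: "\<And>x y. 0 \<le> x \<Longrightarrow> x \<le> y \<Longrightarrow> y \<le> 2*pi \<Longrightarrow> g integrable_on {x..y}"
    "\<And>x y. 0 \<le> x \<Longrightarrow> x \<le> y \<Longrightarrow> y \<le> 2*pi \<Longrightarrow> integral {x..y} g = prim c (cis y) - prim c (cis x)"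
    using boundary_density[OF c2 F hol] by blast
  obtain N where N: "negligible N" "\<And>t. 0 < t \<Longrightarrow> t < 2*pi \<Longrightarrow> t \<notin> N \<Longrightarrow> ((\<lambda>t. prim c (cis t)) has_vector_derivative g t) (at t)"
    using lebesgue_differentiation_interval[of 0 "2*pi" g "\<lambda>t. prim c (cis t)"] g by blast
  \<comment> \<open>The endpoints are thrown in because they may be 0 or tau, where neither the
    derivative nor the bound is available.\<close>
  define N' where "N' = N \<union> {x, y}"
  have N': "negligible N'" using N(1) by (simp add: N'_def)
  define k where "k t = (if t \<in> N' then 0 else g t)" for t
  have gi: "g integrable_on {x..y}" using g(1)[of x y] xy \<tau> by simp
  have ki: "k integrable_on {x..y}" by (rule integrable_spike[OF gi N']) (simp add: k_def)
  have ke: "integral {x..y} g = integral {x..y} k" by (rule integral_spike[OF N']) (simp add: k_def)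
  have kb: "norm (k t) \<le> M" if "t \<in> {x..y}" for t
  proof (cases "t \<in> N'")
    case False
    hence t: "x < t" "t < y" "t \<notin> N" using that by (auto simp: N'_def)
    have "nontangential_limit F (cis t) (g t / (\<i> * cis t))"
      by (rule Fatou_nontangential[OF N(2)]) (use t xy \<tau> in auto)
    from bd[OF _ _ this] have "norm (g t / (\<i> * cis t)) \<le> M" using t xy by simp
    thus ?thesis using False by (simp add: k_def norm_divide norm_mult)
  qed (use M in \<open>simp add: k_def\<close>)
  have "norm (integral {x..y} k) \<le> integral {x..y} (\<lambda>t. M)"
    by (rule integral_norm_bound_integral[OF ki]) (use kb in auto)
  also have "\<dots> = M * (y - x)" using xy by simp
  also have "integral {x..y} k = prim c (cis y) - prim c (cis x)" using ke g(2)[of x y] xy \<tau> by simp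
  finally show ?thesis .
qed

lemma bounded_near_arc:
  assumes \<tau>: "0 < \<tau>" "\<tau> \<le> 2 * pi"
    and bd: "\<And>t w. 0 < t \<Longrightarrow> t < \<tau> \<Longrightarrow> nontangential_limit F (cis t) w \<Longrightarrow> norm w \<le> M"
  obtains K where "\<And>r t. 1/2 < r \<Longrightarrow> r < 1 \<Longrightarrow> \<tau> / 4 \<le> t \<Longrightarrow> t \<le> 3 * \<tau> / 4 \<Longrightarrow> norm (F (of_real r * cis t)) \<le> K"
proof -
  define M' where "M' = max M 0"
  have M': "M' \<ge> 0" by (simp add: M'_def)
  have bd': "norm w \<le> M'" if "0 < t" "t < \<tau>" "nontangential_limit F (cis t) w" for t w
    using bd[OF that] by (simp add: M'_def)
  have lip: "norm (prim c (cis y) - prim c (cis x)) \<le> M' * (y - x)" if "0 \<le> x" "x \<le> y" "y \<le> \<tau>" for x y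
    by (rule prim_Lipschitz[OF \<tau>(2) M' _ that]) (rule bd')
  obtain C where C: "\<And>w. norm w \<le> 1 \<Longrightarrow> norm (prim c w) \<le> C" using prim_bounded by blast
  have C0: "C \<ge> 0" using C[of 0] norm_ge_zero order_trans by (metis norm_zero zero_le_one)
  define B where "B = 16 * C / (\<tau> / 4) ^ 3"
  have B: "B \<ge> 0" using C0 \<tau> by (simp add: B_def)
  have "norm (F (of_real r * cis t)) \<le> 2 * (8 * M' + 16 * B)"
    if r: "1/2 < r" "r < 1" and t: "\<tau> / 4 \<le> t" "t \<le> 3 * \<tau> / 4" for r t
  proof -
    let ?z = "of_real r * cis t"
    \<comment> \<open>Staying at distance tau/4 from the ends keeps the whole window around t inside
      [0, tau], with the same size for every t; this makes the final bound uniform.\<close>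
    have loc: "norm (prim c (cis y) - prim c (cis t)) \<le> (2 * M') / 2 * \<bar>y - t\<bar>" if "\<bar>y - t\<bar> < \<tau> / 4" for y
    proof (cases "y \<ge> t")
      case True
      thus ?thesis using lip[of t y] that t \<tau> by simp
    next
      case False
      thus ?thesis using lip[of y t] that t \<tau> by (simp add: norm_minus_commute)
    qed
    have nz: "norm ?z = r" using r by (simp add: norm_mult)
    have "norm ?z * norm (deriv (prim c) ?z) \<le> 2 * (1 + 1) * (2 * M') + 2 * (1 + 1) ^ 3 * B * (1 - (norm ?z)\<^sup>2)"
    proof (rule boundary_derivative_bound[OF continuous_prim[OF c2 F] prim_holomorphic norm_cis])
      fix w :: complex assume "norm w = 1"
      thus "norm (prim c w - prim c (cis t)) \<le> 2 * M' * norm (w - cis t) + B * norm (w - cis t) ^ 3"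
        unfolding B_def by (intro boundary_modulus_global loc C) (use M' \<tau> in auto)
    next
      \<comment> \<open>On the radius through cis t the distance to the boundary point is exactly 1
        - |z|, so the aperture is alpha = 1.\<close>
      have "?z - cis t = of_real (r - 1) * cis t" by (simp add: algebra_simps)
      hence "norm (?z - cis t) = \<bar>r - 1\<bar>" by (simp only: norm_mult norm_of_real norm_cis mult_1_right)
      thus "norm (?z - cis t) \<le> 1 * (1 - norm ?z)" using r nz by simp
    qed (use M' B r nz in auto)
    also have "\<dots> \<le> 2 * (1 + 1) * (2 * M') + 2 * (1 + 1) ^ 3 * B * 1"
      using B by (intro add_left_mono mult_left_mono) auto
    also have "deriv (prim c) ?z = F ?z" by (rule DERIV_imp_deriv[OF prim_deriv[OF c2 F]]) (use r nz in auto)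
    finally have "r * norm (F ?z) \<le> 8 * M' + 16 * B" unfolding nz by simp
    hence "2 * (r * norm (F ?z)) \<le> 2 * (8 * M' + 16 * B)" by (rule mult_left_mono) simp
    moreover have "1 * norm (F ?z) \<le> (2 * r) * norm (F ?z)" using r by (intro mult_right_mono) auto
    ultimately show ?thesis by (simp only: mult_1 mult.assoc)
  qed
  thus ?thesis using that by blast
qed

end

section \<open>Proof of the theorem\<close>

text \<open>Dominated convergence on the circle: 1 - |f|^2 is bounded by 1 and tends to 0 along
  almost every radius.\<close>

lemma inner_function_inner_like:
  assumes "inner_function f" "f 0 = 0"
  shows "inner_like f"
proof -
  have hol: "f holomorphic_on ball 0 1" and im: "f ` ball 0 1 \<subseteq> ball 0 1"
    and ae: "AE t in lebesgue_on {0..2*pi}. \<exists>w. radial_limit f (cis t) w \<and> norm w = 1"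
    using assms by (auto simp: inner_function_def)
  have cont: "continuous_on (ball 0 1) f" using hol by (rule holomorphic_on_imp_continuous_on)
  have contX: "continuous_on (ball 0 1) (\<lambda>z. norm (1 - (norm (f z))\<^sup>2))" by (intro continuous_intros cont)
  let ?M = "lebesgue_on {0..2*pi}"
  have "blim (\<lambda>z. norm (1 - (norm (f z))\<^sup>2)) 0"
  proof (rule tendsto_at_left_sequentially[where b = 0])
    fix S :: "nat \<Rightarrow> real"
    assume S: "\<And>n. S n < 1" "\<And>n. 0 < S n" "S \<longlonglongrightarrow> 1"
    let ?X = "\<lambda>n t. norm (1 - (norm (f (of_real (S n) * cis t)))\<^sup>2)"
    have cX: "continuous_on {0..2*pi} (?X n)" for n
      by (rule continuous_on_circle[OF contX]) (use S(1,2)[of n] in auto)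
    have iX: "integrable ?M (?X n)" for n
      using absolutely_integrable_continuous_real[OF cX] by (simp add: integrable_restrict_space set_integrable_def)
    have "(\<lambda>n. integral\<^sup>L ?M (?X n)) \<longlonglongrightarrow> integral\<^sup>L ?M (\<lambda>t. 0)"
    proof (rule integral_dominated_convergence[where w = "\<lambda>t. 1"])
      show "?X n \<in> borel_measurable ?M" for n using iX by (rule borel_measurable_integrable)
      show "integrable ?M (\<lambda>t. 1 :: real)"
        using absolutely_integrable_continuous_real[OF continuous_on_const, of 0 "2*pi" "1::real"]
        by (simp add: integrable_restrict_space set_integrable_def)
      show "AE t in ?M. norm (?X n t) \<le> 1" for n
      proof (rule AE_I2)
        fix t
        have "norm (f (of_real (S n) * cis t)) < 1"
          using im S(1,2)[of n] by (auto simp: image_subset_iff norm_mult)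
        hence "(norm (f (of_real (S n) * cis t)))\<^sup>2 \<le> 1" by (simp add: power_le_one)
        thus "norm (?X n t) \<le> 1" by simp
      qed
      show "AE t in ?M. (\<lambda>n. ?X n t) \<longlonglongrightarrow> 0"
        using ae
      proof eventually_elim
        case (elim t)
        then obtain w where w: "radial_limit f (cis t) w" "norm w = 1" by blast
        have "S n \<noteq> 1" for n using S(1)[of n] by simp
        hence "filterlim S (at_left 1) sequentially"
          unfolding filterlim_at using S by (auto intro!: always_eventually)
        from filterlim_compose[OF w(1)[unfolded radial_limit_def] this]
        have "(\<lambda>n. f (of_real (S n) * cis t)) \<longlonglongrightarrow> w" .
        hence "(\<lambda>n. ?X n t) \<longlonglongrightarrow> norm (1 - (norm w)\<^sup>2)" by (intro tendsto_intros)
        thus ?case using w by simp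
      qed
    qed auto
    moreover have "integral\<^sup>L ?M (?X n) = integral {0..2*pi} (?X n)" for n
      by (rule lebesgue_integral_eq_integral[OF iX]) simp
    ultimately have "(\<lambda>n. integral {0..2*pi} (?X n)) \<longlonglongrightarrow> 0" by simp
    hence "(\<lambda>n. (1 / (2*pi)) *\<^sub>R integral {0..2*pi} (?X n)) \<longlonglongrightarrow> (1 / (2*pi)) *\<^sub>R 0" by (intro tendsto_intros)
    thus "(\<lambda>n. circ_mean (S n) (\<lambda>z. norm (1 - (norm (f z))\<^sup>2))) \<longlonglongrightarrow> 0"
      by (simp add: circ_mean_def)
  qed simp
  thus ?thesis using hol im assms(2) by (simp add: inner_like_def bnull_def)
qed

text \<open>Equality |f(z)| = |z| at some z other than 0, or |f'(0)| = 1, is the equality case of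
  Schwarz's lemma.\<close>

lemma norm_shift_less_1:
  assumes "inner_like f" "\<not> rotation f" "norm z < 1"
  shows "norm (shift f z) < 1"
proof (rule ccontr)
  assume neg: "\<not> norm (shift f z) < 1"
  note S = Schwarz_Lemma[OF inner_likeD(1)[OF assms(1)] inner_likeD(3)[OF assms(1)] inner_like_norm_lt[OF assms(1)]]
  have "(\<exists>z. norm z < 1 \<and> z \<noteq> 0 \<and> norm (f z) = norm z) \<or> norm (deriv f 0) = 1"
  proof (cases "z = 0")
    case True
    thus ?thesis using neg S(2)[of 0] by (simp add: shift_def)
  next
    case False
    have "norm (f z) = norm z * norm (shift f z)"
      using shift_eq[of f z] inner_likeD(3)[OF assms(1)] by (simp add: norm_mult)
    hence "norm z \<le> norm (f z)" using neg mult_left_mono[of 1 "norm (shift f z)" "norm z"] by simp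
    moreover have "norm (f z) \<le> norm z" by (rule S(1)[OF _ assms(3)]) 
    ultimately show ?thesis using False assms(3) by (intro disjI1 exI[of _ z]) auto
  qed
  from S(3)[OF _ _ this, of 0] obtain \<alpha> where "\<forall>z. norm z < 1 \<longrightarrow> f z = \<alpha> * z" "norm \<alpha> = 1" by auto
  hence "rotation f" unfolding rotation_def by auto
  thus False using assms(2) by contradiction
qed

section \<open>Reduction to an arc starting at angle 0, and the weight\<close>

lemma nontangential_limit_rotate:
  assumes "nontangential_limit (\<lambda>z. F (cis s * z)) \<xi> w"
  shows "nontangential_limit F (cis s * \<xi>) w"
  unfolding nontangential_limit_def Lim_within
proof (intro allI impI)
  fix \<alpha> e :: real assume \<alpha>: "\<alpha> > 1" and e: "e > 0"
  from assms \<alpha> e obtain d where d: "d > 0"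
    "\<And>z. z \<in> stolz_region \<xi> \<alpha> \<Longrightarrow> 0 < dist z \<xi> \<Longrightarrow> dist z \<xi> < d \<Longrightarrow> dist (F (cis s * z)) w < e"
    unfolding nontangential_limit_def Lim_within by metis
  show "\<exists>d>0. \<forall>z\<in>stolz_region (cis s * \<xi>) \<alpha>. 0 < dist z (cis s * \<xi>) \<and> dist z (cis s * \<xi>) < d \<longrightarrow> dist (F z) w < e"
  proof (intro exI[of _ d] conjI ballI impI d(1))
    fix z assume z: "z \<in> stolz_region (cis s * \<xi>) \<alpha>" "0 < dist z (cis s * \<xi>) \<and> dist z (cis s * \<xi>) < d"
    define y where "y = cis (- s) * z"
    have zy: "z = cis s * y" by (simp add: y_def mult.assoc[symmetric] cis_mult)
    have "z - cis s * \<xi> = cis s * (y - \<xi>)" by (simp add: zy algebra_simps)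
    hence dist: "dist z (cis s * \<xi>) = dist y \<xi>" by (simp add: dist_norm norm_mult)
    have n: "norm z = norm y" by (simp add: zy norm_mult)
    have "y \<in> stolz_region \<xi> \<alpha>" using z(1) by (simp add: stolz_region_def dist n)
    from d(2)[OF this] show "dist (F z) w < e" using z(2) by (simp add: dist zy[symmetric])
  qed
qed

text \<open>The boundary density lives on angles from 0 to 2 pi. Rotating by s makes the arc start
  at 0, so that it cannot straddle the end of that interval; what remains is its middle
  half.\<close>

lemma bounded_near_circle_arc:
  assumes F: "F \<in> hardy2" and st: "s < t" "t \<le> s + 2 * pi" and I: "cis ` {s<..<t} \<subseteq> I"
    and bdd: "bdd_above {norm w |\<xi> w. \<xi> \<in> I \<and> nontangential_limit F \<xi> w}"
  obtains K where "\<And>r y. 1/2 < r \<Longrightarrow> r < 1 \<Longrightarrow> \<bar>y - (s + t) / 2\<bar> \<le> (t - s) / 4 \<Longrightarrow> norm (F (of_real r * cis y)) \<le> K"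
proof -
  define c where "c n = (deriv ^^ n) F 0 / fact n * cis s ^ n" for n
  define G where "G z = F (cis s * z)" for z
  obtain M where M: "\<And>\<xi> w. \<xi> \<in> I \<Longrightarrow> nontangential_limit F \<xi> w \<Longrightarrow> norm w \<le> M"
    using bdd unfolding bdd_above_def by blast
  have hol: "F holomorphic_on ball 0 1" using F by (simp add: hardy2_def)
  have Gs: "(\<lambda>n. c n * z ^ n) sums G z" if "norm z < 1" for z
    using hardy2_coeffs(1)[OF F, of "cis s * z"] that by (simp add: c_def G_def norm_mult power_mult_distrib mult.assoc)
  have c2: "summable (\<lambda>n. (norm (c n))\<^sup>2)"
  proof -
    have "norm (c n) = norm ((deriv ^^ n) F 0 / fact n)" for n
      unfolding c_def norm_mult norm_power by simp
    thus ?thesis using hardy2_coeffs(2)[OF F] by (simp only:)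
  qed
  have holG: "G holomorphic_on ball 0 1"
  proof -
    have "(F \<circ> (\<lambda>z. cis s * z)) holomorphic_on ball 0 1"
      by (rule holomorphic_on_compose_gen[OF _ hol]) (auto intro!: holomorphic_intros simp: norm_mult)
    thus ?thesis by (simp add: G_def[abs_def] o_def)
  qed
  have bd: "norm w \<le> M" if "0 < x" "x < t - s" "nontangential_limit G (cis x) w" for x w
  proof (rule M)
    show "nontangential_limit F (cis s * cis x) w"
      using that(3) unfolding G_def[abs_def] by (rule nontangential_limit_rotate)
    show "cis s * cis x \<in> I" using that I by (auto simp: cis_mult)
  qed
  have \<tau>: "0 < t - s" "t - s \<le> 2 * pi" using st by auto
  have "\<exists>K. \<forall>r x. 1/2 < r \<longrightarrow> r < 1 \<longrightarrow> (t - s) / 4 \<le> x \<longrightarrow> x \<le> 3 * (t - s) / 4 \<longrightarrow> norm (G (of_real r * cis x)) \<le> K"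
    by (rule bounded_near_arc[of c G "t - s" M];
        (fact c2 | fact holG | fact \<tau> | (rule Gs, assumption) | (rule bd; assumption) | blast))
  then obtain K where K: "\<And>r x. 1/2 < r \<Longrightarrow> r < 1 \<Longrightarrow> (t - s) / 4 \<le> x \<Longrightarrow> x \<le> 3 * (t - s) / 4 \<Longrightarrow> norm (G (of_real r * cis x)) \<le> K"
    by blast
  show ?thesis
  proof (rule that)
    fix r y :: real assume r: "1/2 < r" "r < 1" and y: "\<bar>y - (s + t) / 2\<bar> \<le> (t - s) / 4"
    have "(t - s) / 4 \<le> y - s" "y - s \<le> 3 * (t - s) / 4"
      using y unfolding abs_le_iff by (simp_all add: field_simps)
    from K[OF r this] have "norm (F (cis s * (of_real r * cis (y - s)))) \<le> K" by (simp add: G_def)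
    moreover have "cis s * (of_real r * cis (y - s)) = of_real r * cis y"
      by (simp add: cis_mult mult.left_commute)
    ultimately show "norm (F (of_real r * cis y)) \<le> K" by simp
  qed
qed

lemma sector_weight:
  assumes "0 < \<sigma>" "\<sigma> \<le> pi / 2"
  obtains W :: "complex \<Rightarrow> real" and w where
    "continuous_on (cball 0 1) W" "\<And>z. norm z \<le> 1 \<Longrightarrow> 0 \<le> W z \<and> W z \<le> 1" "blim W w" "w > 0"
    "\<And>z. W z > 0 \<Longrightarrow> \<exists>y. z = of_real (norm z) * cis y \<and> \<bar>y - \<theta>\<bar> \<le> \<sigma>"
proof -
  \<comment> \<open>For z = rho cis(y) this is rho times the positive part of cos(y - theta) -
    cos(sigma), hence supported in the sector of half-angle sigma. The factor rho keeps it
    continuous at 0.\<close>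
  define W where "W z = max 0 (Re (z * cnj (cis \<theta>)) - cos \<sigma> * norm z)" for z
  have contW: "continuous_on S W" for S unfolding W_def[abs_def] by (intro continuous_intros)
  have cos0: "0 \<le> cos \<sigma>" by (rule cos_ge_zero) (use assms in auto)
  have cos1: "cos \<sigma> < 1" using cos_monotone_0_pi[of 0 \<sigma>] assms by simp
  have W1: "0 \<le> W z \<and> W z \<le> 1" if "norm z \<le> 1" for z
  proof -
    have "Re (z * cnj (cis \<theta>)) \<le> norm (z * cnj (cis \<theta>))" by (rule complex_Re_le_cmod)
    hence "Re (z * cnj (cis \<theta>)) \<le> 1" using that by (simp only: norm_mult complex_mod_cnj norm_cis mult_1_right)
    moreover have "0 \<le> cos \<sigma> * norm z" using cos0 by simp
    ultimately show ?thesis unfolding W_def by (simp only: max.cobounded1 max.bounded_iff simp_thms) simp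
  qed
  define w where "w = circ_mean 1 W"
  have lim: "blim W w"
  proof (rule Lim_transform_eventually)
    \<comment> \<open>W is positively homogeneous of degree 1, so its mean at radius r is r times
      the mean at radius 1.\<close>
    show "((\<lambda>r. r * w) \<longlongrightarrow> w) (at_left 1)" by (rule tendsto_eq_intros refl | simp)+
    show "\<forall>\<^sub>F r in at_left 1. r * w = circ_mean r W"
      using eventually_at_left_1
    proof eventually_elim
      case (elim r)
      have "W (of_real r * cis t) = r * W (cis t)" for t
      proof -
        have "Re (of_real r * cis t * cnj (cis \<theta>)) - cos \<sigma> * norm (of_real r * cis t)
          = r * (Re (cis t * cnj (cis \<theta>)) - cos \<sigma> * norm (cis t))"
          using elim by (simp add: norm_mult algebra_simps)
        thus ?thesis using elim unfolding W_def by (simp only: max_mult_distrib_left) simp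
      qed
      thus ?case by (simp add: circ_mean_def w_def)
    qed
  qed
  have "w \<noteq> 0"
  proof
    assume "w = 0"
    hence "integral {0..2*pi} (\<lambda>t. W (cis t)) = 0" by (simp add: w_def circ_mean_def)
    moreover have "continuous_on {0..2*pi} (\<lambda>t. W (cis t))"
      by (intro continuous_on_compose2[OF contW[of UNIV]] continuous_intros) auto
    ultimately have z: "\<forall>t\<in>{0..2*pi}. W (cis t) = 0"
      using integral_eq_0_iff[of 0 "2*pi" "\<lambda>t. W (cis t)"] W1 by simp
    obtain y where y: "cis \<theta> = cis y" "\<bar>y - pi\<bar> \<le> pi" using circle_param[of "cis \<theta>" pi] by auto
    have "y \<in> {0..2*pi}" using y(2) unfolding abs_le_iff by auto
    hence "W (cis \<theta>) = 0" using z y(1) by auto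
    thus False using cos1 by (simp add: W_def cis_cnj cis_mult)
  qed
  moreover have "w \<ge> 0"
  proof -
    have "0 \<le> integral {0..2*pi} (\<lambda>t. W (cis t))"
      by (intro integral_nonneg integrable_continuous_real continuous_on_compose2[OF contW[of UNIV]] continuous_intros)
        (use W1 in auto)
    thus ?thesis by (simp add: w_def circ_mean_def)
  qed
  ultimately have "w > 0" by simp
  moreover have "\<exists>y. z = of_real (norm z) * cis y \<and> \<bar>y - \<theta>\<bar> \<le> \<sigma>" if "W z > 0" for z
  proof -
    have z0: "z \<noteq> 0" using that by (auto simp: W_def)
    obtain y where y: "z / of_real (norm z) = cis y" "\<bar>y - \<theta>\<bar> \<le> pi"
      using circle_param[of "z / of_real (norm z)" \<theta>] z0 by (auto simp: norm_divide)
    have zy: "z = of_real (norm z) * cis y" using y(1) z0 by (simp add: field_simps)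
    have "\<bar>y - \<theta>\<bar> \<le> \<sigma>"
    proof (rule ccontr)
      assume "\<not> \<bar>y - \<theta>\<bar> \<le> \<sigma>"
      hence "cos \<bar>y - \<theta>\<bar> \<le> cos \<sigma>" using y(2) assms by (intro cos_monotone_0_pi_le) auto
      hence le: "cos (y - \<theta>) \<le> cos \<sigma>" by simp
      have "z * cnj (cis \<theta>) = of_real (norm z) * cis (y - \<theta>)"
        by (subst zy) (simp add: cis_cnj cis_mult mult.assoc)
      hence "Re (z * cnj (cis \<theta>)) = norm z * cos (y - \<theta>)" by simp
      also have "\<dots> \<le> norm z * cos \<sigma>" using le by (intro mult_left_mono) auto
      finally have "W z = 0" by (simp add: W_def mult.commute)
      thus False using that by simp
    qed
    thus ?thesis using zy by blast
  qed
  ultimately show ?thesis using that[OF contW W1 lim] by blast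
qed

text \<open>\<open>hardy2_norm\<close> is a real supremum and dominates the individual means only
  once these are known to be bounded; 2 |F|^2 + 2 |U|^2 provides that.\<close>

lemma hardy2_norm_bound:
  assumes F: "F \<in> hardy2" and U: "bh U" and r: "0 < r" "r < 1"
  shows "circ_mean r (\<lambda>z. (norm (F z - U z))\<^sup>2) \<le> (hardy2_norm (\<lambda>z. F z - U z))\<^sup>2"
proof -
  let ?g = "\<lambda>z. F z - U z"
  have sm: "square_mean g q = circ_mean q (\<lambda>z. (norm (g z))\<^sup>2)" for g :: "complex \<Rightarrow> complex" and q
    by (simp add: square_mean_def circ_mean_def)
  have contF: "continuous_on (ball 0 1) F" using F by (simp add: hardy2_def holomorphic_on_imp_continuous_on)
  have contU: "continuous_on (ball 0 1) U" by (rule cb_cont[OF bh_imp_cb[OF U]])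
  obtain C where C: "\<And>q. q \<in> {0..<1} \<Longrightarrow> square_mean F q \<le> C"
    using F unfolding hardy2_def bdd_above_def by blast
  obtain K where K: "K > 0" "\<And>z. norm z < 1 \<Longrightarrow> norm (U z) \<le> K" using cb_bound[OF bh_imp_cb[OF U]] by metis
  have "square_mean ?g q \<le> 2 * C + 2 * K\<^sup>2" if q: "q \<in> {0..<1}" for q
  proof -
    have q': "\<bar>q\<bar> < 1" using q by auto
    have "square_mean ?g q \<le> circ_mean q (\<lambda>z. 2 * (norm (F z))\<^sup>2 + 2 * K\<^sup>2)"
      unfolding sm
    proof (rule circ_mean_mono[OF q'])
      fix z :: complex assume "norm z = \<bar>q\<bar>"
      hence z: "norm z < 1" using q' by simp
      have "(norm (F z - U z))\<^sup>2 \<le> (norm (F z) + norm (U z))\<^sup>2" by (intro power_mono norm_triangle_ineq4) auto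
      also have "\<dots> \<le> 2 * (norm (F z))\<^sup>2 + 2 * (norm (U z))\<^sup>2"
        using sum_squares_bound[of "norm (F z)" "norm (U z)"] by (simp add: power2_sum)
      also have "(norm (U z))\<^sup>2 \<le> K\<^sup>2" using K(2)[OF z] by (intro power_mono) auto
      finally show "(norm (F z - U z))\<^sup>2 \<le> 2 * (norm (F z))\<^sup>2 + 2 * K\<^sup>2" by simp
    qed (intro continuous_intros contF contU)+
    also have "\<dots> = circ_mean q (\<lambda>z. 2 * (norm (F z))\<^sup>2) + 2 * K\<^sup>2"
      by (subst circ_mean_add[OF q']) (auto intro!: continuous_intros contF simp: circ_mean_const[OF q'])
    also have "circ_mean q (\<lambda>z. 2 * (norm (F z))\<^sup>2) = 2 * square_mean F q"
      unfolding sm by (rule circ_mean_cmult[OF q']) (intro continuous_intros contF)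
    finally show ?thesis using C[OF q] by simp
  qed
  hence bdd: "bdd_above (square_mean ?g ` {0..<1})" by (intro bdd_aboveI[of _ "2 * C + 2 * K\<^sup>2"]) blast
  have le: "square_mean ?g r \<le> (SUP q\<in>{0..<1}. square_mean ?g q)"
    by (rule cSUP_upper[OF _ bdd]) (use r in auto)
  have "0 \<le> square_mean ?g r" unfolding sm
    by (rule circ_mean_nonneg) (use r in \<open>auto intro!: continuous_intros contF contU\<close>)
  hence "(hardy2_norm ?g)\<^sup>2 = (SUP q\<in>{0..<1}. square_mean ?g q)" unfolding hardy2_norm_def using le by simp
  thus ?thesis using le unfolding sm by simp
qed

text \<open>The sequence starts at index 1, hence \<open>a (Suc n)\<close>. The supremum is taken
  over those points of I where the nontangential limit exists, and its finiteness reads as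
  boundedness above.\<close>

theorem theorem1p5:
  fixes f F :: "complex \<Rightarrow> complex" and a :: "nat \<Rightarrow> complex" and I :: "complex set"
  assumes "inner_function f" and "f 0 = 0" and "\<not> rotation f"
    and "summable (\<lambda>n. (norm (a (Suc n)))\<^sup>2)"
    and "hardy2_sums (\<lambda>n z. a (Suc n) * (f ^^ Suc n) z) F"
    and "circle_arc I"
    and "bdd_above {norm w |\<xi> w. \<xi> \<in> I \<and> nontangential_limit F \<xi> w}"
  shows "summable (\<lambda>n. norm (a (Suc n)))"
proof -
  have f: "inner_like f" by (rule inner_function_inner_like[OF assms(1,2)])
  have F: "F \<in> hardy2" using assms(5) by (simp add: hardy2_sums_def)
  obtain s t where st: "s < t" "t \<le> s + 2 * pi" "cis ` {s<..<t} \<subseteq> I"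
    using assms(6) unfolding circle_arc_def by blast
  obtain K where K: "\<And>r y. 1/2 < r \<Longrightarrow> r < 1 \<Longrightarrow> \<bar>y - (s + t) / 2\<bar> \<le> (t - s) / 4 \<Longrightarrow> norm (F (of_real r * cis y)) \<le> K"
    using bounded_near_circle_arc[OF F st assms(7)] by blast
  have \<sigma>: "0 < (t - s) / 4" "(t - s) / 4 \<le> pi / 2" using st by auto
  obtain W :: "complex \<Rightarrow> real" and w where W: "continuous_on (cball 0 1) W" "\<And>z. norm z \<le> 1 \<Longrightarrow> 0 \<le> W z \<and> W z \<le> 1"
    "blim W w" "w > 0" "\<And>z. W z > 0 \<Longrightarrow> \<exists>y. z = of_real (norm z) * cis y \<and> \<bar>y - (s + t) / 2\<bar> \<le> (t - s) / 4"
    using sector_weight[OF \<sigma>, of "(s + t) / 2"] by blast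
  \<comment> \<open>The Riesz product argument sums from index 0, where the iterate is the identity;
    the coefficient 0 there leaves the series unchanged.\<close>
  define \<alpha> where "\<alpha> n = (if n = 0 then 0 else a n)" for n
  have sum_eq: "(\<Sum>n<Suc N. \<alpha> n * (f ^^ n) z) = (\<Sum>n<N. a (Suc n) * (f ^^ Suc n) z)" for N z
    unfolding sum.lessThan_Suc_shift by (simp add: \<alpha>_def)
  define S where "S N = (hardy2_norm (\<lambda>z. F z - (\<Sum>n<N. a (Suc n) * (f ^^ Suc n) z)))\<^sup>2" for N
  have "summable (\<lambda>n. norm (\<alpha> n))"
  proof (rule Riesz_product_summable[OF f])
    show "norm (shift f z) < 1" if "norm z < 1" for z by (rule norm_shift_less_1[OF f assms(3) that])
    show "norm (\<alpha> n) \<le> sqrt (\<Sum>n. (norm (a (Suc n)))\<^sup>2)" for n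
    proof (cases n)
      case 0
      thus ?thesis using suminf_nonneg[OF assms(4)] by (simp add: \<alpha>_def)
    next
      case (Suc k)
      have "(norm (a (Suc k)))\<^sup>2 \<le> (\<Sum>n. (norm (a (Suc n)))\<^sup>2)"
        using sum_le_suminf[OF assms(4), of "{k}"] by simp
      hence "norm (a (Suc k)) \<le> sqrt (\<Sum>n. (norm (a (Suc n)))\<^sup>2)" by (rule real_le_rsqrt)
      thus ?thesis using Suc by (simp add: \<alpha>_def)
    qed
    show "continuous_on (ball 0 1) F" using F by (simp add: hardy2_def holomorphic_on_imp_continuous_on)
    show "norm (F z) \<le> K" if "1/2 < norm z" "norm z < 1" "W z > 0" for z
    proof -
      from W(5)[OF that(3)] obtain y where "z = of_real (norm z) * cis y" "\<bar>y - (s + t) / 2\<bar> \<le> (t - s) / 4" by blast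
      thus ?thesis using K[OF that(1,2), of y] by simp
    qed
    show "circ_mean r (\<lambda>z. (norm (F z - (\<Sum>n<Suc N. \<alpha> n * (f ^^ n) z)))\<^sup>2) \<le> S N" if "0 < r" "r < 1" for N r
      unfolding sum_eq S_def
      by (rule hardy2_norm_bound[OF F _ that]) (intro bh_sum bh_mult bh_const inner_like_bh inner_like_iterate f)
    have "S \<longlonglongrightarrow> 0\<^sup>2" unfolding S_def[abs_def]
      using assms(5) by (intro tendsto_power) (simp add: hardy2_sums_def)
    thus "S \<longlonglongrightarrow> 0" by simp
  qed (use W in auto)
  hence "summable (\<lambda>n. norm (\<alpha> (Suc n)))" by (subst summable_Suc_iff)
  thus ?thesis by (simp add: \<alpha>_def)
qed

end
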